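(* The commutator subgroup $F'$ of R. Thompson's group $F$ is a diagram group. Namely, $F'\cong\mathcal{D}(\mathcal{Q},a_0b_0)$, where $$\mathcal{Q}=\langle x,\ a_i,\ b_i\ (i\ge0)\mid x=xx,\ a_i=a_{i+1}x,\ b_i=xb_{i+1}\ (i\ge0)\rangle .$$
   Context: R. Thompson's group $F$ is the group, under composition, of all increasing continuous piecewise linear maps of $[0,1]$ onto itself whose singularities occur at finitely many dyadic points (points of the form $m/2^n$) and all of whose slopes are integer powers of $2$; it is isomorphic to the diagram group $\mathcal{D}(\langle x\mid xx=x\rangle,x)$. Diagram groups. A semigroup presentation $\mathcal{P}=\langle\Sigma\mid\mathcal{R}\rangle$ consists of an alphabet $\Sigma$ and a set $\mathcal{R}$ of pairs $(u,v)$ of non-empty words over $\Sigma$, written $u=v$; presentations are assumed anti-symmetric: if $(u=v)\in\mathcal{R}$ then $(v=u)\notin\mathcal{R}$. $\Sigma^+$ and $\Sigma^*$ are the free semigroup and free monoid on $\Sigma$. The graph $\Gamma(\mathcal{P})$ has vertex set $\Sigma^+$ and an edge $(p,u\to v,q)$ from $puq$ to $pvq$ for all $p,q\in\Sigma^*$ and all $u,v$ with $(u=v)\in\mathcal{R}$ or $(v=u)\in\mathcal{R}$; the inverse edge is $(p,v\to u,q)$. The Squier complex $\mathcal{K}(\mathcal{P})$ is the 2-complex obtained from $\Gamma(\mathcal{P})$ by attaching, for all $p,z,q\in\Sigma^*$ and $(\ell_1=r_1),(\ell_2=r_2)\in\mathcal{R}$, a 2-cell along the closed path $p_1p_2^{-1}$,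 where $p_1=(p,\ell_1\to r_1,z\ell_2q)(pr_1z,\ell_2\to r_2,q)$ and $p_2=(p\ell_1z,\ell_2\to r_2,q)(p,\ell_1\to r_1,zr_2q)$. For $w\in\Sigma^+$ the diagram group $\mathcal{D}(\mathcal{P},w)$ is (up to isomorphism, by Kilibarda's theorem; this may be taken as the definition) the fundamental group $\pi_1(\mathcal{K}(\mathcal{P}),w)$. A group is a diagram group if it is isomorphic to some $\mathcal{D}(\mathcal{P},w)$. *)

theory Defs
  imports "HOL-Analysis.Analysis" "HOL-Algebra.Bij" "HOL-Algebra.Generated_Groups"
begin

section \<open>R. Thompson's group \<open>F\<close>\<close>

definition dyadics :: "real set" where
  "dyadics = {of_int m / 2 ^ n | (m :: int) (n :: nat). True}"

text \<open>The set \<open>D\<close> contains all singularities: \<open>f\<close> is affine, with slope an integer power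
  of 2, on every subinterval having no point of \<open>D\<close> in its interior. Maps of the unit interval
  are represented by functions that are \<open>undefined\<close> outside it, as in \<open>BijGroup\<close>.\<close>

definition thompson_maps :: "(real \<Rightarrow> real) set" where
  "thompson_maps = {f \<in> extensional {0..1}.
     strict_mono_on {0..1} f \<and> continuous_on {0..1} f \<and> f ` {0..1} = {0..1} \<and>
     (\<exists>D. finite D \<and> D \<subseteq> dyadics \<and>
        (\<forall>a b. 0 \<le> a \<and> a < b \<and> b \<le> 1 \<and> D \<inter> {a<..<b} = {} \<longrightarrow>
           (\<exists>(k :: int) c. \<forall>x\<in>{a..b}. f x = 2 powi k * x + c)))}"

definition thompson_F :: "(real \<Rightarrow> real) monoid" where
  "thompson_F = BijGroup {0..1} \<lparr>carrier := thompson_maps\<rparr>"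

definition commutator_subgroup :: "'a monoid \<Rightarrow> 'a monoid" where
  "commutator_subgroup G = G \<lparr>carrier := derived G (carrier G)\<rparr>"


section \<open>The fundamental group of a 2-complex\<close>

text \<open>Every edge \<open>e\<close> comes with an inverse edge \<open>einv e\<close>. A 2-cell is recorded by the closed
  edge path along which it is attached. The fundamental group is the combinatorial one: closed
  edge paths modulo insertion and deletion of subpaths \<open>e e\<inverse>\<close> and of attaching paths of
  2-cells. Cyclic shifts and inverses of attaching paths need no separate clauses.\<close>

record ('v, 'e) two_complex =
  verts :: "'v set"
  edges :: "'e set"
  src :: "'e \<Rightarrow> 'v"
  tgt :: "'e \<Rightarrow> 'v"
  einv :: "'e \<Rightarrow> 'e"
  cells :: "'e list set"

primrec is_path :: "('v, 'e) two_complex \<Rightarrow> 'v \<Rightarrow> 'e list \<Rightarrow> 'v \<Rightarrow> bool" where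
  "is_path K u [] w \<longleftrightarrow> u \<in> verts K \<and> u = w"
| "is_path K u (e # es) w \<longleftrightarrow> e \<in> edges K \<and> src K e = u \<and> is_path K (tgt K e) es w"

definition path_inv :: "('v, 'e) two_complex \<Rightarrow> 'e list \<Rightarrow> 'e list" where
  "path_inv K es = rev (map (einv K) es)"

definition loops :: "('v, 'e) two_complex \<Rightarrow> 'v \<Rightarrow> 'e list set" where
  "loops K v = {es. is_path K v es v}"

inductive homotopic_loops :: "('v, 'e) two_complex \<Rightarrow> 'v \<Rightarrow> 'e list \<Rightarrow> 'e list \<Rightarrow> bool"
  for K v where
  refl: "f \<in> loops K v \<Longrightarrow> homotopic_loops K v f f"
| sym: "homotopic_loops K v f g \<Longrightarrow> homotopic_loops K v g f"
| trans: "homotopic_loops K v f g \<Longrightarrow> homotopic_loops K v g h \<Longrightarrow> homotopic_loops K v f h"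
| cancel: "f @ [e, einv K e] @ g \<in> loops K v \<Longrightarrow>
    homotopic_loops K v (f @ [e, einv K e] @ g) (f @ g)"
| cell: "c \<in> cells K \<Longrightarrow> f @ c @ g \<in> loops K v \<Longrightarrow>
    homotopic_loops K v (f @ c @ g) (f @ g)"

definition loop_rel :: "('v, 'e) two_complex \<Rightarrow> 'v \<Rightarrow> ('e list \<times> 'e list) set" where
  "loop_rel K v = {(f, g). homotopic_loops K v f g}"

definition pi1 :: "('v, 'e) two_complex \<Rightarrow> 'v \<Rightarrow> 'e list set monoid" where
  "pi1 K v =
    \<lparr>carrier = loops K v // loop_rel K v,
     mult = (\<lambda>X Y. \<Union>f\<in>X. \<Union>g\<in>Y. loop_rel K v `` {f @ g}),
     one = loop_rel K v `` {[]}\<rparr>"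


section \<open>Semigroup presentations and diagram groups\<close>

record 's presentation =
  alphabet :: "'s set"
  rels :: "('s list \<times> 's list) set"

definition semigroup_presentation :: "'s presentation \<Rightarrow> bool" where
  "semigroup_presentation P \<longleftrightarrow>
     (\<forall>(u, v) \<in> rels P. u \<in> lists (alphabet P) - {[]} \<and> v \<in> lists (alphabet P) - {[]}) \<and>
     (\<forall>(u, v) \<in> rels P. (v, u) \<notin> rels P)"

text \<open>The tuple \<open>(p, u, v, q)\<close> encodes the edge \<open>(p, u \<rightarrow> v, q)\<close> from \<open>puq\<close> to \<open>pvq\<close>.\<close>

type_synonym 's sq_edge = "'s list \<times> 's list \<times> 's list \<times> 's list"

definition squier_graph :: "'s presentation \<Rightarrow> ('s list, 's sq_edge) two_complex" where
  "squier_graph P =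
    \<lparr>verts = lists (alphabet P) - {[]},
     edges = {(p, u, v, q). p \<in> lists (alphabet P) \<and> q \<in> lists (alphabet P) \<and>
                ((u, v) \<in> rels P \<or> (v, u) \<in> rels P)},
     src = (\<lambda>(p, u, v, q). p @ u @ q),
     tgt = (\<lambda>(p, u, v, q). p @ v @ q),
     einv = (\<lambda>(p, u, v, q). (p, v, u, q)),
     cells = {}\<rparr>"

definition squier_complex :: "'s presentation \<Rightarrow> ('s list, 's sq_edge) two_complex" where
  "squier_complex P = squier_graph P
    \<lparr>cells := {[(p, l1, r1, z @ l2 @ q), (p @ r1 @ z, l2, r2, q)] @
               path_inv (squier_graph P)
                 [(p @ l1 @ z, l2, r2, q), (p, l1, r1, z @ r2 @ q)] | p z q l1 r1 l2 r2.
               p \<in> lists (alphabet P) \<and> z \<in> lists (alphabet P) \<and> q \<in> lists (alphabet P) \<and>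
               (l1, r1) \<in> rels P \<and> (l2, r2) \<in> rels P}\<rparr>"

definition diagram_group :: "'s presentation \<Rightarrow> 's list \<Rightarrow> 's sq_edge list set monoid" where
  "diagram_group P w = pi1 (squier_complex P) w"

text \<open>HOL has no quantification over types, so the type from which the letters of the
  presentation are drawn is an explicit parameter.\<close>

definition is_diagram_group :: "'s itself \<Rightarrow> 'g monoid \<Rightarrow> bool" where
  "is_diagram_group _ G \<longleftrightarrow>
     (\<exists>(P :: 's presentation) w. semigroup_presentation P \<and> w \<in> lists (alphabet P) - {[]} \<and>
        G \<cong> diagram_group P w)"


section \<open>The presentation \<open>\<Q>\<close>\<close>

datatype letter = Lx | La nat | Lb nat

definition Q_pres :: "letter presentation" where
  "Q_pres =
    \<lparr>alphabet = UNIV,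
     rels = {([Lx], [Lx, Lx])} \<union> {([La i], [La (Suc i), Lx]) | i. True}
              \<union> {([Lb i], [Lx, Lb (Suc i)]) | i. True}\<rparr>"

lemma semigroup_presentation_Q_pres: "semigroup_presentation Q_pres"
  by (auto simp: semigroup_presentation_def Q_pres_def)

end

theory Submission
  imports Defs
begin

text \<open>Read a word $a_i x^n b_j$ as the real line cut into pieces: $a_i$ is the half line ending at $-i$,
then come $n$ unit intervals, and $b_j$ is a right half line, whose own coordinate starts at $j$.
Splitting a unit interval off a half line, as in $a_i \to a_{i+1}x$ or $b_j \to xb_{j+1}$, changes
nothing in the picture. The edge $x \to xx$ at the unit interval $[m,m+1]$ is a real change, and it
is the map \<open>caret m\<close>: identity to the left of $m$, stretching $[m,m+1]$ by the factor 2, and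
translation by 1 further right. So every edge path that starts at $a_0b_0$ carries a word in the
letters \<open>caret m\<close> and their inverses, and a loop acts on the line as a piecewise linear
homeomorphism with bounded support. The theorem says that this action is an isomorphism onto a
copy of $F'$, and there are three parts to it.

The action is faithful. A 2-cell for two independent splittings $x \to xx$ gives the relation
\<open>caret m \<circ> caret n = caret (n + 1) \<circ> caret m\<close> for $m < n$, and the other 2-cells say that
the edges for $a$ and $b$ can be moved out of the way. Hence each path is homotopic to one that
first enlarges the word sufficiently on both sides, then performs only splittings and merges of
letters $x$, and finally shrinks both sides again (\<open>path_normal\<close>), and loops with equal words in
the group given by those relations are homotopic. This group acts faithfully on the line
(\<open>word_map_faithful\<close>): every word can be written as splittings followed by merges, splittings can
be sorted, and a sorted product of splittings is recovered from its fixed points.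

Every homeomorphism of the right kind occurs. If a map with bounded support carries a fine
dyadic partition of the line to another dyadic partition, both partitions arise from the
integers by successive halving, and the two histories of halving spell out a word for the map
(\<open>dyadic_homeomorphism_word\<close>).

The group so obtained is $F'$. The line is identified with the open unit interval by a piecewise
linear chart \<open>squeeze\<close> whose breaks accumulate at 0 and 1. A commutator in $F$ is the identity
near 0 and near 1, because linear maps commute, so $F'$ consists of maps with bounded support on
the line. Conversely, a loop carries a word of exponent sum 0, and \<open>caret n\<close> and
\<open>caret (n + 1)\<close> are conjugate by the relation above, so that all such words are trivial in the
abelianization of $F$ (\<open>derived_eq_words\<close>).\<close>

section \<open>Carets on the line and the group presented by them\<close>

definition caret :: "int \<Rightarrow> real \<Rightarrow> real" where
  "caret m t = (if t \<le> m then t else if t \<le> m + 1 then 2 * t - m else t + 1)"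

definition uncaret :: "int \<Rightarrow> real \<Rightarrow> real" where
  "uncaret m t = (if t \<le> m then t else if t \<le> m + 2 then (t + m) / 2 else t - 1)"

lemma caret_uncaret [simp]: "caret m (uncaret m t) = t"
  by (auto simp: caret_def uncaret_def field_simps)

lemma uncaret_caret [simp]: "uncaret m (caret m t) = t"
  by (auto simp: caret_def uncaret_def field_simps)

lemma caret_commute:
  assumes "m < n"
  shows "caret m (caret n t) = caret (n + 1) (caret m t)"
proof -
  have "of_int m + 1 \<le> (of_int n :: real)" using assms by linarith
  then show ?thesis by (auto simp: caret_def)
qed

lemma caret_ge: "t \<le> caret m t"
  by (auto simp: caret_def)

lemma caret_fixed: "t \<le> of_int m \<Longrightarrow> caret m t = t"
  by (auto simp: caret_def)

lemma caret_moves: "of_int m < t \<Longrightarrow> t < caret m t"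
  by (auto simp: caret_def)

type_synonym caret_word = "(bool \<times> int) list"

text \<open>The letter \<open>(True, m)\<close> stands for the splitting $x \to xx$ of $[m,m+1]$, and \<open>(False, m)\<close> for the
merge that undoes it. A splitting is sent to the inverse of its caret, that is to the map from the
new picture back to the old one, so that concatenation of paths becomes composition of maps in
the same order.\<close>

fun letter_map :: "bool \<times> int \<Rightarrow> real \<Rightarrow> real" where
  "letter_map (b, m) = (if b then uncaret m else caret m)"

definition word_map :: "caret_word \<Rightarrow> real \<Rightarrow> real" where
  "word_map w = foldr (\<lambda>c f. letter_map c \<circ> f) w id"

lemma word_map_Nil [simp]: "word_map [] = id"
  and word_map_Cons [simp]: "word_map (c # w) = letter_map c \<circ> word_map w"
  by (simp_all add: word_map_def)

lemma word_map_append [simp]: "word_map (v @ w) = word_map v \<circ> word_map w"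
  by (induction v) (simp_all add: comp_assoc)

definition flip :: "bool \<times> int \<Rightarrow> bool \<times> int" where
  "flip = (\<lambda>(b, m). (\<not> b, m))"

lemma flip_simp [simp]: "flip (b, m) = (\<not> b, m)"
  by (simp add: flip_def)

lemma flip_flip [simp]: "flip (flip c) = c"
  by (cases c) simp

definition word_inv :: "caret_word \<Rightarrow> caret_word" where
  "word_inv w = rev (map flip w)"

lemma word_inv_Nil [simp]: "word_inv [] = []"
  and word_inv_Cons [simp]: "word_inv (c # w) = word_inv w @ [flip c]"
  and word_inv_append [simp]: "word_inv (v @ w) = word_inv w @ word_inv v"
  by (simp_all add: word_inv_def)

lemma word_inv_inv [simp]: "word_inv (word_inv w) = w"
  by (induction w) auto

lemma letter_map_flip [simp]: "letter_map c (letter_map (flip c) t) = t"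
  by (cases c) auto

lemma word_map_inv_apply [simp]: "word_map w (word_map (word_inv w) t) = t"
  by (induction w arbitrary: t) simp_all

lemma word_map_inv_apply' [simp]: "word_map (word_inv w) (word_map w t) = t"
  using word_map_inv_apply[of "word_inv w"] by simp

fun letter_sum :: "bool \<times> int \<Rightarrow> int" where
  "letter_sum (b, m) = (if b then 1 else -1)"

definition word_sum :: "caret_word \<Rightarrow> int" where
  "word_sum w = sum_list (map letter_sum w)"

lemma word_sum_simps [simp]: "word_sum [] = 0" "word_sum (c # w) = letter_sum c + word_sum w"
  "word_sum (v @ w) = word_sum v + word_sum w"
  by (simp_all add: word_sum_def)

lemma letter_sum_flip [simp]: "letter_sum (flip c) = - letter_sum c"
  by (cases c) auto

lemma word_sum_inv [simp]: "word_sum (word_inv w) = - word_sum w"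
  by (induction w) auto

text \<open>The group with one generator for each integer in which, besides free cancellation, only this
holds: splittings of two different unit intervals can be interchanged, and the one on the right
is renumbered when the one on the left comes first. These are the relations of the infinite
presentation of Thompson's group, with the indices running over all integers.\<close>

inductive word_eq :: "caret_word \<Rightarrow> caret_word \<Rightarrow> bool" (infix "\<doteq>" 50) where
  refl: "w \<doteq> w"
| sym: "v \<doteq> w \<Longrightarrow> w \<doteq> v"
| trans [trans]: "u \<doteq> v \<Longrightarrow> v \<doteq> w \<Longrightarrow> u \<doteq> w"
| append: "v \<doteq> v' \<Longrightarrow> w \<doteq> w' \<Longrightarrow> v @ w \<doteq> v' @ w'"
| cancel: "[c, flip c] \<doteq> []"
| swap: "m < n \<Longrightarrow> [(True, n), (True, m)] \<doteq> [(True, m), (True, n + 1)]"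

lemma word_eq_context: "v \<doteq> w \<Longrightarrow> p @ v @ q \<doteq> p @ w @ q"
  by (intro word_eq.append word_eq.refl)

lemma word_eq_Cons: "v \<doteq> w \<Longrightarrow> c # v \<doteq> c # w"
  using word_eq.append[OF word_eq.refl, of v w "[c]"] by simp

lemma word_eq_inv_cancel: "w @ word_inv w \<doteq> []"
proof (induction w)
  case (Cons c w)
  have "[c] @ (w @ word_inv w) @ [flip c] \<doteq> [c] @ [] @ [flip c]"
    by (rule word_eq_context[OF Cons.IH])
  also have "\<dots> \<doteq> []" using word_eq.cancel[of c] by simp
  finally show ?case by simp
qed (simp add: word_eq.refl)

lemma word_eq_inv_cancel': "word_inv w @ w \<doteq> []"
  using word_eq_inv_cancel[of "word_inv w"] by simp

lemma word_map_respects: "v \<doteq> w \<Longrightarrow> word_map v = word_map w"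
proof (induction rule: word_eq.induct)
  case (cancel c)
  show ?case by (simp add: fun_eq_iff)
next
  case (swap m n)
  have "uncaret n (uncaret m t) = uncaret m (uncaret (n + 1) t)" for t
  proof -
    have "caret m (caret n (uncaret n (uncaret m t))) =
        caret m (caret n (uncaret m (uncaret (n + 1) t)))"
      by (simp add: caret_commute[OF swap])
    then show ?thesis by (metis uncaret_caret)
  qed
  then show ?case by (simp add: fun_eq_iff)
qed simp_all

definition splits :: "int list \<Rightarrow> caret_word" where
  "splits ks = map (Pair True) ks"

lemma splits_simps [simp]: "splits [] = []" "splits (k # ks) = (True, k) # splits ks"
  "splits (ks @ ls) = splits ks @ splits ls"
  by (simp_all add: splits_def)

lemma word_sum_splits [simp]: "word_sum (splits ks) = int (length ks)"
  by (induction ks) auto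


text \<open>A merge and a splitting that follows it either concern the same interval and cancel, or they
concern different ones; in the latter case the relation \<open>swap\<close>, multiplied by inverses on both
sides, interchanges them.\<close>

lemma merge_past_split:
  "[(False, m), (True, n)] \<doteq> [] \<or> (\<exists>n' m'. [(False, m), (True, n)] \<doteq> [(True, n'), (False, m')])"
proof -
  consider "m < n" | "m = n" | "n < m" by linarith
  then show ?thesis
  proof cases
    case 1
    have "[(False, m), (True, n)] @ [] \<doteq> [(False, m), (True, n)] @ [(True, m), flip (True, m)]"
      by (intro word_eq.append word_eq.refl word_eq.sym[OF word_eq.cancel])
    also have "\<dots> = [(False, m)] @ [(True, n), (True, m)] @ [(False, m)]" by simp
    also have "\<dots> \<doteq> [(False, m)] @ [(True, m), (True, n + 1)] @ [(False, m)]"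
      by (intro word_eq_context word_eq.swap 1)
    also have "\<dots> = [(False, m), flip (False, m)] @ [(True, n + 1), (False, m)]" by simp
    also have "\<dots> \<doteq> [] @ [(True, n + 1), (False, m)]"
      by (intro word_eq.append word_eq.refl word_eq.cancel)
    finally show ?thesis by auto
  next
    case 2
    then show ?thesis using word_eq.cancel[of "(False, m)"] by simp
  next
    case 3
    have "[(False, m), (True, n)] @ [] \<doteq>
        [(False, m), (True, n)] @ [(True, m + 1), flip (True, m + 1)]"
      by (intro word_eq.append word_eq.refl word_eq.sym[OF word_eq.cancel])
    also have "\<dots> = [(False, m)] @ [(True, n), (True, m + 1)] @ [(False, m + 1)]" by simp
    also have "\<dots> \<doteq> [(False, m)] @ [(True, m), (True, n)] @ [(False, m + 1)]"
      by (intro word_eq_context word_eq.sym[OF word_eq.swap] 3)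
    also have "\<dots> = [(False, m), flip (False, m)] @ [(True, n), (False, m + 1)]" by simp
    also have "\<dots> \<doteq> [] @ [(True, n), (False, m + 1)]"
      by (intro word_eq.append word_eq.refl word_eq.cancel)
    finally show ?thesis by auto
  qed
qed

lemma merge_past_splits:
  "\<exists>ks' ms. (False, m) # splits ks \<doteq> splits ks' @ word_inv (splits ms)"
proof (induction ks arbitrary: m)
  case Nil
  have "[(False, m)] = splits [] @ word_inv (splits [m])" by simp
  then show ?case by (metis word_eq.refl splits_simps(1))
next
  case (Cons n ks)
  have *: "(False, m) # splits (n # ks) \<doteq> w @ splits ks" if "[(False, m), (True, n)] \<doteq> w" for w
    using word_eq.append[OF that word_eq.refl, of "splits ks"] by simp
  show ?case
  proof (cases "[(False, m), (True, n)] \<doteq> []")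
    case True
    then have "(False, m) # splits (n # ks) \<doteq> splits ks @ word_inv (splits [])"
      using *[OF True] by simp
    then show ?thesis by blast
  next
    case False
    then obtain n' m' where 1: "[(False, m), (True, n)] \<doteq> [(True, n'), (False, m')]"
      using merge_past_split[of m n] by blast
    obtain ks' ms where 2: "(False, m') # splits ks \<doteq> splits ks' @ word_inv (splits ms)"
      using Cons.IH by blast
    have "(False, m) # splits (n # ks) \<doteq> (True, n') # (False, m') # splits ks"
      using *[OF 1] by simp
    also have "\<dots> \<doteq> splits (n' # ks') @ word_inv (splits ms)"
      using word_eq_Cons[OF 2] by simp
    finally show ?thesis by blast
  qed
qed

lemma splits_then_merges: "\<exists>ks ls. w \<doteq> splits ks @ word_inv (splits ls)"
proof (induction w)
  case Nil
  have "[] = splits [] @ word_inv (splits [])" by simp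
  then show ?case by (metis word_eq.refl)
next
  case (Cons c w)
  then obtain ks ls where w: "w \<doteq> splits ks @ word_inv (splits ls)" by blast
  obtain b m where c: "c = (b, m)" by fastforce
  show ?case
  proof (cases b)
    case True
    then have "c # w \<doteq> splits (m # ks) @ word_inv (splits ls)"
      using word_eq_Cons[OF w, of c] c by simp
    then show ?thesis by blast
  next
    case False
    obtain ks' ms where m: "(False, m) # splits ks \<doteq> splits ks' @ word_inv (splits ms)"
      using merge_past_splits by blast
    have "c # w \<doteq> ((False, m) # splits ks) @ word_inv (splits ls)"
      using word_eq_Cons[OF w, of c] c False by simp
    also have "\<dots> \<doteq> (splits ks' @ word_inv (splits ms)) @ word_inv (splits ls)"
      by (intro word_eq.append m word_eq.refl)
    also have "\<dots> = splits ks' @ word_inv (splits (ls @ ms))" by simp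
    finally show ?thesis by blast
  qed
qed

fun insert_split :: "int \<Rightarrow> int list \<Rightarrow> int list" where
  "insert_split n [] = [n]"
| "insert_split n (m # ks) = (if m < n then m # insert_split (n + 1) ks else n # m # ks)"

lemma insert_split_eq: "splits (n # ks) \<doteq> splits (insert_split n ks)"
proof (induction ks arbitrary: n)
  case (Cons m ks)
  show ?case
  proof (cases "m < n")
    case True
    have "splits (n # m # ks) = [(True, n), (True, m)] @ splits ks" by simp
    also have "\<dots> \<doteq> [(True, m), (True, n + 1)] @ splits ks"
      by (intro word_eq.append word_eq.refl word_eq.swap True)
    also have "\<dots> = (True, m) # splits ((n + 1) # ks)" by simp
    also have "\<dots> \<doteq> (True, m) # splits (insert_split (n + 1) ks)"
      by (intro word_eq_Cons Cons.IH)
    finally show ?thesis using True by simp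
  qed (simp add: word_eq.refl)
qed (simp add: word_eq.refl)

lemma set_insert_split: "k \<in> set (insert_split n ks) \<Longrightarrow> n \<le> k \<or> k \<in> set ks"
  by (induction ks arbitrary: n) (fastforce split: if_splits)+

lemma sorted_insert_split: "sorted ks \<Longrightarrow> sorted (insert_split n ks)"
  by (induction ks arbitrary: n) (fastforce dest: set_insert_split)+

lemma sort_splits: "\<exists>ls. sorted ls \<and> splits ks \<doteq> splits ls"
proof (induction ks)
  case Nil
  show ?case using word_eq.refl[of "[]"] by (intro exI[of _ "[]"]) simp
next
  case (Cons k ks)
  then obtain ls where ls: "sorted ls" "splits ks \<doteq> splits ls" by blast
  have "splits (k # ks) \<doteq> splits (k # ls)" using word_eq_Cons[OF ls(2)] by simp
  also have "\<dots> \<doteq> splits (insert_split k ls)" by (rule insert_split_eq)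
  finally show ?case using sorted_insert_split[OF ls(1)] by blast
qed

definition carets :: "int list \<Rightarrow> real \<Rightarrow> real" where
  "carets ks = fold caret ks"

lemma carets_simps [simp]: "carets [] t = t" "carets (k # ks) t = carets ks (caret k t)"
  "carets (ks @ ls) t = carets ls (carets ks t)"
  by (simp_all add: carets_def)

lemma word_map_inv_splits: "word_map (word_inv (splits ks)) = carets ks"
  by (induction ks) (auto simp: fun_eq_iff)

lemma carets_fixed: "(\<And>k. k \<in> set ks \<Longrightarrow> t \<le> of_int k) \<Longrightarrow> carets ks t = t"
  by (induction ks) (auto simp: caret_fixed)

lemma carets_ge: "t \<le> carets ks t"
proof (induction ks arbitrary: t)
  case (Cons k ks)
  show ?case using caret_ge[of t k] Cons.IH[of "caret k t"] by simp
qed simp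

lemma carets_moves: "of_int k < t \<Longrightarrow> t < carets (k # ks) t"
  using caret_moves[of k t] carets_ge[of "caret k t" ks] by simp

text \<open>The smallest index is the point where the half line of fixed points ends. In an increasing list
it comes first, so it can be read off from the map and cancelled.\<close>

lemma carets_sorted_inj:
  assumes "sorted ks" "sorted ls" "carets ks = carets ls"
  shows "ks = ls"
  using assms
proof (induction ks arbitrary: ls)
  case Nil
  show ?case
  proof (cases ls)
    case (Cons l ls')
    then show ?thesis using Nil.prems(3) carets_moves[of l "l + 1" ls'] by (simp add: fun_eq_iff)
  qed simp
next
  case (Cons k ks)
  show ?case
  proof (cases ls)
    case Nil
    then show ?thesis
      using Cons.prems(3) carets_moves[of k "k + 1" ks] by (simp add: fun_eq_iff)
  next
    case ls: (Cons l ls')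
    have fix_k: "carets (k # ks) (of_int k) = of_int k"
      using Cons.prems(1) by (intro carets_fixed) auto
    have fix_l: "carets (l # ls') (of_int l) = of_int l"
      using Cons.prems(2) ls by (intro carets_fixed) auto
    have "k = l"
      using carets_moves[of k "of_int l" ks] carets_moves[of l "of_int k" ls'] fix_k fix_l
        Cons.prems(3) ls by (metis less_irrefl linorder_neqE_linordered_idom of_int_less_iff)
    moreover have "carets ks t = carets ls' t" for t
      using fun_cong[OF Cons.prems(3), of "uncaret k t"] ls \<open>k = l\<close> by simp
    ultimately show ?thesis using Cons ls by (auto simp: fun_eq_iff)
  qed
qed

text \<open>Moving \<open>w\<close> to the left and all merges to the right reduces the claim to an equation between two
products of splittings, and those may be sorted.\<close>

theorem word_map_faithful:
  assumes "word_map v = word_map w"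
  shows "v \<doteq> w"
proof -
  obtain ks ls where kl: "v @ word_inv w \<doteq> splits ks @ word_inv (splits ls)"
    using splits_then_merges by blast
  obtain ks' where ks': "sorted ks'" "splits ks \<doteq> splits ks'" using sort_splits by blast
  obtain ls' where ls': "sorted ls'" "splits ls \<doteq> splits ls'" using sort_splits by blast
  have "word_map (splits ks) (word_map (word_inv (splits ls)) t) = t" for t
    using fun_cong[OF word_map_respects[OF kl], of t] assms by simp
  then have "word_map (word_inv (splits ks)) = word_map (word_inv (splits ls))"
    by (metis word_map_inv_apply' ext)
  moreover have "word_map (word_inv (splits ks)) = word_map (word_inv (splits ks'))"
    "word_map (word_inv (splits ls)) = word_map (word_inv (splits ls'))"
    using word_map_respects[OF ks'(2)] word_map_respects[OF ls'(2)]
    by (metis word_map_inv_apply word_map_inv_apply' ext)+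
  ultimately have "ks' = ls'"
    using ks'(1) ls'(1) by (intro carets_sorted_inj) (simp_all add: word_map_inv_splits)
  then have "splits ks \<doteq> splits ls"
    using ks'(2) ls'(2) word_eq.sym word_eq.trans by blast
  then have "splits ks @ word_inv (splits ls) \<doteq> splits ls @ word_inv (splits ls)"
    by (intro word_eq.append word_eq.refl)
  also have "\<dots> \<doteq> []" by (rule word_eq_inv_cancel)
  finally have 1: "v @ word_inv w \<doteq> []" using kl word_eq.trans by blast
  have "v @ [] \<doteq> v @ (word_inv w @ w)"
    by (intro word_eq.append word_eq.refl word_eq.sym[OF word_eq_inv_cancel'])
  also have "\<dots> = (v @ word_inv w) @ w" by simp
  also have "\<dots> \<doteq> [] @ w" by (intro word_eq.append word_eq.refl 1)
  finally show ?thesis by simp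
qed

section \<open>Dyadic partitions of the line\<close>

text \<open>These are the intervals that arise from $[m,m+1]$, for an integer $m$, by repeated halving; in
particular their length is at most 1.\<close>

definition dyadic_interval :: "real \<Rightarrow> real \<Rightarrow> bool" where
  "dyadic_interval a b \<longleftrightarrow> (\<exists>(m :: int) (k :: nat). a = m / 2 ^ k \<and> b = (m + 1) / 2 ^ k)"

lemma dyadic_interval_less: "dyadic_interval a b \<Longrightarrow> a < b"
  by (auto simp: dyadic_interval_def divide_strict_right_mono)

lemma segment_bounds:
  fixes a b s :: real
  assumes "a \<le> b" "s \<in> {0..1}"
  shows "a \<le> a + s * (b - a)" "a + s * (b - a) \<le> b"
proof -
  show "a \<le> a + s * (b - a)" using assms by simp
  have "s * (b - a) \<le> 1 * (b - a)" using assms by (intro mult_right_mono) auto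
  then show "a + s * (b - a) \<le> b" by simp
qed

lemma dyadic_interval_length: "dyadic_interval a b \<Longrightarrow> b - a \<le> 1"
  by (auto simp: dyadic_interval_def diff_divide_distrib[symmetric])

lemma dyadic_interval_unit: "dyadic_interval (of_int m) (of_int m + 1)"
  unfolding dyadic_interval_def by (intro exI[of _ m] exI[of _ 0]) simp

lemma dyadic_interval_shift:
  assumes "dyadic_interval a b" shows "dyadic_interval (a + of_int n) (b + of_int n)"
proof -
  obtain m :: int and k :: nat where "a = m / 2 ^ k" "b = (m + 1) / 2 ^ k"
    using assms by (auto simp: dyadic_interval_def)
  then have "a + of_int n = (m + n * 2 ^ k :: int) / 2 ^ k"
    "b + of_int n = (m + n * 2 ^ k + 1 :: int) / 2 ^ k"
    by (simp_all add: field_simps)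
  then show ?thesis unfolding dyadic_interval_def by fastforce
qed

lemma grid_step:
  fixes m n :: int
  assumes "l \<le> k" "real_of_int m / 2 ^ k < n / 2 ^ l"
  shows "(real_of_int m + 1) / 2 ^ k \<le> n / 2 ^ l"
proof -
  have n: "real_of_int n / 2 ^ l = (n * 2 ^ (k - l) :: int) / 2 ^ k"
    using assms(1) by (simp add: field_simps flip: power_add)
  have "m < n * 2 ^ (k - l)"
    using assms(2) unfolding n by (simp add: divide_less_cancel del: of_int_mult)
  then have "real_of_int (m + 1) \<le> real_of_int (n * 2 ^ (k - l))"
    by (subst of_int_le_iff) simp
  then show ?thesis unfolding n by (simp add: divide_right_mono del: of_int_mult)
qed

text \<open>Dyadic intervals are nested or have disjoint interiors: the right end of the longer one is a
multiple of the length of the shorter one.\<close>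

lemma dyadic_interval_nested:
  assumes "dyadic_interval a b" "dyadic_interval c d" "b - a \<le> d - c" "a < d"
  shows "b \<le> d"
proof -
  obtain m :: int and k :: nat where ab: "a = m / 2 ^ k" "b = (m + 1) / 2 ^ k"
    using assms(1) by (auto simp: dyadic_interval_def)
  obtain n :: int and l :: nat where cd: "c = n / 2 ^ l" "d = (n + 1) / 2 ^ l"
    using assms(2) by (auto simp: dyadic_interval_def)
  have "(1 :: real) / 2 ^ k \<le> 1 / 2 ^ l"
    using assms(3) by (simp add: ab cd add_divide_distrib)
  then have "l \<le> k" by (simp add: field_simps)
  then show ?thesis using grid_step[of l k m "n + 1"] assms(4) by (simp add: ab cd)
qed

text \<open>The image is required to be a dyadic interval again, and not only to be stretched by a power of 2.
This is what makes the notion stable under restriction to smaller dyadic intervals, composition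
and inversion, and all piecewise linear maps below are treated through it.\<close>

definition dyadic_affine :: "(real \<Rightarrow> real) \<Rightarrow> real \<Rightarrow> real \<Rightarrow> bool" where
  "dyadic_affine f a b \<longleftrightarrow> dyadic_interval a b \<and> dyadic_interval (f a) (f b) \<and>
     (\<forall>s\<in>{0..1}. f (a + s * (b - a)) = f a + s * (f b - f a))"

lemma dyadic_affine_apply:
  assumes "dyadic_affine f a b" "a \<le> x" "x \<le> b"
  shows "f x = f a + (x - a) / (b - a) * (f b - f a)"
proof -
  have "a < b" using assms(1) dyadic_interval_less by (auto simp: dyadic_affine_def)
  then have "(x - a) / (b - a) \<in> {0..1}" using assms by (simp add: field_simps)
  then have "f (a + (x - a) / (b - a) * (b - a)) = f a + (x - a) / (b - a) * (f b - f a)"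
    using assms(1) unfolding dyadic_affine_def by blast
  then show ?thesis using \<open>a < b\<close> by simp
qed

text \<open>An affine map that is onto a dyadic interval takes halves to halves.\<close>

lemma dyadic_affine_subinterval:
  assumes f: "dyadic_affine f a b" and sub: "dyadic_interval a' b'" "a \<le> a'" "b' \<le> b"
  shows "dyadic_affine f a' b'"
proof -
  obtain m :: int and k :: nat where ab: "a = m / 2 ^ k" "b = (m + 1) / 2 ^ k"
    using f by (auto simp: dyadic_interval_def dyadic_affine_def)
  obtain m' :: int and k' :: nat where ab': "a' = m' / 2 ^ k'" "b' = (m' + 1) / 2 ^ k'"
    using sub by (auto simp: dyadic_interval_def)
  obtain n :: int and l :: nat where cd: "f a = n / 2 ^ l" "f b = (n + 1) / 2 ^ l"
    using f by (auto simp: dyadic_interval_def dyadic_affine_def)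
  have "b' - a' \<le> b - a" using sub by simp
  then have "(1 :: real) / 2 ^ k' \<le> 1 / 2 ^ k" by (simp add: ab ab' add_divide_distrib)
  then have "k \<le> k'" by (simp add: field_simps)
  then obtain j where k': "k' = k + j" using le_Suc_ex by blast
  have ba: "b - a = 1 / 2 ^ k" by (simp add: ab add_divide_distrib)
  have dc: "f b - f a = 1 / 2 ^ l" by (simp add: cd add_divide_distrib)
  have "a' < b'" using sub dyadic_interval_less by blast
  have *: "f x = (x - a) * 2 ^ k / 2 ^ l + n / 2 ^ l" if "a' \<le> x" "x \<le> b'" for x
    using dyadic_affine_apply[OF f, of x] that sub by (simp add: ba dc) (simp add: cd)
  have a'a: "(a' - a) * 2 ^ k = (m' - m * 2 ^ j) / 2 ^ j"
    by (simp add: ab ab' k' power_add field_simps)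
  have b'a: "(b' - a) * 2 ^ k = (m' + 1 - m * 2 ^ j) / 2 ^ j"
    by (simp add: ab ab' k' power_add field_simps)
  have fa': "f a' = (n * 2 ^ j + m' - m * 2 ^ j :: int) / 2 ^ (l + j)"
    using *[of a'] \<open>a' < b'\<close> unfolding a'a by (simp add: power_add field_simps)
  have fb': "f b' = (n * 2 ^ j + m' - m * 2 ^ j + 1 :: int) / 2 ^ (l + j)"
    using *[of b'] \<open>a' < b'\<close> unfolding b'a by (simp add: power_add field_simps)
  have "dyadic_interval (f a') (f b')"
    unfolding dyadic_interval_def using fa' fb'
    by (intro exI[of _ "n * 2 ^ j + m' - m * 2 ^ j"] exI[of _ "l + j"]) simp
  moreover have "f (a' + s * (b' - a')) = f a' + s * (f b' - f a')" if s: "s \<in> {0..1}" for s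
  proof -
    define c d :: real where "c = 2 ^ k / 2 ^ l" and "d = n / 2 ^ l"
    have cd': "f x = (x - a) * c + d" if "a' \<le> x" "x \<le> b'" for x
      using *[OF that] by (simp add: c_def d_def)
    have 1: "f (a' + s * (b' - a')) = (a' + s * (b' - a') - a) * c + d"
      using s \<open>a' < b'\<close> by (intro cd' segment_bounds) auto
    have 2: "f a' = (a' - a) * c + d" "f b' = (b' - a) * c + d"
      using \<open>a' < b'\<close> by (auto intro: cd')
    show ?thesis unfolding 1 2 by (simp add: algebra_simps)
  qed
  ultimately show ?thesis using sub by (simp add: dyadic_affine_def)
qed

lemma dyadic_affine_compose:
  assumes "dyadic_affine f a b" "dyadic_affine g (f a) (f b)"
  shows "dyadic_affine (g \<circ> f) a b"
  using assms by (auto simp: dyadic_affine_def)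

lemma dyadic_affine_inverse:
  assumes f: "dyadic_affine f a b" and inv: "\<And>x. a \<le> x \<Longrightarrow> x \<le> b \<Longrightarrow> g (f x) = x"
  shows "dyadic_affine g (f a) (f b)"
proof -
  have ab: "a < b" using f dyadic_interval_less by (auto simp: dyadic_affine_def)
  have "g (f a + s * (f b - f a)) = a + s * (b - a)" if s: "s \<in> {0..1}" for s
  proof -
    have "f (a + s * (b - a)) = f a + s * (f b - f a)"
      using f s by (simp add: dyadic_affine_def)
    then show ?thesis
      using inv[OF segment_bounds[of a b s]] s ab by simp
  qed
  then show ?thesis using f ab inv by (simp add: dyadic_affine_def)
qed

lemma dyadic_affine_id:
  assumes "dyadic_interval a b" "\<And>x. a \<le> x \<Longrightarrow> x \<le> b \<Longrightarrow> f x = x"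
  shows "dyadic_affine f a b"
proof -
  have ab: "a < b" using assms dyadic_interval_less by blast
  have "f (a + s * (b - a)) = a + s * (b - a)" if s: "s \<in> {0..1}" for s
  proof -
    show ?thesis using s ab by (intro assms(2) segment_bounds) auto
  qed
  then show ?thesis using assms ab by (simp add: dyadic_affine_def)
qed

lemma dyadic_affine_slope:
  assumes "dyadic_affine f a b"
  shows "\<exists>(k :: int) c. \<forall>x\<in>{a..b}. f x = 2 powi k * x + c"
proof -
  obtain m :: int and k :: nat where ab: "a = m / 2 ^ k" "b = (m + 1) / 2 ^ k"
    using assms by (auto simp: dyadic_interval_def dyadic_affine_def)
  obtain n :: int and l :: nat where cd: "f a = n / 2 ^ l" "f b = (n + 1) / 2 ^ l"
    using assms by (auto simp: dyadic_interval_def dyadic_affine_def)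
  have ba: "b - a = 1 / 2 ^ k" by (simp add: ab add_divide_distrib)
  have dc: "f b - f a = 1 / 2 ^ l" by (simp add: cd add_divide_distrib)
  have slope: "2 powi (int k - int l) = (2 :: real) ^ k / 2 ^ l"
    by (simp add: power_int_diff)
  have "f x = 2 powi (int k - int l) * x + (f a - 2 powi (int k - int l) * a)"
    if "x \<in> {a..b}" for x
    using dyadic_affine_apply[OF assms, of x] that unfolding slope ba dc
    by (simp add: field_simps)
  then show ?thesis by blast
qed

text \<open>A partition into dyadic intervals that are not all units contains two neighbours that are the
halves of one dyadic interval. Take an interval $[a/2^K,(a+1)/2^K]$ of minimal length. If $a$ is
even, its right neighbour starts at an odd multiple of $2^{-K}$, so it cannot be longer; if $a$ is
odd, the same holds for the end of the left neighbour.\<close>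

lemma partition_siblings:
  fixes p :: "int \<Rightarrow> real"
  assumes std: "\<And>m. dyadic_interval (p m) (p (m + 1))"
    and far: "\<And>m. m < - N \<or> N \<le> m \<Longrightarrow> p (m + 1) = p m + 1"
    and small: "p (j + 1) - p j \<noteq> 1"
  shows "\<exists>m (c :: int) K. p m = c / 2 ^ K \<and> p (m + 1) = (2 * c + 1) / 2 ^ Suc K \<and>
    p (m + 2) = (c + 1) / 2 ^ K"
proof -
  have "\<forall>m. \<exists>(a :: int) (k :: nat). p m = a / 2 ^ k \<and> p (m + 1) = (a + 1) / 2 ^ k"
    using std by (simp add: dyadic_interval_def)
  then obtain a :: "int \<Rightarrow> int" and k :: "int \<Rightarrow> nat"
    where a: "\<And>m. p m = a m / 2 ^ k m" and a1: "\<And>m. p (m + 1) = (real_of_int (a m) + 1) / 2 ^ k m"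
    by metis
  have len: "p (m + 1) - p m = 1 / 2 ^ k m" for m
    unfolding a1 by (simp add: a add_divide_distrib)
  have k0: "k m = 0 \<longleftrightarrow> p (m + 1) - p m = 1" for m
    unfolding len using power_inject_exp[of "2 :: real" "k m" 0] by auto
  have "k m \<in> insert 0 (k ` {- N..N})" for m
    using k0[of m] far[of m] by (cases "m \<in> {- N..N}") auto
  \<comment> \<open>Only finitely many lengths occur, so a shortest interval exists.\<close>
  then have "range k \<subseteq> insert 0 (k ` {- N..N})" by (rule image_subsetI)
  then have fin: "finite (range k)" by (rule finite_subset) simp
  define K where "K = Max (range k)"
  have le: "k m \<le> K" for m unfolding K_def using fin by simp
  obtain m where m: "k m = K" using Max_in[OF fin] unfolding K_def by fastforce
  have "K > 0" using le[of j] k0[of j] small by simp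
  then obtain K' where K': "K = Suc K'" by (cases K) auto
  \<comment> \<open>Either way the common end point of two neighbours is an odd multiple of \<open>2\<^sup>-\<^sup>K\<close>.\<close>
  have step: "k i = K \<and> k (i + 1) = K \<and> a (i + 1) = a i + 1"
    if "k i = K \<and> even (a i) \<or> k (i + 1) = K \<and> odd (a (i + 1))" for i
  proof -
    have eq: "a (i + 1) / 2 ^ k (i + 1) = (a i + 1) / (2 :: real) ^ k i"
      using a[of "i + 1"] a1[of i] by simp
    show ?thesis
    proof (cases "k i = K")
      case True
      obtain d where d: "K = k (i + 1) + d" using le[of "i + 1"] le_Suc_ex by blast
      have "real_of_int (a (i + 1)) * 2 ^ d = a i + 1"
        using eq unfolding True d by (simp add: power_add field_simps)
      then have "real_of_int (a (i + 1) * 2 ^ d) = real_of_int (a i + 1)" by simp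
      then have *: "a (i + 1) * 2 ^ d = a i + 1" by (simp only: of_int_eq_iff)
      have "d = 0"
      proof (rule ccontr)
        assume "d \<noteq> 0"
        then have "even (a (i + 1) * 2 ^ d)" by simp
        then have "even (a i + 1)" unfolding * .
        then have o: "odd (a i)" by simp
        then have "k (i + 1) = K" using that by blast
        then show False using d \<open>d \<noteq> 0\<close> by simp
      qed
      then show ?thesis using * d True by simp
    next
      case False
      then have kk: "k (i + 1) = K" "odd (a (i + 1))" using that by auto
      obtain d where d: "K = k i + Suc d"
        using le[of i] False less_natE[of "k i" K] by auto
      have "real_of_int (a (i + 1)) = (a i + 1) * 2 ^ Suc d"
        using eq unfolding kk(1) d by (simp add: power_add field_simps)
      then have "real_of_int (a (i + 1)) = real_of_int ((a i + 1) * 2 ^ Suc d)" by simp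
      then have "a (i + 1) = (a i + 1) * 2 ^ Suc d" by (simp only: of_int_eq_iff)
      then show ?thesis using kk(2) by simp
    qed
  qed
  have "\<exists>i. k i = K \<and> k (i + 1) = K \<and> even (a i) \<and> a (i + 1) = a i + 1"
  proof (cases "even (a m)")
    case True
    then show ?thesis using m step[of m] by blast
  next
    case False
    then show ?thesis using m step[of "m - 1"] by (intro exI[of _ "m - 1"]) auto
  qed
  then obtain i where i: "k i = K" "k (i + 1) = K" "even (a i)" "a (i + 1) = a i + 1" by blast
  then obtain c where c: "a i = 2 * c" by (elim evenE)
  have "p i = c / 2 ^ K'" using a[of i] i c K' by simp
  moreover have "p (i + 1) = (2 * real_of_int c + 1) / 2 ^ Suc K'" using a1[of i] i c K' by simp
  moreover have "p (i + 2) = (real_of_int c + 1) / 2 ^ K'"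
    using a1[of "i + 1"] i c K' by (simp add: add.assoc field_simps)
  ultimately show ?thesis by blast
qed

text \<open>Far to the left the points of the partition are numbered by their own value, and \<open>T\<close> is the
number by which the numbering has run ahead far to the right, i.e. the number of halvings that are
needed to get the partition from the integers. Merging two halves lowers it by one.\<close>

lemma partition_carets:
  fixes p :: "int \<Rightarrow> real" and N :: int and T :: nat
  assumes "\<And>m. dyadic_interval (p m) (p (m + 1))"
    and "\<And>m. m \<le> - N \<Longrightarrow> p m = m" and "\<And>m. N \<le> m \<Longrightarrow> p m = m - int T"
  shows "\<exists>ks. length ks = T \<and>
    (\<forall>m. \<forall>s\<in>{0..1}. carets ks (p m + s * (p (m + 1) - p m)) = m + s)"
  using assms
proof (induction T arbitrary: p N)
  case 0
  have le: "p (m + 1) \<le> p m + 1" for m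
    using dyadic_interval_length[OF 0(1)[of m]] by simp
  have up: "p m \<le> m" if "- N \<le> m" for m
    using that
  proof (induction m rule: int_ge_induct)
    case base then show ?case using 0(2)[of "- N"] by simp
  next
    case (step i) then show ?case using le[of i] by simp
  qed
  have down: "m \<le> p m" if "m \<le> N" for m
    using that
  proof (induction m rule: int_le_induct)
    case base then show ?case using 0(3)[of N] by simp
  next
    case (step i) then show ?case using le[of "i - 1"] by simp
  qed
  have "p m = m" for m
  proof (cases "- N \<le> m \<and> m \<le> N")
    case True
    then show ?thesis using up[of m] down[of m] by linarith
  next
    case False
    then show ?thesis using 0(2)[of m] 0(3)[of m] by auto
  qed
  then show ?case by (intro exI[of _ "[]"]) (simp add: mult.commute)
next
  case (Suc T)
  have "\<exists>j. p (j + 1) - p j \<noteq> 1"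
  proof (rule ccontr)
    assume "\<not> ?thesis"
    then have "p (j + 1) - p j = 1" for j by blast
    then have one: "p (j + 1) = p j + 1" for j by (metis diff_eq_eq add.commute)
    have "p m = m" if "- N \<le> m" for m
      using that
    proof (induction m rule: int_ge_induct)
      case base then show ?case using Suc.prems(2)[of "- N"] by simp
    next
      case (step i) then show ?case using one[of i] by simp
    qed
    from this[of "max N (- N)"] show False using Suc.prems(3)[of "max N (- N)"] by simp
  qed
  then obtain j where "p (j + 1) - p j \<noteq> 1" by blast
  moreover have "p (m + 1) = p m + 1" if "m < - N \<or> N \<le> m" for m
    using that Suc.prems(2)[of m] Suc.prems(2)[of "m + 1"]
      Suc.prems(3)[of m] Suc.prems(3)[of "m + 1"] by auto
  ultimately obtain m c K where sib: "p m = of_int c / 2 ^ K"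
    "p (m + 1) = (2 * of_int c + 1) / 2 ^ Suc K" "p (m + 2) = (of_int c + 1) / 2 ^ K"
    using partition_siblings[of p N j] Suc.prems(1) by blast
  have mid: "p (m + 1) = (p m + p (m + 2)) / 2" unfolding sib by (simp add: field_simps)
  \<comment> \<open>Deleting the midpoint \<open>p (m + 1)\<close> renumbers all points to the right of it.\<close>
  define p' where "p' i = (if i \<le> m then p i else p (i + 1))" for i
  have "\<exists>ks. length ks = T \<and>
    (\<forall>i. \<forall>s\<in>{0..1}. carets ks (p' i + s * (p' (i + 1) - p' i)) = i + s)"
  proof (rule Suc.IH[of p' "max N (\<bar>m\<bar> + 1)"])
    fix i
    consider "i < m" | "i = m" | "m < i" by linarith
    then show "dyadic_interval (p' i) (p' (i + 1))"
    proof cases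
      case 2
      then show ?thesis unfolding p'_def dyadic_interval_def
        using sib by (intro exI[of _ c] exI[of _ K]) (simp add: add.assoc)
    qed (use Suc.prems(1)[of i] Suc.prems(1)[of "i + 1"] in \<open>auto simp: p'_def\<close>)
  next
    fix i assume "i \<le> - max N (\<bar>m\<bar> + 1)"
    then show "p' i = i" using Suc.prems(2)[of i] by (auto simp: p'_def)
  next
    fix i assume "max N (\<bar>m\<bar> + 1) \<le> i"
    then show "p' i = i - int T" using Suc.prems(3)[of "i + 1"] by (auto simp: p'_def)
  qed
  then obtain ks where ks: "length ks = T"
    "\<And>i s. 0 \<le> s \<Longrightarrow> s \<le> 1 \<Longrightarrow> carets ks (p' i + s * (p' (i + 1) - p' i)) = i + s"
    by auto
  have "carets (ks @ [m]) (p i + s * (p (i + 1) - p i)) = i + s" if s: "0 \<le> s" "s \<le> 1" for i s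
  proof -
    consider "i < m" | "i = m" | "i = m + 1" | "m + 1 < i" by linarith
    then show ?thesis
    proof cases
      case 1
      then have "real_of_int i + 1 \<le> m" by linarith
      then show ?thesis using ks(2)[OF s, of i] 1 s by (simp add: p'_def caret_def)
    next
      case 2
      have "p i + s * (p (i + 1) - p i) = p' m + (s / 2) * (p' (m + 1) - p' m)"
        unfolding p'_def 2 mid by (simp add: field_simps)
      then have "carets ks (p i + s * (p (i + 1) - p i)) = m + s / 2"
        using ks(2)[of "s / 2" m] s by simp
      then show ?thesis using 2 s by (simp only: carets_simps) (simp add: caret_def)
    next
      case 3
      have "p i + s * (p (i + 1) - p i) = p' m + ((1 + s) / 2) * (p' (m + 1) - p' m)"
        unfolding p'_def 3 using mid by (simp add: field_simps)
      then have "carets ks (p i + s * (p (i + 1) - p i)) = m + (1 + s) / 2"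
        using ks(2)[of "(1 + s) / 2" m] s by simp
      then show ?thesis using 3 s by (simp only: carets_simps) (simp add: caret_def field_simps)
    next
      case 4
      then have "real_of_int m + 2 \<le> i" by linarith
      then show ?thesis using ks(2)[OF s, of "i - 1"] 4 s by (auto simp: p'_def caret_def)
    qed
  qed
  then show ?case using ks(1) by (intro exI[of _ "ks @ [m]"]) auto
qed

text \<open>Cut $[-N,N]$ uniformly into intervals of length $2^{-k}$. The resulting partition of the line and
its image under \<open>g\<close> are both dyadic and both need the same number of halvings, so carets take
either of them to the integers. The two products of carets differ by \<open>g\<close>, since everything is
affine between the points of the partition.\<close>

theorem dyadic_homeomorphism_word:
  fixes g :: "real \<Rightarrow> real" and N k :: nat
  assumes outside: "\<And>t. t \<le> - real N \<or> real N \<le> t \<Longrightarrow> g t = t"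
    and grid: "\<And>m :: int. dyadic_affine g (m / 2 ^ k) ((m + 1) / 2 ^ k)"
  shows "\<exists>w. word_sum w = 0 \<and> word_map w = g"
proof -
  define M :: int where "M = 2 * int N * 2 ^ k"
  have M: "2 * int N \<le> M" unfolding M_def by (simp add: mult_le_cancel_left1)
  define T where "T = nat (M - 2 * int N)"
  have T: "int T = M - 2 * int N" using M by (simp add: T_def)
  define p :: "int \<Rightarrow> real" where
    "p m = (if m \<le> - int N then m else if m \<le> M - int N then (m + int N) / 2 ^ k - N
       else m - int T)" for m
  have aff: "dyadic_affine g (p m) (p (m + 1))" for m
  proof -
    consider "m < - int N" | "- int N \<le> m" "m < M - int N" | "M - int N \<le> m" by linarith
    then show ?thesis
    proof cases
      case 1
      have "dyadic_affine g (of_int m) (of_int m + 1)"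
      proof (rule dyadic_affine_id[OF dyadic_interval_unit])
        fix x :: real assume "x \<le> of_int m + 1"
        moreover have "real_of_int m + 1 \<le> - real N" using 1 by linarith
        ultimately show "g x = x" by (intro outside) auto
      qed
      then show ?thesis using 1 by (simp add: p_def)
    next
      case 2
      have *: "p i = (i + int N - int N * 2 ^ k :: int) / 2 ^ k"
        if "- int N \<le> i" "i \<le> M - int N" for i
        using that by (auto simp: p_def field_simps)
      show ?thesis using *[of m] *[of "m + 1"] 2 grid[of "m + int N - int N * 2 ^ k"]
        by (simp add: algebra_simps)
    next
      case 3
      have *: "p i = i - int T" if "M - int N \<le> i" for i
      proof (cases "i = M - int N")
        case True
        have "p i = N"
        proof (cases "N = 0")
          case False
          then have "- int N < i" using True M by linarith
          then show ?thesis using True by (simp add: p_def M_def)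
        qed (use True in \<open>simp add: p_def M_def\<close>)
        then show ?thesis using True T by simp
      next
        case False
        then show ?thesis using that M by (auto simp: p_def)
      qed
      have "dyadic_affine g (of_int (m - int T)) (of_int (m - int T) + 1)"
      proof (rule dyadic_affine_id[OF dyadic_interval_unit])
        fix x :: real assume "of_int (m - int T) \<le> x"
        moreover have "real N \<le> of_int (m - int T)" using 3 T by linarith
        ultimately show "g x = x" by (intro outside) auto
      qed
      moreover have "p m = of_int (m - int T)" "p (m + 1) = of_int (m - int T) + 1"
        using 3 *[of m] *[of "m + 1"] by auto
      ultimately show ?thesis by (simp only:)
    qed
  qed
  have left: "p m = m" if "m \<le> - int N" for m using that by (simp add: p_def)
  have right: "p m = m - int T" if "M + int N + 1 \<le> m" for m
    using that M by (simp add: p_def)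
  have "\<exists>ks. length ks = T \<and> (\<forall>m. \<forall>s\<in>{0..1}. carets ks (p m + s * (p (m + 1) - p m)) = m + s)"
  proof (rule partition_carets[of p "M + int N + 1"])
    show "dyadic_interval (p m) (p (m + 1))" for m using aff by (simp add: dyadic_affine_def)
    show "p m = m" if "m \<le> - (M + int N + 1)" for m
      using that M by (intro left) linarith
  qed (rule right)
  then obtain ks where ks: "length ks = T"
    "\<And>m s. 0 \<le> s \<Longrightarrow> s \<le> 1 \<Longrightarrow> carets ks (p m + s * (p (m + 1) - p m)) = m + s" by auto
  have "\<exists>ls. length ls = T \<and> (\<forall>m. \<forall>s\<in>{0..1}.
      carets ls (g (p m) + s * (g (p (m + 1)) - g (p m))) = m + s)"
  proof (rule partition_carets[of "g \<circ> p" "M + int N + 1", unfolded comp_def])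
    fix m
    show "dyadic_interval (g (p m)) (g (p (m + 1)))" using aff by (simp add: dyadic_affine_def)
  next
    fix m assume "m \<le> - (M + int N + 1)"
    then have "m \<le> - int N" using M by linarith
    moreover from this have "real_of_int m \<le> - real N" by linarith
    ultimately show "g (p m) = m" using left[of m] outside[of m] by simp
  next
    fix m assume "M + int N + 1 \<le> m"
    moreover from this have "real N \<le> real_of_int m - real T" using T by linarith
    ultimately show "g (p m) = m - int T" using right[of m] outside[of "m - int T"] by simp
  qed
  then obtain ls where ls: "length ls = T" "\<And>m s. 0 \<le> s \<Longrightarrow> s \<le> 1 \<Longrightarrow>
      carets ls (g (p m) + s * (g (p (m + 1)) - g (p m))) = m + s" by auto
  have inj: "carets ks t = carets ks t' \<Longrightarrow> t = t'" for t t'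
    by (metis word_map_inv_splits word_map_inv_apply)
  have "carets ls (g t) = carets ks t" for t
  proof -
    define m where "m = \<lfloor>carets ks t\<rfloor>"
    define s where "s = carets ks t - m"
    have s: "0 \<le> s" "s \<le> 1" unfolding s_def m_def by linarith+
    have ms: "carets ks t = m + s" by (simp add: s_def)
    have t: "t = p m + s * (p (m + 1) - p m)"
      by (rule inj, rule HOL.trans[OF ms], rule ks(2)[OF s, symmetric])
    have "g (p m + s * (p (m + 1) - p m)) = g (p m) + s * (g (p (m + 1)) - g (p m))"
      using aff[of m] s unfolding dyadic_affine_def by simp
    then have "carets ls (g t) = m + s" using ls(2)[OF s, of m] by (simp flip: t)
    then show ?thesis by (simp only: ms)
  qed
  then have "word_map (word_inv (splits ls)) (g t) = word_map (word_inv (splits ks)) t" for t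
    by (simp add: word_map_inv_splits)
  then have "word_map (splits ls) (word_map (word_inv (splits ks)) t) = g t" for t
    by (metis word_map_inv_apply)
  then have "word_map (splits ls @ word_inv (splits ks)) = g" by (simp add: fun_eq_iff)
  moreover have "word_sum (splits ls @ word_inv (splits ks)) = 0" using ks(1) ls(1) by simp
  ultimately show ?thesis by blast
qed

section \<open>Thompson's group F\<close>

lemma dyadics_Ints: "x \<in> dyadics \<longleftrightarrow> (\<exists>n :: nat. x * 2 ^ n \<in> \<int>)"
proof
  assume "x \<in> dyadics"
  then obtain m :: int and n :: nat where "x = of_int m / 2 ^ n" by (auto simp: dyadics_def)
  then have "x * 2 ^ n = of_int m" by simp
  then show "\<exists>n :: nat. x * 2 ^ n \<in> \<int>" by (metis Ints_of_int)
next
  assume "\<exists>n :: nat. x * 2 ^ n \<in> \<int>"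
  then obtain n m where "x * 2 ^ n = of_int m" by (auto elim: Ints_cases)
  then have "x = of_int m / 2 ^ n" by (simp add: field_simps)
  then show "x \<in> dyadics" by (auto simp: dyadics_def)
qed

lemma Ints_power_mono:
  assumes "x * 2 ^ n \<in> \<int>" "n \<le> k" shows "(x :: real) * 2 ^ k \<in> \<int>"
proof -
  have "(2 :: real) ^ k = 2 ^ n * 2 ^ (k - n)" using assms(2) by (simp flip: power_add)
  then have "x * 2 ^ k = x * 2 ^ n * 2 ^ (k - n)" by (simp only: mult.assoc)
  also have "\<dots> \<in> \<int>" by (rule Ints_mult[OF assms(1)]) simp
  finally show ?thesis .
qed

lemma dyadics_of_int [simp]: "of_int m \<in> dyadics"
  unfolding dyadics_Ints by (intro exI[of _ 0]) simp

lemma dyadics_add: "x \<in> dyadics \<Longrightarrow> y \<in> dyadics \<Longrightarrow> x + y \<in> dyadics"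
  unfolding dyadics_Ints
proof (elim exE)
  fix n k assume "x * 2 ^ n \<in> \<int>" "y * 2 ^ k \<in> \<int>"
  then have "x * 2 ^ max n k + y * 2 ^ max n k \<in> \<int>"
    by (intro Ints_add) (auto intro: Ints_power_mono)
  then show "\<exists>n. (x + y) * 2 ^ n \<in> \<int>" by (auto simp: distrib_right)
qed

lemma dyadics_minus: "x \<in> dyadics \<Longrightarrow> - x \<in> dyadics"
  unfolding dyadics_Ints by (auto simp: minus_mult_left[symmetric] simp del: minus_mult_left)

lemma dyadics_diff: "x \<in> dyadics \<Longrightarrow> y \<in> dyadics \<Longrightarrow> x - y \<in> dyadics"
  using dyadics_add[of x "- y"] dyadics_minus[of y] by simp

lemma dyadics_powi_mult:
  assumes "x \<in> dyadics" shows "2 powi k * x \<in> dyadics"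
proof -
  obtain n where n: "x * 2 ^ n \<in> \<int>" using assms by (auto simp: dyadics_Ints)
  show ?thesis
  proof (cases "k \<ge> 0")
    case True
    then have "2 powi k * x * 2 ^ n = 2 ^ nat k * (x * 2 ^ n)"
      by (simp add: power_int_def)
    also have "\<dots> \<in> \<int>" using n by simp
    finally show ?thesis unfolding dyadics_Ints by blast
  next
    case False
    then have "2 powi k * x * 2 ^ (n + nat (- k)) = x * 2 ^ n"
      by (simp add: power_int_def power_add field_simps)
    then show ?thesis unfolding dyadics_Ints using n by metis
  qed
qed

lemma dyadics_affine_iff:
  assumes "c \<in> dyadics" shows "2 powi k * x + c \<in> dyadics \<longleftrightarrow> x \<in> dyadics"
proof
  assume "2 powi k * x + c \<in> dyadics"
  then have "2 powi (- k) * ((2 powi k * x + c) - c) \<in> dyadics"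
    using assms by (intro dyadics_powi_mult dyadics_diff)
  moreover have "2 powi (- k) * ((2 powi k * x + c) - c) = x"
    by (simp add: power_int_minus field_simps)
  ultimately show "x \<in> dyadics" by (simp only:)
qed (use assms in \<open>auto intro: dyadics_add dyadics_powi_mult\<close>)

lemma dyadics_grid: "of_int m / 2 ^ n \<in> dyadics"
  by (auto simp: dyadics_def)

lemma thompson_mapsD:
  assumes "f \<in> thompson_maps"
  shows "f \<in> extensional {0..1}" "strict_mono_on {0..1} f" "continuous_on {0..1} f"
    "f ` {0..1} = {0..1}" "f 0 = 0" "f 1 = 1" "f \<in> Bij {0..1}"
    "\<And>x. 0 \<le> x \<Longrightarrow> x \<le> 1 \<Longrightarrow> 0 \<le> f x \<and> f x \<le> 1"
proof -
  show ext: "f \<in> extensional {0..1}" and mono: "strict_mono_on {0..1} f"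
    and "continuous_on {0..1} f" and im: "f ` {0..1} = {0..1}"
    using assms by (auto simp: thompson_maps_def)
  show bounds: "0 \<le> f x \<and> f x \<le> 1" if "0 \<le> x" "x \<le> 1" for x using im that by auto
  have le: "f x \<le> f y" if "0 \<le> x" "x \<le> y" "y \<le> 1" for x y
    using strict_mono_on_leD[OF mono, of x y] that by simp
  obtain x where x: "x \<in> {0..1}" "f x = 0" using im by (metis atLeastAtMost_iff imageE order_refl zero_le_one)
  then show "f 0 = 0" using le[of 0 x] bounds[of 0] by simp
  obtain y where y: "y \<in> {0..1}" "f y = 1" using im by (metis atLeastAtMost_iff imageE order_refl zero_le_one)
  then show "f 1 = 1" using le[of y 1] bounds[of 1] by simp
  show "f \<in> Bij {0..1}"
    using ext im strict_mono_on_imp_inj_on[OF mono] by (simp add: Bij_def bij_betw_def)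
qed

definition breaks_within :: "(real \<Rightarrow> real) \<Rightarrow> real set \<Rightarrow> bool" where
  "breaks_within f D \<longleftrightarrow> (\<forall>a b. 0 \<le> a \<and> a < b \<and> b \<le> 1 \<and> D \<inter> {a<..<b} = {} \<longrightarrow>
     (\<exists>(k :: int) c. \<forall>x\<in>{a..b}. f x = 2 powi k * x + c))"

lemma breaks_withinD:
  assumes "breaks_within f D" "0 \<le> a" "a < b" "b \<le> 1" "D \<inter> {a<..<b} = {}"
  obtains k :: int and c where "\<forall>x\<in>{a..b}. f x = 2 powi k * x + c"
  using assms unfolding breaks_within_def by (elim allE[of _ a] allE[of _ b]) auto

lemma thompson_maps_altdef:
  "thompson_maps = {f \<in> extensional {0..1}. strict_mono_on {0..1} f \<and> continuous_on {0..1} f \<and>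
     f ` {0..1} = {0..1} \<and> (\<exists>D. finite D \<and> D \<subseteq> dyadics \<and> breaks_within f D)}"
  by (simp add: thompson_maps_def breaks_within_def)

lemma thompson_mapsI:
  assumes "f \<in> extensional {0..1}" "strict_mono_on {0..1} f" "continuous_on {0..1} f"
    "f ` {0..1} = {0..1}" "finite D" "D \<subseteq> dyadics"
    and "\<And>a b. 0 \<le> a \<Longrightarrow> a < b \<Longrightarrow> b \<le> 1 \<Longrightarrow> D \<inter> {a<..<b} = {} \<Longrightarrow>
      \<exists>(k :: int) c. \<forall>x\<in>{a..b}. f x = 2 powi k * x + c"
  shows "f \<in> thompson_maps"
proof -
  have "breaks_within f D" unfolding breaks_within_def using assms(7) by simp
  with assms(1-6) show ?thesis by (auto simp: thompson_maps_altdef)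
qed

lemma finite_dyadics_grid:
  assumes "finite D" "D \<subseteq> dyadics"
  shows "\<exists>n. \<forall>d\<in>D. d * 2 ^ n \<in> \<int>"
  using assms
proof (induction rule: finite_induct)
  case (insert d D)
  then obtain n where n: "\<forall>d\<in>D. d * 2 ^ n \<in> \<int>" by auto
  obtain k where k: "d * 2 ^ k \<in> \<int>" using insert.prems by (auto simp: dyadics_Ints)
  have "\<forall>x\<in>insert d D. x * 2 ^ max n k \<in> \<int>"
    using n k by (auto intro: Ints_power_mono)
  then show ?case by blast
qed simp

lemma unit_interval_cell:
  fixes x :: real
  assumes "0 \<le> x" "x < 1"
  obtains a :: nat where "a < 2 ^ n" "real a / 2 ^ n \<le> x" "x < (real a + 1) / 2 ^ n"
proof
  define a where "a = nat \<lfloor>x * 2 ^ n\<rfloor>"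
  have a: "real a = of_int \<lfloor>x * 2 ^ n\<rfloor>" using assms unfolding a_def by simp
  have le: "real a \<le> x * 2 ^ n" unfolding a by simp
  then show "real a / 2 ^ n \<le> x" by (simp add: field_simps)
  have "x * 2 ^ n < real a + 1" unfolding a by linarith
  then show "x < (real a + 1) / 2 ^ n" by (simp add: field_simps)
  have "x * 2 ^ n < 1 * 2 ^ n" using assms(2) by (rule mult_strict_right_mono) simp
  then have "real a < 2 ^ n" using le by linarith
  then have "real a < real (2 ^ n)" by (simp only: of_nat_power of_nat_numeral)
  then show "a < 2 ^ n" by (simp only: of_nat_less_iff)
qed

text \<open>All singularities lie on one grid. The values at the grid points are dyadic because $f(0)=0$ and
$f$ grows by a dyadic number from each grid point to the next; hence the constant terms are dyadic.\<close>

lemma thompson_grid: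
  assumes f: "f \<in> thompson_maps"
  shows "\<exists>n. \<forall>a<2 ^ n. \<exists>(k :: int). \<exists>c\<in>dyadics.
    \<forall>x\<in>{real a / 2 ^ n..(real a + 1) / 2 ^ n}. f x = 2 powi k * x + c"
proof -
  obtain D where D: "finite D" "D \<subseteq> dyadics" "breaks_within f D"
    using f by (auto simp: thompson_maps_altdef)
  obtain n where n: "\<forall>d\<in>D. d * 2 ^ n \<in> \<int>" using finite_dyadics_grid D by metis
  have cell: "\<exists>(k :: int) c. \<forall>x\<in>{real a / 2 ^ n..(real a + 1) / 2 ^ n}. f x = 2 powi k * x + c"
    if a: "a < 2 ^ n" for a
  proof -
    have "real (a + 1) \<le> real (2 ^ n)" using a by (subst of_nat_le_iff) simp
    then have 1: "(real a + 1) / 2 ^ n \<le> 1" by simp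
    have 2: "D \<inter> {real a / 2 ^ n<..<(real a + 1) / 2 ^ n} = {}"
    proof (rule ccontr)
      assume "\<not> ?thesis"
      then obtain d where d: "d \<in> D" "real a / 2 ^ n < d" "d < (real a + 1) / 2 ^ n" by auto
      then obtain z :: int where z: "d * 2 ^ n = of_int z" using n by (metis Ints_cases)
      have "of_int (int a) < real_of_int z" "real_of_int z < of_int (int a + 1)"
        using d by (simp_all add: field_simps flip: z)
      then show False unfolding of_int_less_iff by linarith
    qed
    show ?thesis
      by (rule breaks_withinD[OF D(3) _ _ 1 2]) (auto simp: divide_strict_right_mono)
  qed
  have val: "f (real a / 2 ^ n) \<in> dyadics" if "a \<le> 2 ^ n" for a
    using that
  proof (induction a)
    case 0
    then show ?case using thompson_mapsD(5)[OF f] dyadics_of_int[of 0] by simp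
  next
    case (Suc a)
    obtain k :: int and c where kc:
      "\<forall>x\<in>{real a / 2 ^ n..(real a + 1) / 2 ^ n}. f x = 2 powi k * x + c"
      using cell[of a] Suc.prems by auto
    have "f (real (Suc a) / 2 ^ n) = 2 powi k * (real (Suc a) / 2 ^ n) + c"
      using kc by (simp add: add.commute divide_right_mono)
    moreover have "f (real a / 2 ^ n) = 2 powi k * (real a / 2 ^ n) + c"
      using kc by (simp add: divide_right_mono)
    ultimately have "f (real (Suc a) / 2 ^ n) = 2 powi k * (1 / 2 ^ n) + f (real a / 2 ^ n)"
      by (simp add: field_simps)
    moreover have "1 / 2 ^ n \<in> dyadics" using dyadics_grid[of 1 n] by simp
    moreover have "f (real a / 2 ^ n) \<in> dyadics" using Suc by simp
    ultimately show ?case by (metis dyadics_add dyadics_powi_mult)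
  qed
  show ?thesis
  proof (intro exI[of _ n] allI impI)
    fix a :: nat assume a: "a < 2 ^ n"
    obtain k :: int and c where kc:
      "\<forall>x\<in>{real a / 2 ^ n..(real a + 1) / 2 ^ n}. f x = 2 powi k * x + c"
      using cell[OF a] by auto
    then have "f (real a / 2 ^ n) = 2 powi k * (real a / 2 ^ n) + c"
      by (simp add: divide_right_mono)
    then have "c = f (real a / 2 ^ n) - 2 powi k * (real a / 2 ^ n)" by simp
    also have "\<dots> \<in> dyadics"
      using a dyadics_grid[of "int a" n] by (intro dyadics_diff val dyadics_powi_mult) auto
    finally show "\<exists>k. \<exists>c\<in>dyadics. \<forall>x\<in>{real a / 2 ^ n..(real a + 1) / 2 ^ n}. f x = 2 powi k * x + c"
      using kc by blast
  qed
qed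

lemma thompson_dyadics_iff:
  assumes f: "f \<in> thompson_maps" and x: "0 \<le> x" "x \<le> 1"
  shows "f x \<in> dyadics \<longleftrightarrow> x \<in> dyadics"
proof (cases "x = 1")
  case True
  then show ?thesis using thompson_mapsD(6)[OF f] by simp
next
  case False
  obtain n where n: "\<forall>a<2 ^ n. \<exists>(k :: int). \<exists>c\<in>dyadics.
      \<forall>x\<in>{real a / 2 ^ n..(real a + 1) / 2 ^ n}. f x = 2 powi k * x + c"
    using thompson_grid[OF f] by blast
  obtain a where "a < 2 ^ n" "real a / 2 ^ n \<le> x" "x < (real a + 1) / 2 ^ n"
    using unit_interval_cell[of x n] x False by auto
  then obtain k :: int and c where "c \<in> dyadics" "f x = 2 powi k * x + c"
    using n by (meson atLeastAtMost_iff less_imp_le)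
  then show ?thesis by (simp add: dyadics_affine_iff)
qed

text \<open>The converse of \<open>thompson_grid\<close>. Continuity and monotonicity come for free, because neighbouring
closed cells share an end point.\<close>

lemma thompson_mapsI_grid:
  assumes ext: "f \<in> extensional {0..1}" and f0: "f 0 = 0" and f1: "f 1 = 1"
    and cell: "\<And>a. a < 2 ^ n \<Longrightarrow> \<exists>(k :: int) c.
      \<forall>x\<in>{real a / 2 ^ n..(real a + 1) / 2 ^ n}. f x = 2 powi k * x + c"
  shows "f \<in> thompson_maps"
proof -
  have cell_mono: "f x < f y" if "a < 2 ^ n" "real a / 2 ^ n \<le> x" "x < y" "y \<le> (real a + 1) / 2 ^ n"
    for a x y
    using cell[OF that(1)] that by auto
  have *: "strict_mono_on {0..real a / 2 ^ n} f \<and> continuous_on {0..real a / 2 ^ n} f"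
    if "a \<le> 2 ^ n" for a
    using that
  proof (induction a)
    case 0
    then show ?case by (simp add: strict_mono_on_def)
  next
    case (Suc a)
    let ?p = "real a / 2 ^ n" and ?q = "(real a + 1) / 2 ^ n"
    have a: "a < 2 ^ n" using Suc.prems by simp
    have pq: "?p \<le> ?q" by (simp add: divide_right_mono)
    have IH: "strict_mono_on {0..?p} f" "continuous_on {0..?p} f" using Suc by auto
    have "f x < f y" if xy: "0 \<le> x" "x < y" "y \<le> ?q" for x y
    proof -
      consider "y \<le> ?p" | "?p \<le> x" | "x < ?p" "?p < y" by linarith
      then show ?thesis
      proof cases
        case 1
        then show ?thesis using strict_mono_onD[OF IH(1)] xy by simp
      next
        case 2
        then show ?thesis using cell_mono[OF a] xy by blast
      next
        case 3
        then have "f x < f ?p" using strict_mono_onD[OF IH(1)] xy by simp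
        also have "\<dots> < f y" using cell_mono[OF a] 3 xy by simp
        finally show ?thesis .
      qed
    qed
    then have "strict_mono_on {0..?q} f" by (simp add: strict_mono_on_def)
    moreover have "continuous_on {0..?q} f"
    proof -
      obtain k :: int and c where kc: "\<forall>x\<in>{?p..?q}. f x = 2 powi k * x + c"
        using cell[OF a] by auto
      have "continuous_on {?p..?q} f \<longleftrightarrow> continuous_on {?p..?q} (\<lambda>x. 2 powi k * x + c)"
        using kc by (intro continuous_on_cong) auto
      then have "continuous_on {?p..?q} f" by (simp add: continuous_intros)
      then have "continuous_on ({0..?p} \<union> {?p..?q}) f"
        using IH(2) by (intro continuous_on_closed_Un) auto
      then show ?thesis using pq by (simp add: ivl_disj_un_two_touch)
    qed
    ultimately show ?case by (simp add: add.commute)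
  qed
  from *[of "2 ^ n"] have mono: "strict_mono_on {0..1} f" and cont: "continuous_on {0..1} f"
    by auto
  have im: "f ` {0..1} = {0..1}"
  proof
    show "f ` {0..1} \<subseteq> {0..1}"
      using strict_mono_on_leD[OF mono, of 0] strict_mono_on_leD[OF mono, of _ 1] f0 f1 by fastforce
    show "{0..1} \<subseteq> f ` {0..1}"
    proof
      fix y :: real assume "y \<in> {0..1}"
      then have "\<exists>x. 0 \<le> x \<and> x \<le> 1 \<and> f x = y"
        using f0 f1 cont by (intro IVT') auto
      then show "y \<in> f ` {0..1}" by auto
    qed
  qed
  define D where "D = (\<lambda>a. real a / 2 ^ n) ` {..2 ^ n}"
  have "D \<subseteq> dyadics" using dyadics_grid[of "int _" n] by (auto simp: D_def)
  moreover have "\<exists>(k :: int) c. \<forall>x\<in>{a..b}. f x = 2 powi k * x + c"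
    if ab: "0 \<le> a" "a < b" "b \<le> 1" "D \<inter> {a<..<b} = {}" for a b
  proof -
    obtain i where i: "i < 2 ^ n" "real i / 2 ^ n \<le> a" "a < (real i + 1) / 2 ^ n"
      using unit_interval_cell[of a n] ab by auto
    have "(real i + 1) / 2 ^ n \<in> D"
      unfolding D_def using i(1) by (intro image_eqI[of _ _ "Suc i"]) (auto simp: add.commute)
    then have "b \<le> (real i + 1) / 2 ^ n" using ab(4) i(3) by force
    then have "{a..b} \<subseteq> {real i / 2 ^ n..(real i + 1) / 2 ^ n}" using i by auto
    then show ?thesis using cell[OF i(1)] by blast
  qed
  moreover have "finite D" by (simp add: D_def)
  ultimately show ?thesis using ext mono cont im by (intro thompson_mapsI[of f D])
qed

text \<open>The singularities of $f \circ g$ are singularities of $g$ or are mapped to singularities of $f$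
by $g$; the latter points are dyadic by \<open>thompson_dyadics_iff\<close>.\<close>

lemma thompson_compose:
  assumes f: "f \<in> thompson_maps" and g: "g \<in> thompson_maps"
  shows "compose {0..1} f g \<in> thompson_maps"
proof -
  note F = thompson_mapsD[OF f] and G = thompson_mapsD[OF g]
  obtain D where D: "finite D" "D \<subseteq> dyadics" "breaks_within f D"
    using f by (auto simp: thompson_maps_altdef)
  obtain E where E: "finite E" "E \<subseteq> dyadics" "breaks_within g E"
    using g by (auto simp: thompson_maps_altdef)
  define H where "H = E \<union> {x \<in> {0..1}. g x \<in> D}"
  have inj: "inj_on g {0..1}" using strict_mono_on_imp_inj_on[OF G(2)] .
  have "finite {x \<in> {0..1}. g x \<in> D}"
    using finite_vimage_IntI[OF D(1) inj] by (simp add: vimage_def Int_def conj_commute)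
  then have "finite H" using E(1) by (simp add: H_def)
  moreover have "H \<subseteq> dyadics"
    using E(2) D(2) thompson_dyadics_iff[OF g] by (auto simp: H_def)
  moreover have "\<exists>(k :: int) c. \<forall>x\<in>{a..b}. compose {0..1} f g x = 2 powi k * x + c"
    if ab: "0 \<le> a" "a < b" "b \<le> 1" "H \<inter> {a<..<b} = {}" for a b
  proof -
    have "E \<inter> {a<..<b} = {}" using ab(4) by (auto simp: H_def)
    then obtain k :: int and c where k: "\<forall>x\<in>{a..b}. g x = 2 powi k * x + c"
      using breaks_withinD[OF E(3) ab(1-3)] by blast
    have le: "g x \<le> g y" if "0 \<le> x" "x \<le> y" "y \<le> 1" for x y
      using strict_mono_on_leD[OF G(2), of x y] that by simp
    have "D \<inter> {g a<..<g b} = {}"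
    proof (rule ccontr)
      assume "\<not> ?thesis"
      then obtain d where d: "d \<in> D" "g a < d" "d < g b" by auto
      then have "d \<in> {0..1}" using G(8)[of a] G(8)[of b] ab by auto
      then obtain x where x: "x \<in> {0..1}" "d = g x" using G(4) by (metis imageE)
      have "a < x" using le[of x a] d x ab by fastforce
      moreover have "x < b" using le[of b x] d x ab by fastforce
      ultimately have "x \<in> H \<inter> {a<..<b}" using x d by (auto simp: H_def)
      then show False using ab(4) by blast
    qed
    moreover have "g a < g b" using strict_mono_onD[OF G(2), of a b] ab by simp
    moreover have "0 \<le> g a" "g b \<le> 1" using G(8)[of a] G(8)[of b] ab by auto
    ultimately obtain l :: int and d where l: "\<forall>x\<in>{g a..g b}. f x = 2 powi l * x + d"
      using breaks_withinD[OF D(3)] by blast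
    have "compose {0..1} f g x = 2 powi (l + k) * x + (2 powi l * c + d)"
      if x: "x \<in> {a..b}" for x
    proof -
      have "g x \<in> {g a..g b}" using le[of a x] le[of x b] x ab by auto
      then have "f (g x) = 2 powi l * (2 powi k * x + c) + d" using l k x by simp
      then show ?thesis using x ab by (simp add: compose_def power_int_add algebra_simps)
    qed
    then show ?thesis by blast
  qed
  moreover have "strict_mono_on {0..1} (compose {0..1} f g)"
  proof (rule strict_mono_onI)
    fix x y :: real assume "x \<in> {0..1}" "y \<in> {0..1}" "x < y"
    then show "compose {0..1} f g x < compose {0..1} f g y"
      using G(8)[of x] G(8)[of y] strict_mono_onD[OF G(2), of x y]
        strict_mono_onD[OF F(2), of "g x" "g y"] by (simp add: compose_def)
  qed
  moreover have "continuous_on {0..1} (compose {0..1} f g)"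
  proof -
    have "continuous_on {0..1} (f \<circ> g)"
      using F(3) G(3) G(4) by (intro continuous_on_compose) auto
    then show ?thesis by (rule continuous_on_eq) (simp add: compose_def)
  qed
  moreover have "compose {0..1} f g ` {0..1} = {0..1}"
  proof -
    have "compose {0..1} f g ` {0..1} = f ` g ` {0..1}" by (auto simp: compose_def image_iff)
    then show ?thesis using F(4) G(4) by simp
  qed
  moreover have "compose {0..1} f g \<in> extensional {0..1}" by (simp add: compose_extensional)
  ultimately show ?thesis by (intro thompson_mapsI[of _ H])
qed

lemma thompson_inverse:
  assumes f: "f \<in> thompson_maps"
  shows "(\<lambda>x\<in>{0..1}. inv_into {0..1} f x) \<in> thompson_maps"
proof -
  note F = thompson_mapsD[OF f]
  define h where "h = (\<lambda>x\<in>{0..1}. inv_into {0..1} f x)"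
  have inj: "inj_on f {0..1}" using strict_mono_on_imp_inj_on[OF F(2)] .
  have hf: "h (f x) = x" if "0 \<le> x" "x \<le> 1" for x
    using that F(8)[of x] inv_into_f_f[OF inj, of x] by (simp add: h_def)
  have fh: "f (h y) = y" "0 \<le> h y" "h y \<le> 1" if "0 \<le> y" "y \<le> 1" for y
    using that f_inv_into_f[of y f "{0..1}"] inv_into_into[of y f "{0..1}"] F(4)
    by (simp_all add: h_def)
  have le: "f x \<le> f y" if "0 \<le> x" "x \<le> y" "y \<le> 1" for x y
    using strict_mono_on_leD[OF F(2), of x y] that by simp
  have h_less: "h x < h y" if "0 \<le> x" "x < y" "y \<le> 1" for x y
    using le[of "h y" "h x"] fh[of x] fh[of y] that by (cases "h x < h y") auto
  obtain D where D: "finite D" "D \<subseteq> dyadics" "breaks_within f D"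
    using f by (auto simp: thompson_maps_altdef)
  define E where "E = f ` (D \<inter> {0..1})"
  have "E \<subseteq> dyadics" using D(2) thompson_dyadics_iff[OF f] by (auto simp: E_def)
  moreover have "\<exists>(k :: int) c. \<forall>x\<in>{a..b}. h x = 2 powi k * x + c"
    if ab: "0 \<le> a" "a < b" "b \<le> 1" "E \<inter> {a<..<b} = {}" for a b
  proof -
    have "D \<inter> {h a<..<h b} = {}"
    proof (rule ccontr)
      assume "\<not> ?thesis"
      then obtain d where d: "d \<in> D" "h a < d" "d < h b" by auto
      then have "d \<in> {0..1}" using fh[of a] fh[of b] ab by auto
      moreover have "h a \<in> {0..1}" "h b \<in> {0..1}" using fh[of a] fh[of b] ab by auto
      ultimately have "f (h a) < f d" "f d < f (h b)"
        using d by (auto intro: strict_mono_onD[OF F(2)] simp del: atLeastAtMost_iff)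
      moreover have "f d \<in> E" using d(1) \<open>d \<in> {0..1}\<close> unfolding E_def by blast
      ultimately have "f d \<in> E \<inter> {a<..<b}" using fh[of a] fh[of b] ab(1-3) by simp
      then show False using ab(4) by blast
    qed
    moreover have "h a < h b" "0 \<le> h a" "h b \<le> 1"
      using h_less[of a b] fh[of a] fh[of b] ab by auto
    ultimately obtain k :: int and c where k: "\<forall>x\<in>{h a..h b}. f x = 2 powi k * x + c"
      using breaks_withinD[OF D(3)] by blast
    have "h x = 2 powi (- k) * x + (- (2 powi (- k) * c))" if x: "x \<in> {a..b}" for x
    proof -
      have "h x \<in> {h a..h b}"
        using h_less[of a x] h_less[of x b] x ab by (cases "a = x"; cases "x = b") auto
      then have "x = 2 powi k * h x + c" using k fh[of x] x ab by auto
      then have "2 powi (- k) * x + (- (2 powi (- k) * c)) = 2 powi (- k) * (2 powi k * h x)"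
        by (metis add.commute add_diff_cancel_left' right_diff_distrib diff_conv_add_uminus)
      then show ?thesis by (simp add: power_int_minus)
    qed
    then show ?thesis by blast
  qed
  moreover have "finite E" using D(1) by (simp add: E_def)
  moreover have "strict_mono_on {0..1} h" by (rule strict_mono_onI) (auto intro: h_less)
  moreover have "continuous_on {0..1} h"
    using continuous_on_inv[OF F(3), of h] hf F(4) by auto
  moreover have "h ` {0..1} = {0..1}"
  proof
    show "h ` {0..1} \<subseteq> {0..1}" using fh by auto
    show "{0..1} \<subseteq> h ` {0..1}"
    proof
      fix x :: real assume "x \<in> {0..1}"
      then show "x \<in> h ` {0..1}" using hf[of x] F(8)[of x] by (intro image_eqI[of _ _ "f x"]) auto
    qed
  qed
  moreover have "h \<in> extensional {0..1}" by (simp add: h_def)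
  ultimately have "h \<in> thompson_maps" by (intro thompson_mapsI[of h E])
  then show ?thesis by (simp add: h_def)
qed

lemma thompson_id: "(\<lambda>x\<in>{0..1}. x) \<in> thompson_maps"
proof (rule thompson_mapsI_grid[where n = 0])
  fix a :: nat assume "a < 2 ^ 0"
  then show "\<exists>(k :: int) c. \<forall>x\<in>{real a / 2 ^ 0..(real a + 1) / 2 ^ 0}.
      (\<lambda>x\<in>{0..1}. x) x = 2 powi k * x + c"
    by (intro exI[of _ 0]) simp
qed auto

lemma subgroup_thompson: "subgroup thompson_maps (BijGroup {0..1})"
proof (rule group.subgroupI[OF group_BijGroup])
  show "thompson_maps \<subseteq> carrier (BijGroup {0..1})"
    using thompson_mapsD(7) by (auto simp: BijGroup_def)
  show "thompson_maps \<noteq> {}" using thompson_id by blast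
next
  fix f assume f: "f \<in> thompson_maps"
  show "inv\<^bsub>BijGroup {0..1}\<^esub> f \<in> thompson_maps"
    using thompson_inverse[OF f] inv_BijGroup[OF thompson_mapsD(7)[OF f]] by simp
next
  fix f g assume "f \<in> thompson_maps" "g \<in> thompson_maps"
  then show "f \<otimes>\<^bsub>BijGroup {0..1}\<^esub> g \<in> thompson_maps"
    using thompson_compose thompson_mapsD(7) by (simp add: BijGroup_def)
qed

lemma group_thompson_F: "group thompson_F"
  unfolding thompson_F_def by (rule subgroup.subgroup_is_group[OF subgroup_thompson group_BijGroup])

lemma thompson_F_simps [simp]:
  "carrier thompson_F = thompson_maps" "\<one>\<^bsub>thompson_F\<^esub> = (\<lambda>x\<in>{0..1}. x)"
  by (simp_all add: thompson_F_def BijGroup_def)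

lemma thompson_F_mult [simp]:
  "f \<in> thompson_maps \<Longrightarrow> g \<in> thompson_maps \<Longrightarrow> f \<otimes>\<^bsub>thompson_F\<^esub> g = compose {0..1} f g"
  using thompson_mapsD(7) by (simp add: thompson_F_def BijGroup_def)

section \<open>Commutators are the identity near the ends\<close>

definition interior_maps :: "(real \<Rightarrow> real) set" where
  "interior_maps = {f \<in> thompson_maps. \<exists>e>0. \<forall>x\<in>{0..1}. x \<le> e \<or> 1 - e \<le> x \<longrightarrow> f x = x}"

lemma thompson_ends:
  assumes f: "f \<in> thompson_maps"
  obtains e \<alpha> \<beta> where "0 < e" "0 < \<alpha>" "0 < \<beta>" "\<And>x. 0 \<le> x \<Longrightarrow> x \<le> e \<Longrightarrow> f x = \<alpha> * x"
    "\<And>x. 1 - e \<le> x \<Longrightarrow> x \<le> 1 \<Longrightarrow> 1 - f x = \<beta> * (1 - x)"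
proof -
  obtain n where n: "\<forall>a<2 ^ n. \<exists>(k :: int). \<exists>c\<in>dyadics.
      \<forall>x\<in>{real a / 2 ^ n..(real a + 1) / 2 ^ n}. f x = 2 powi k * x + c"
    using thompson_grid[OF f] by blast
  obtain k :: int and c where k: "\<forall>x\<in>{0..1 / 2 ^ n}. f x = 2 powi k * x + c"
    using n[rule_format, of 0] by auto
  have "c = 0" using k thompson_mapsD(5)[OF f] by simp
  obtain l :: int and d where l: "\<forall>x\<in>{1 - 1 / 2 ^ n..1}. f x = 2 powi l * x + d"
    using n[rule_format, of "2 ^ n - 1"] by (auto simp: of_nat_diff diff_divide_distrib)
  have "2 powi l + d = 1" using l thompson_mapsD(6)[OF f] by simp
  then have d: "d = 1 - 2 powi l" by simp
  show thesis
  proof (rule that[of "1 / 2 ^ n" "2 powi k" "2 powi l"])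
    fix x :: real assume "x \<le> 1" "1 - 1 / 2 ^ n \<le> x"
    then show "1 - f x = 2 powi l * (1 - x)" using l d by (simp add: algebra_simps)
  qed (use k \<open>c = 0\<close> in auto)
qed


lemma interior_maps_iff:
  "f \<in> interior_maps \<longleftrightarrow> f \<in> thompson_maps \<and>
     (\<exists>e>0. (\<forall>x. 0 \<le> x \<and> x \<le> e \<longrightarrow> f x = x) \<and> (\<forall>x. 1 - e \<le> x \<and> x \<le> 1 \<longrightarrow> f x = x))"
  (is "_ \<longleftrightarrow> _ \<and> ?R")
proof (cases "f \<in> thompson_maps")
  case True
  have "?R" if "e > 0" "\<forall>x\<in>{0..1}. x \<le> e \<or> 1 - e \<le> x \<longrightarrow> f x = x" for e
    by (rule exI[of _ "min e 1"]) (use that in auto)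
  then show ?thesis using True by (auto simp: interior_maps_def)
qed (simp add: interior_maps_def)

text \<open>The two linear maps commute, so $h$ fixes $g(f(x))$ for all small $x \ge 0$, and these values fill
a neighbourhood of 0. For $h = fgf^{-1}g^{-1}$ the last hypothesis holds; in this form no inverse
has to be computed.\<close>

lemma commutator_fixes_near_zero:
  fixes f g h :: "real \<Rightarrow> real"
  assumes pos: "0 < d" "0 < \<alpha>" "0 < \<beta>"
    and f: "\<And>x. 0 \<le> x \<Longrightarrow> x \<le> d \<Longrightarrow> f x = \<alpha> * x"
    and g: "\<And>x. 0 \<le> x \<Longrightarrow> x \<le> d \<Longrightarrow> g x = \<beta> * x"
    and h: "\<And>x. 0 \<le> x \<Longrightarrow> x \<le> d \<Longrightarrow> h (g (f x)) = f (g x)"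
  shows "\<exists>e>0. \<forall>x. 0 \<le> x \<and> x \<le> e \<longrightarrow> h x = x"
proof -
  define e where "e = min d (min (d / \<alpha>) (d / \<beta>))"
  have e: "0 < e" "e \<le> d" "\<alpha> * e \<le> d" "\<beta> * e \<le> d"
    using pos by (auto simp: e_def min_def field_simps)
  have "h z = z" if z: "0 \<le> z" "z \<le> \<alpha> * \<beta> * e" for z
  proof -
    define w where "w = z / (\<alpha> * \<beta>)"
    have w: "0 \<le> w" "w \<le> e" "z = \<alpha> * \<beta> * w" using z pos by (simp_all add: w_def field_simps)
    have "\<alpha> * w \<le> d" "\<beta> * w \<le> d"
      using w e pos mult_left_mono[of w e \<alpha>] mult_left_mono[of w e \<beta>] by linarith+
    then show ?thesis using h[of w] f[of w] g[of w] f[of "\<beta> * w"] g[of "\<alpha> * w"] w e pos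
      by (simp add: mult.assoc mult.left_commute)
  qed
  then show ?thesis using e pos by (intro exI[of _ "\<alpha> * \<beta> * e"]) simp
qed

text \<open>The end 1 is reduced to the end 0 by conjugation with the reflection of the unit interval.\<close>

lemma commutator_interior:
  assumes f: "f \<in> thompson_maps" and g: "g \<in> thompson_maps" and h: "h \<in> thompson_maps"
    and comm: "\<And>x. 0 \<le> x \<Longrightarrow> x \<le> 1 \<Longrightarrow> h (g (f x)) = f (g x)"
  shows "h \<in> interior_maps"
proof -
  obtain d \<alpha> \<beta> where d: "0 < d" "0 < \<alpha>" "0 < \<beta>"
    "\<And>x. 0 \<le> x \<Longrightarrow> x \<le> d \<Longrightarrow> f x = \<alpha> * x"
    "\<And>x. 1 - d \<le> x \<Longrightarrow> x \<le> 1 \<Longrightarrow> 1 - f x = \<beta> * (1 - x)"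
    using thompson_ends[OF f] by blast
  obtain e \<gamma> \<delta> where e: "0 < e" "0 < \<gamma>" "0 < \<delta>"
    "\<And>x. 0 \<le> x \<Longrightarrow> x \<le> e \<Longrightarrow> g x = \<gamma> * x"
    "\<And>x. 1 - e \<le> x \<Longrightarrow> x \<le> 1 \<Longrightarrow> 1 - g x = \<delta> * (1 - x)"
    using thompson_ends[OF g] by blast
  define c where "c = min 1 (min d e)"
  have c: "0 < c" "c \<le> 1" "c \<le> d" "c \<le> e" using d e by (auto simp: c_def)
  have "\<exists>r>0. \<forall>x. 0 \<le> x \<and> x \<le> r \<longrightarrow> h x = x"
  proof (rule commutator_fixes_near_zero[of c \<alpha> \<gamma> f g])
    show "h (g (f x)) = f (g x)" if "0 \<le> x" "x \<le> c" for x using that c by (intro comm) auto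
  qed (use c d e in auto)
  then obtain r where r: "r > 0" "\<forall>x. 0 \<le> x \<and> x \<le> r \<longrightarrow> h x = x" by blast
  have "\<exists>r>0. \<forall>x. 0 \<le> x \<and> x \<le> r \<longrightarrow> 1 - h (1 - x) = x"
  proof (rule commutator_fixes_near_zero[of c \<beta> \<delta> "\<lambda>x. 1 - f (1 - x)" "\<lambda>x. 1 - g (1 - x)"])
    show "1 - h (1 - (1 - g (1 - (1 - f (1 - x))))) = 1 - f (1 - (1 - g (1 - x)))"
      if "0 \<le> x" "x \<le> c" for x
      using comm[of "1 - x"] that c by simp
  qed (use c d e in auto)
  then obtain s where s: "s > 0" "\<forall>x. 0 \<le> x \<and> x \<le> s \<longrightarrow> 1 - h (1 - x) = x" by blast
  have "h x = x" if "1 - s \<le> x" "x \<le> 1" for x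
    using s(2)[rule_format, of "1 - x"] that by simp
  then show ?thesis
    using h r s unfolding interior_maps_iff by (intro conjI exI[of _ "min r s"]) auto
qed

lemma subgroup_interior: "subgroup interior_maps thompson_F"
proof (rule group.subgroupI[OF group_thompson_F])
  show "interior_maps \<subseteq> carrier thompson_F" by (auto simp: interior_maps_iff)
  have "(\<lambda>x\<in>{0..1}. x) \<in> interior_maps"
    using thompson_id unfolding interior_maps_def by (auto intro: exI[of _ 1])
  then show "interior_maps \<noteq> {}" by blast
next
  fix f assume f: "f \<in> interior_maps"
  then have fF: "f \<in> thompson_maps" by (simp add: interior_maps_iff)
  have inj: "inj_on f {0..1}" using strict_mono_on_imp_inj_on thompson_mapsD(2)[OF fF] by blast
  have inv: "inv\<^bsub>thompson_F\<^esub> f = (\<lambda>x\<in>{0..1}. inv_into {0..1} f x)"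
    using group.m_inv_consistent[OF group_BijGroup subgroup_thompson fF]
      inv_BijGroup[OF thompson_mapsD(7)[OF fF]] by (simp add: thompson_F_def)
  have "inv_into {0..1} f x = x" if "f x = x" "x \<in> {0..1}" for x
    using inv_into_f_f[OF inj that(2)] that(1) by simp
  then show "inv\<^bsub>thompson_F\<^esub> f \<in> interior_maps"
    using f thompson_inverse[OF fF] unfolding inv interior_maps_def by auto
next
  fix f g assume fg: "f \<in> interior_maps" "g \<in> interior_maps"
  then obtain d e where d: "d > 0" "\<forall>x\<in>{0..1}. x \<le> d \<or> 1 - d \<le> x \<longrightarrow> f x = x"
    and e: "e > 0" "\<forall>x\<in>{0..1}. x \<le> e \<or> 1 - e \<le> x \<longrightarrow> g x = x"
    by (auto simp: interior_maps_def)
  have "compose {0..1} f g x = x" if "x \<in> {0..1}" "x \<le> min d e \<or> 1 - min d e \<le> x" for x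
    using that d e by (auto simp: compose_def)
  moreover have "compose {0..1} f g \<in> thompson_maps"
    using fg by (auto simp: interior_maps_def intro: thompson_compose)
  ultimately have "compose {0..1} f g \<in> interior_maps"
    using d(1) e(1) unfolding interior_maps_def by (auto intro!: exI[of _ "min d e"])
  then show "f \<otimes>\<^bsub>thompson_F\<^esub> g \<in> interior_maps" using fg by (simp add: interior_maps_def)
qed

lemma derived_subset_interior: "derived thompson_F (carrier thompson_F) \<subseteq> interior_maps"
  unfolding derived_def
proof (rule group.generate_subgroup_incl[OF group_thompson_F _ subgroup_interior], safe)
  interpret group thompson_F by (rule group_thompson_F)
  fix f g assume "f \<in> carrier thompson_F" "g \<in> carrier thompson_F"
  then have f: "f \<in> thompson_maps" and g: "g \<in> thompson_maps" by simp_all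
  define h where "h = f \<otimes>\<^bsub>thompson_F\<^esub> g \<otimes>\<^bsub>thompson_F\<^esub> inv\<^bsub>thompson_F\<^esub> f \<otimes>\<^bsub>thompson_F\<^esub> inv\<^bsub>thompson_F\<^esub> g"
  have fg: "f \<in> carrier thompson_F" "g \<in> carrier thompson_F" using f g by simp_all
  have hF: "h \<in> carrier thompson_F" unfolding h_def using fg by (intro m_closed inv_closed)
  have "inv\<^bsub>thompson_F\<^esub> g \<otimes>\<^bsub>thompson_F\<^esub> (g \<otimes>\<^bsub>thompson_F\<^esub> f) = f"
    using fg by (simp add: m_assoc[symmetric] del: thompson_F_simps thompson_F_mult)
  then have "h \<otimes>\<^bsub>thompson_F\<^esub> (g \<otimes>\<^bsub>thompson_F\<^esub> f) = f \<otimes>\<^bsub>thompson_F\<^esub> g"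
    unfolding h_def using fg by (simp add: m_assoc del: thompson_F_simps thompson_F_mult)
  then have "compose {0..1} h (compose {0..1} g f) = compose {0..1} f g"
    using f g hF thompson_compose[OF g f] by simp
  then have "h (g (f x)) = f (g x)" if "0 \<le> x" "x \<le> 1" for x
    using that thompson_mapsD(8)[OF f that] by (auto simp: compose_def fun_eq_iff restrict_def split: if_splits)
  then show "f \<otimes>\<^bsub>thompson_F\<^esub> g \<otimes>\<^bsub>thompson_F\<^esub> inv\<^bsub>thompson_F\<^esub> f \<otimes>\<^bsub>thompson_F\<^esub> inv\<^bsub>thompson_F\<^esub> g \<in> interior_maps"
    using commutator_interior[OF f g, of h] hF by (simp add: h_def)
qed

section \<open>Elements of F on fine dyadic intervals\<close>

text \<open>The end points of the image of a dyadic interval of length $2^{-k}$ are multiples of $2^{r-k}$ up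
to the shift by \<open>c\<close>, and this shift is itself such a multiple as soon as $k$ is large.\<close>

lemma affine_dyadic_fine:
  assumes "c \<in> dyadics"
  shows "\<exists>K. \<forall>f x y. dyadic_interval x y \<and> y - x \<le> 1 / 2 ^ K \<and>
    (\<forall>z\<in>{x..y}. f z = 2 powi r * z + c) \<longrightarrow> dyadic_affine f x y"
proof -
  obtain w :: int and M :: nat where c: "c = w / 2 ^ M" using assms by (auto simp: dyadics_def)
  show ?thesis
  proof (intro exI[of _ "M + nat \<bar>r\<bar>"] allI impI, elim conjE)
    fix f :: "real \<Rightarrow> real" and x y :: real
    assume xy: "dyadic_interval x y" and len: "y - x \<le> 1 / 2 ^ (M + nat \<bar>r\<bar>)"
      and f: "\<forall>z\<in>{x..y}. f z = 2 powi r * z + c"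
    obtain j :: int and k :: nat where jk: "x = j / 2 ^ k" "y = (j + 1) / 2 ^ k"
      using xy by (auto simp: dyadic_interval_def)
    have "y - x = 1 / 2 ^ k" by (simp add: jk add_divide_distrib)
    then have "(1 :: real) / 2 ^ k \<le> 1 / 2 ^ (M + nat \<bar>r\<bar>)" using len by (simp only:)
    then have "(2 :: real) ^ (M + nat \<bar>r\<bar>) \<le> 2 ^ k" by (simp add: field_simps)
    then have kM: "M + nat \<bar>r\<bar> \<le> k" by simp
    define l where "l = nat (int k - r)"
    have l: "int l = int k - r" "M \<le> l" using kM by (simp_all add: l_def)
    have slope: "2 powi r / 2 ^ k = (1 :: real) / 2 ^ l"
    proof -
      have "(2 :: real) powi r = 2 powi (int k - int l)" using l(1) by simp
      also have "\<dots> = 2 ^ k / 2 ^ l" by (simp add: power_int_diff)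
      finally show ?thesis by simp
    qed
    obtain d where d: "l = M + d" using l(2) le_Suc_ex by blast
    have ab: "x < y" using dyadic_interval_less[OF xy] .
    have "f x = j * (2 powi r / 2 ^ k) + c" using f ab by (simp add: jk)
    also have "\<dots> = (j + w * 2 ^ d :: int) / 2 ^ l"
      unfolding slope c d by (simp add: field_simps power_add)
    finally have fx: "f x = (j + w * 2 ^ d :: int) / 2 ^ l" .
    have "f y = (j + 1) * (2 powi r / 2 ^ k) + c" using f ab by (simp add: jk)
    also have "\<dots> = (real_of_int (j + w * 2 ^ d) + 1) / 2 ^ l"
      unfolding slope c d by (simp add: field_simps power_add)
    finally have fy: "f y = (real_of_int (j + w * 2 ^ d) + 1) / 2 ^ l" .
    have "dyadic_interval (f x) (f y)" unfolding dyadic_interval_def using fx fy by blast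
    moreover have "f (x + s * (y - x)) = f x + s * (f y - f x)" if "s \<in> {0..1}" for s
    proof -
      have "f (x + s * (y - x)) = 2 powi r * (x + s * (y - x)) + c"
        using f segment_bounds[of x y s] that ab by simp
      moreover have "f x = 2 powi r * x + c" "f y = 2 powi r * y + c" using f ab by simp_all
      ultimately show ?thesis by (simp add: algebra_simps)
    qed
    ultimately show "dyadic_affine f x y" using xy by (simp add: dyadic_affine_def)
  qed
qed

text \<open>Finitely many cells of a grid, each with its own bound by \<open>affine_dyadic_fine\<close>.\<close>

lemma thompson_dyadic_fine:
  assumes f: "f \<in> thompson_maps"
  shows "\<exists>K. \<forall>x y. dyadic_interval x y \<and> 0 \<le> x \<and> y \<le> 1 \<and> y - x \<le> 1 / 2 ^ K \<longrightarrow>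
    dyadic_affine f x y"
proof -
  obtain n where n: "\<forall>a<2 ^ n. \<exists>(k :: int). \<exists>c\<in>dyadics.
      \<forall>x\<in>{real a / 2 ^ n..(real a + 1) / 2 ^ n}. f x = 2 powi k * x + c"
    using thompson_grid[OF f] by blast
  have "\<exists>K. \<forall>x y. dyadic_interval x y \<and> real a / 2 ^ n \<le> x \<and> y \<le> (real a + 1) / 2 ^ n \<and>
      y - x \<le> 1 / 2 ^ K \<longrightarrow> dyadic_affine f x y" if a: "a < 2 ^ n" for a
  proof -
    obtain k :: int and c where kc: "c \<in> dyadics"
      "\<forall>x\<in>{real a / 2 ^ n..(real a + 1) / 2 ^ n}. f x = 2 powi k * x + c"
      using n a by blast
    obtain K where K: "\<And>f x y. dyadic_interval x y \<Longrightarrow> y - x \<le> 1 / 2 ^ K \<Longrightarrow>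
        (\<forall>z\<in>{x..y}. f z = 2 powi k * z + c) \<Longrightarrow> dyadic_affine f x y"
      using affine_dyadic_fine[OF kc(1), of k] by blast
    show ?thesis
    proof (intro exI[of _ K] allI impI, elim conjE)
      fix x y assume "dyadic_interval x y" "real a / 2 ^ n \<le> x" "y \<le> (real a + 1) / 2 ^ n"
        "y - x \<le> 1 / 2 ^ K"
      then show "dyadic_affine f x y" using kc(2) by (intro K) auto
    qed
  qed
  then obtain K where K: "\<And>a x y. a < 2 ^ n \<Longrightarrow> dyadic_interval x y \<Longrightarrow> real a / 2 ^ n \<le> x \<Longrightarrow>
      y \<le> (real a + 1) / 2 ^ n \<Longrightarrow> y - x \<le> 1 / 2 ^ K a \<Longrightarrow> dyadic_affine f x y"
    by metis
  define L where "L = n + Max (K ` {..<2 ^ n})"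
  show ?thesis
  proof (intro exI[of _ L] allI impI, elim conjE)
    fix x y assume xy: "dyadic_interval x y" "0 \<le> x" "y \<le> 1" "y - x \<le> 1 / 2 ^ L"
    have "x < 1" using dyadic_interval_less[OF xy(1)] xy by simp
    then obtain a where a: "a < 2 ^ n" "real a / 2 ^ n \<le> x" "x < (real a + 1) / 2 ^ n"
      using unit_interval_cell[of x n] xy by auto
    have cell: "dyadic_interval (real a / 2 ^ n) ((real a + 1) / 2 ^ n)"
      unfolding dyadic_interval_def by (intro exI[of _ "int a"] exI[of _ n]) simp
    have "n \<le> L" by (simp add: L_def)
    then have "(1 :: real) / 2 ^ L \<le> 1 / 2 ^ n" by (simp add: field_simps)
    then have "y - x \<le> (real a + 1) / 2 ^ n - real a / 2 ^ n"
      using xy by (simp add: add_divide_distrib)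
    then have y: "y \<le> (real a + 1) / 2 ^ n" using dyadic_interval_nested[OF xy(1) cell] a by blast
    have "K a \<le> Max (K ` {..<2 ^ n})" using a by (intro Max_ge) auto
    then have "K a \<le> L" by (simp add: L_def)
    then have "(1 :: real) / 2 ^ L \<le> 1 / 2 ^ K a" by (simp add: field_simps)
    then show "dyadic_affine f x y" using K[OF a(1) xy(1) a(2) y] xy by linarith
  qed
qed

section \<open>The line as an open unit interval\<close>

lemma powi_double: "j = i + 1 \<Longrightarrow> (2 :: real) powi j = 2 * 2 powi i"
  by (simp add: power_int_add)

text \<open>From each knot to the next, the distance to 0 doubles on the left half of the unit interval, and the
distance to 1 halves on its right half. So the knots cut the open unit interval into dyadic
intervals that accumulate at both ends.\<close>

definition knot :: "int \<Rightarrow> real" where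
  "knot m = (if m \<le> 0 then 2 powi (m - 1) else 1 - 2 powi (- m - 1))"

lemma knot_minus: "knot (- m) = 1 - knot m"
  by (cases "m = 0") (auto simp: knot_def power_int_minus)

lemma knot_diff: "knot (m + 1) - knot m = (if m < 0 then 2 powi (m - 1) else 2 powi (- m - 2))"
proof -
  consider "m < 0" | "m = 0" | "0 < m" by linarith
  then show ?thesis
  proof cases
    case 1
    have "(2 :: real) powi m = 2 * 2 powi (m - 1)" by (rule powi_double) simp
    then show ?thesis using 1 by (simp add: knot_def)
  next
    case 2
    then show ?thesis by (simp add: knot_def power_int_minus)
  next
    case 3
    have "(2 :: real) powi (- m - 1) = 2 * 2 powi (- m - 2)" by (rule powi_double) simp
    then show ?thesis using 3 by (simp add: knot_def algebra_simps)
  qed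
qed

lemma knot_interval: "dyadic_interval (knot m) (knot (m + 1))"
proof (cases "m < 0")
  case True
  define k where "k = nat (1 - m)"
  have "2 powi (m - 1) = (1 :: real) / 2 ^ k"
    using True by (simp add: k_def power_int_def field_simps)
  then have "knot m = 1 / 2 ^ k" "knot (m + 1) - knot m = 1 / 2 ^ k"
    unfolding knot_diff using True by (simp_all add: knot_def)
  then show ?thesis unfolding dyadic_interval_def by (intro exI[of _ 1] exI[of _ k]) simp
next
  case False
  define k where "k = nat (m + 2)"
  have k2: "2 powi (- m - 2) = (1 :: real) / 2 ^ k"
    using False by (simp add: k_def power_int_def field_simps)
  then have diff: "knot (m + 1) - knot m = 1 / 2 ^ k"
    unfolding knot_diff using False by simp
  have "knot (m + 1) = 1 - 2 powi (- m - 2)" using False by (simp add: knot_def algebra_simps)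
  then have "knot (m + 1) = 1 - 1 / 2 ^ k" using k2 by simp
  then have "knot (m + 1) = (real_of_int (2 ^ k - 2) + 1) / 2 ^ k" "knot m = (2 ^ k - 2 :: int) / 2 ^ k"
    using diff by (simp_all add: field_simps)
  then show ?thesis unfolding dyadic_interval_def by blast
qed

lemma knot_diff_pos: "knot m < knot (m + 1)"
  using dyadic_interval_less[OF knot_interval] .

lemma knot_less: "m < n \<Longrightarrow> knot m < knot n"
proof (induction n rule: int_gr_induct)
  case base
  then show ?case by (rule knot_diff_pos)
next
  case (step n)
  then show ?case using knot_diff_pos[of n] by simp
qed

lemma knot_mono: "m \<le> n \<Longrightarrow> knot m \<le> knot n"
  using knot_less[of m n] by (cases "m = n") auto

lemma knot_bounds: "0 < knot m" "knot m < 1"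
proof -
  have pos: "0 < knot m" for m
  proof (cases "m \<le> 0")
    case False
    then have "(2 :: real) powi (- m - 1) < 2 powi 0" by (intro power_int_strict_increasing) auto
    then show ?thesis using False by (simp add: knot_def)
  qed (simp add: knot_def)
  show "0 < knot m" by (rule pos)
  show "knot m < 1" using pos[of "- m"] by (simp add: knot_minus)
qed

text \<open>The homeomorphism of the line with the open unit interval that takes integers to knots and is
affine in between. Maps with bounded support correspond to maps that are the identity near 0 and 1,
and a translation by 1 near plus infinity becomes multiplication of the distance to 1 by a half.\<close>

definition squeeze :: "real \<Rightarrow> real" where
  "squeeze t = knot \<lfloor>t\<rfloor> + (t - \<lfloor>t\<rfloor>) * (knot (\<lfloor>t\<rfloor> + 1) - knot \<lfloor>t\<rfloor>)"

lemma squeeze_of_int [simp]: "squeeze (of_int m) = knot m"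
  by (simp add: squeeze_def)

lemma squeeze_unit:
  assumes "0 \<le> s" "s \<le> 1"
  shows "squeeze (of_int m + s) = knot m + s * (knot (m + 1) - knot m)"
proof (cases "s = 1")
  case True
  then show ?thesis using squeeze_of_int[of "m + 1"] by simp
next
  case False
  then have "\<lfloor>of_int m + s\<rfloor> = m" using assms by (simp add: floor_eq_iff)
  then show ?thesis by (simp add: squeeze_def)
qed

lemma squeeze_less:
  assumes "x < y" shows "squeeze x < squeeze y"
proof -
  have unit: "knot \<lfloor>t\<rfloor> \<le> squeeze t" "squeeze t < knot (\<lfloor>t\<rfloor> + 1)" for t
  proof -
    have "0 \<le> t - \<lfloor>t\<rfloor>" "t - \<lfloor>t\<rfloor> < 1" by linarith+
    then have "0 \<le> (t - \<lfloor>t\<rfloor>) * (knot (\<lfloor>t\<rfloor> + 1) - knot \<lfloor>t\<rfloor>)"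
      "(t - \<lfloor>t\<rfloor>) * (knot (\<lfloor>t\<rfloor> + 1) - knot \<lfloor>t\<rfloor>) < 1 * (knot (\<lfloor>t\<rfloor> + 1) - knot \<lfloor>t\<rfloor>)"
      using knot_diff_pos[of "\<lfloor>t\<rfloor>"] by (intro mult_nonneg_nonneg mult_strict_right_mono; simp)+
    then show "knot \<lfloor>t\<rfloor> \<le> squeeze t" "squeeze t < knot (\<lfloor>t\<rfloor> + 1)" by (auto simp: squeeze_def)
  qed
  show ?thesis
  proof (cases "\<lfloor>x\<rfloor> = \<lfloor>y\<rfloor>")
    case True
    then show ?thesis using assms knot_diff_pos[of "\<lfloor>y\<rfloor>"] by (simp add: squeeze_def)
  next
    case False
    then have "\<lfloor>x\<rfloor> + 1 \<le> \<lfloor>y\<rfloor>" using floor_mono[of x y] assms by linarith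
    then show ?thesis using unit(2)[of x] unit(1)[of y] knot_mono[of "\<lfloor>x\<rfloor> + 1" "\<lfloor>y\<rfloor>"] by linarith
  qed
qed

lemma squeeze_less_iff [simp]: "squeeze x < squeeze y \<longleftrightarrow> x < y"
  using squeeze_less[of x y] squeeze_less[of y x] by (cases x y rule: linorder_cases) auto

lemma squeeze_le_iff [simp]: "squeeze x \<le> squeeze y \<longleftrightarrow> x \<le> y"
  using squeeze_less_iff[of y x] by (simp flip: not_less)

lemma inj_squeeze: "inj squeeze"
  by (rule injI) (metis squeeze_less_iff less_irrefl linorder_less_linear)

lemma squeeze_bounds [simp]: "0 < squeeze t" "squeeze t < 1"
proof -
  have "squeeze (of_int \<lfloor>t\<rfloor>) \<le> squeeze t" "squeeze t \<le> squeeze (of_int (\<lfloor>t\<rfloor> + 1))"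
    unfolding squeeze_le_iff by linarith+
  then show "0 < squeeze t" "squeeze t < 1"
    using knot_bounds(1)[of "\<lfloor>t\<rfloor>"] knot_bounds(2)[of "\<lfloor>t\<rfloor> + 1"] unfolding squeeze_of_int by linarith+
qed

lemma knot_small:
  assumes "0 < e" shows "\<exists>N :: nat. knot (- int N) \<le> e \<and> 1 - e \<le> knot (int N)"
proof -
  obtain N where N: "(1 / 2 :: real) ^ N < e" using real_arch_pow_inv[of e "1 / 2"] assms by auto
  have "- int N - 1 = - int (Suc N)" by simp
  then have "knot (- int N) = 2 powi (- int (Suc N))" unfolding knot_def by (simp only:) simp
  also have "\<dots> = (1 / 2) ^ Suc N" by (simp only: power_int_minus power_int_of_nat) (simp add: power_one_over inverse_eq_divide)
  also have "\<dots> \<le> (1 / 2) ^ N" by simp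
  finally show ?thesis using N knot_minus[of "int N"] by (intro exI[of _ N]) auto
qed

lemma between_knots:
  assumes "0 < x" "x < 1"
  shows "\<exists>m. knot m \<le> x \<and> x < knot (m + 1)"
proof -
  obtain N where N: "knot (- int N) \<le> x" using knot_small[OF assms(1)] by blast
  obtain M where "1 - (1 - x) / 2 \<le> knot (int M)" using knot_small[of "(1 - x) / 2"] assms by auto
  then have M: "x < knot (int M)" using assms by (simp add: field_simps)
  define S where "S = {m. - int N \<le> m \<and> m \<le> int M \<and> knot m \<le> x}"
  have "S \<subseteq> {- int N..int M}" by (auto simp: S_def)
  then have fin: "finite S" by (rule finite_subset) simp
  have "- int N \<in> S" using N by (simp add: S_def)
  then have "Max S \<in> S" using fin by (intro Max_in) auto
  moreover have "x < knot (Max S + 1)"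
  proof (rule ccontr)
    assume "\<not> x < knot (Max S + 1)"
    then have le: "knot (Max S + 1) \<le> x" by simp
    then have "\<not> int M \<le> Max S + 1" using knot_mono[of "int M" "Max S + 1"] M by linarith
    then have "Max S + 1 \<in> S" using le \<open>Max S \<in> S\<close> by (auto simp: S_def)
    then show False using Max_ge[OF fin, of "Max S + 1"] by simp
  qed
  ultimately show ?thesis by (auto simp: S_def)
qed

definition unsqueeze :: "real \<Rightarrow> real" where
  "unsqueeze = the_inv squeeze"

lemma unsqueeze_squeeze [simp]: "unsqueeze (squeeze t) = t"
  unfolding unsqueeze_def by (rule the_inv_f_f[OF inj_squeeze])

lemma squeeze_unsqueeze [simp]:
  assumes "0 < x" "x < 1" shows "squeeze (unsqueeze x) = x"
proof -
  obtain m where m: "knot m \<le> x" "x < knot (m + 1)" using between_knots assms by blast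
  define s where "s = (x - knot m) / (knot (m + 1) - knot m)"
  have "0 \<le> s" "s \<le> 1" using m by (auto simp: s_def field_simps)
  then have "squeeze (of_int m + s) = x" using m by (simp add: squeeze_unit) (simp add: s_def)
  then show ?thesis by (metis unsqueeze_squeeze)
qed

lemma less_unsqueeze: "0 < x \<Longrightarrow> x < 1 \<Longrightarrow> t < unsqueeze x \<longleftrightarrow> squeeze t < x"
  by (metis squeeze_unsqueeze squeeze_less_iff)

lemma unsqueeze_le: "0 < x \<Longrightarrow> x < 1 \<Longrightarrow> unsqueeze x \<le> t \<longleftrightarrow> x \<le> squeeze t"
  by (metis squeeze_unsqueeze squeeze_le_iff)

lemma squeeze_affine_unit: "dyadic_affine squeeze (of_int m) (of_int m + 1)"
  unfolding dyadic_affine_def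
  using squeeze_unit[of 1 m] squeeze_unit[of _ m] dyadic_interval_unit[of m] knot_interval[of m]
  by auto

lemma squeeze_affine:
  assumes "dyadic_interval a b" shows "dyadic_affine squeeze a b"
proof (rule dyadic_affine_subinterval[OF squeeze_affine_unit[of "\<lfloor>a\<rfloor>"] assms])
  show "of_int \<lfloor>a\<rfloor> \<le> a" by simp
  show "b \<le> of_int \<lfloor>a\<rfloor> + 1"
    using dyadic_interval_length[OF assms]
    by (intro dyadic_interval_nested[OF assms dyadic_interval_unit]) (simp_all add: floor_less_cancel)
qed

text \<open>Each unit interval is taken affinely to an interval of length at most 1.\<close>

lemma squeeze_contracts:
  assumes "dyadic_interval a b" shows "squeeze b - squeeze a \<le> b - a"
proof -
  let ?m = "\<lfloor>a\<rfloor>"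
  have a: "?m \<le> a" "a < b" using dyadic_interval_less[OF assms] by auto
  have b: "b \<le> of_int ?m + 1"
    using dyadic_interval_length[OF assms]
    by (intro dyadic_interval_nested[OF assms dyadic_interval_unit]) simp_all
  have "squeeze a = knot ?m + (a - ?m) * (knot (?m + 1) - knot ?m)"
    using squeeze_unit[of "a - ?m" ?m] a b by simp
  moreover have "squeeze b = knot ?m + (b - ?m) * (knot (?m + 1) - knot ?m)"
    using squeeze_unit[of "b - ?m" ?m] a b by simp
  ultimately have "squeeze b - squeeze a = (b - a) * (knot (?m + 1) - knot ?m)"
    by (simp add: algebra_simps)
  also have "\<dots> \<le> (b - a) * 1"
    using a dyadic_interval_length[OF knot_interval[of ?m]] by (intro mult_left_mono) auto
  finally show ?thesis by simp
qed

text \<open>A dyadic interval of length $2^{-k}$ that touches neither 0 nor 1 has distance at least $2^{-k}$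
from both of them. So it cannot be longer than the interval between knots that contains its left end.\<close>

lemma dyadic_interval_between_knots:
  assumes ab: "dyadic_interval a b" and "0 < a" "b < 1"
  shows "\<exists>m. knot m \<le> a \<and> b \<le> knot (m + 1)"
proof -
  have less: "a < b" using dyadic_interval_less[OF ab] .
  obtain m where m: "knot m \<le> a" "a < knot (m + 1)" using between_knots[of a] assms less by auto
  obtain j :: int and k :: nat where jk: "a = j / 2 ^ k" "b = (j + 1) / 2 ^ k"
    using ab by (auto simp: dyadic_interval_def)
  have len: "b - a = 1 / 2 ^ k" by (simp add: jk add_divide_distrib)
  have "b - a \<le> knot (m + 1) - knot m"
  proof (cases "m < 0")
    case True
    have "0 < real_of_int j" using assms(2) by (simp add: jk zero_less_divide_iff)
    then have "0 < j" by simp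
    then have "1 \<le> real_of_int j" by linarith
    then have "1 / 2 ^ k \<le> a" by (simp add: jk divide_right_mono)
    also have "a < 2 powi m" using m True by (simp add: knot_def)
    also have "\<dots> = 1 / 2 ^ nat (- m)" using True by (simp add: power_int_def field_simps)
    finally have "nat (- m) < k" by (simp add: field_simps)
    then have "nat (1 - m) \<le> k" by linarith
    then have "(1 :: real) / 2 ^ k \<le> 1 / 2 ^ nat (1 - m)" by (simp add: field_simps)
    also have "\<dots> = 2 powi (m - 1)" using True by (simp add: power_int_def field_simps)
    finally show ?thesis using True len by (simp add: knot_diff)
  next
    case False
    have "real_of_int (j + 1) < 2 ^ k" using assms(3) by (simp add: jk field_simps)
    then have "real_of_int (j + 1) < real_of_int (2 ^ k)" by simp
    then have "j + 2 \<le> 2 ^ k" unfolding of_int_less_iff by simp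
    then have "real_of_int (j + 2) \<le> real_of_int (2 ^ k)" by (simp only: of_int_le_iff)
    then have "2 * (1 / 2 ^ k) \<le> 1 - a" by (simp add: jk field_simps)
    also have "1 - a \<le> 1 - knot m" using m by simp
    also have "\<dots> = 2 powi (- m - 1)" using False by (cases "m = 0") (simp_all add: knot_def power_int_minus)
    also have "\<dots> = 2 * 2 powi (- m - 2)" by (rule powi_double) simp
    finally show ?thesis using False len by (simp add: knot_diff)
  qed
  then have "b \<le> knot (m + 1)" using dyadic_interval_nested[OF ab knot_interval] m by blast
  then show ?thesis using m by blast
qed

lemma unsqueeze_affine:
  assumes ab: "dyadic_interval a b" and "0 < a" "b < 1"
  shows "dyadic_affine unsqueeze a b"
proof -
  obtain m where m: "knot m \<le> a" "b \<le> knot (m + 1)"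
    using dyadic_interval_between_knots[OF assms] by blast
  have "dyadic_affine unsqueeze (squeeze (of_int m)) (squeeze (of_int m + 1))"
    by (rule dyadic_affine_inverse[OF squeeze_affine_unit]) simp
  then have "dyadic_affine unsqueeze (knot m) (knot (m + 1))"
    using squeeze_of_int[of "m + 1"] by simp
  then show ?thesis by (rule dyadic_affine_subinterval[OF _ ab m])
qed

text \<open>Conjugation by \<open>squeeze\<close>, extended to the end points of the unit interval by fixing them.\<close>

definition transport :: "(real \<Rightarrow> real) \<Rightarrow> real \<Rightarrow> real" where
  "transport g = (\<lambda>x\<in>{0..1}. if 0 < x \<and> x < 1 then squeeze (g (unsqueeze x)) else x)"

lemma transport_in [simp]: "0 < x \<Longrightarrow> x < 1 \<Longrightarrow> transport g x = squeeze (g (unsqueeze x))"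
  and transport_ends [simp]: "transport g 0 = 0" "transport g 1 = 1"
  and transport_extensional: "transport g \<in> extensional {0..1}"
  by (auto simp: transport_def)

lemma transport_id: "transport (\<lambda>t. t) = (\<lambda>x\<in>{0..1}. x)"
  by (auto simp: transport_def fun_eq_iff restrict_def)

lemma transport_word_Nil: "transport (word_map []) = (\<lambda>x\<in>{0..1}. x)"
  by (simp only: word_map_Nil id_def transport_id)

lemma transport_comp: "compose {0..1} (transport g) (transport h) = transport (g \<circ> h)"
proof
  fix x show "compose {0..1} (transport g) (transport h) x = transport (g \<circ> h) x"
  proof (cases "0 < x \<and> x < 1")
    case True
    then show ?thesis by (simp add: compose_def)
  next
    case False
    then show ?thesis
      by (cases "x = 0 \<or> x = 1") (auto simp: compose_def transport_def)
  qed
qed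

lemma transport_word_Cons: "transport (word_map (c # w)) =
    compose {0..1} (transport (letter_map c)) (transport (word_map w))"
  by (simp only: word_map_Cons transport_comp)

lemma transport_inj:
  assumes "transport g = transport h" shows "g = h"
proof
  fix t
  have "squeeze (g t) = squeeze (h t)" using fun_cong[OF assms, of "squeeze t"] by simp
  then show "g t = h t" by (metis unsqueeze_squeeze)
qed

text \<open>On $[m,m+1]$ the caret is affine too, but the image has length 2 and is not a dyadic interval.\<close>

lemma caret_affine:
  assumes ab: "dyadic_interval a b" and "a \<noteq> of_int m \<or> b \<noteq> of_int m + 1"
  shows "dyadic_affine (caret m) a b"
proof -
  have half: "dyadic_affine (caret m) (of_int n / 2) ((of_int n + 1) / 2)" for n
  proof -
    have n: "dyadic_interval (of_int n / 2) ((of_int n + 1) / 2)"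
      unfolding dyadic_interval_def by (intro exI[of _ n] exI[of _ 1]) simp
    consider "n + 1 \<le> 2 * m" | "n = 2 * m" | "n = 2 * m + 1" | "2 * m + 2 \<le> n" by linarith
    then show ?thesis
    proof cases
      case 1
      then have "real_of_int (n + 1) \<le> real_of_int (2 * m)" unfolding of_int_le_iff .
      then have "(real_of_int n + 1) / 2 \<le> m" by simp
      then show ?thesis by (intro dyadic_affine_id[OF n]) (auto intro!: caret_fixed)
    next
      case 2
      then have ends: "of_int n / 2 = real_of_int m" "(of_int n + 1) / 2 = real_of_int m + 1 / 2"
        by (simp_all add: field_simps)
      show ?thesis using n dyadic_interval_unit[of m]
        unfolding ends dyadic_affine_def by (auto simp: caret_def)
    next
      case 3
      then have ends: "of_int n / 2 = real_of_int m + 1 / 2" "(of_int n + 1) / 2 = real_of_int m + 1"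
        by (simp_all add: field_simps)
      have "dyadic_interval (of_int m + 1) (of_int m + 2)"
        using dyadic_interval_unit[of "m + 1"] by (simp add: add.assoc)
      then show ?thesis using n
        unfolding ends dyadic_affine_def by (auto simp: caret_def)
    next
      case 4
      then have "real_of_int (2 * m + 2) \<le> real_of_int n" unfolding of_int_le_iff .
      then have *: "real_of_int m + 1 \<le> of_int n / 2" by simp
      then have shift: "caret m t = t + 1" if "of_int n / 2 \<le> t" for t
        using that by (auto simp: caret_def)
      have "caret m (of_int n / 2 + s * ((of_int n + 1) / 2 - of_int n / 2)) =
          of_int n / 2 + 1 + s * ((of_int n + 1) / 2 + 1 - (of_int n / 2 + 1))" if "s \<in> {0..1}" for s
        using that by (subst shift) (auto simp: field_simps)
      then show ?thesis
        using n dyadic_interval_shift[OF n, of 1] shift[of "of_int n / 2"] shift[of "(of_int n + 1) / 2"]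
        by (simp add: dyadic_affine_def)
    qed
  qed
  obtain j :: int and k :: nat where jk: "a = j / 2 ^ k" "b = (j + 1) / 2 ^ k"
    using ab by (auto simp: dyadic_interval_def)
  show ?thesis
  proof (cases k)
    case 0
    consider "j < m" | "j > m" using assms(2) jk 0 by fastforce
    then show ?thesis
    proof cases
      case 1
      then have "b \<le> m" using jk 0 by simp
      then show ?thesis by (intro dyadic_affine_id[OF ab]) (auto intro!: caret_fixed)
    next
      case 2
      then have "of_int m + 1 \<le> a" using jk 0 by simp
      then have shift: "caret m t = t + 1" if "a \<le> t" for t
        using that by (auto simp: caret_def)
      have less: "a < b" using dyadic_interval_less[OF ab] .
      have "caret m (a + s * (b - a)) = a + 1 + s * (b + 1 - (a + 1))" if "s \<in> {0..1}" for s
        using that less by (subst shift) auto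
      then show ?thesis
        using ab dyadic_interval_shift[OF ab, of 1] shift[of a] shift[of b] less
        by (simp add: dyadic_affine_def)
    qed
  next
    case (Suc k')
    have len: "b - a = 1 / 2 ^ k" by (simp add: jk add_divide_distrib)
    have "b - a \<le> 1 / 2" unfolding len Suc by (simp add: field_simps)
    obtain q where q: "of_int q \<le> 2 * a" "2 * a < of_int q + 1" by (rule floor_exists[THEN exE]) auto
    then have q': "of_int q / 2 \<le> a" "a < (of_int q + 1) / 2" by simp_all
    have "dyadic_interval (of_int q / 2) ((of_int q + 1) / 2)"
      using half by (simp add: dyadic_affine_def)
    then have "b \<le> (of_int q + 1) / 2"
      using \<open>b - a \<le> 1 / 2\<close> q'(2) by (intro dyadic_interval_nested[OF ab]) (auto simp: add_divide_distrib)
    with q'(1) show ?thesis by (intro dyadic_affine_subinterval[OF half ab])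
  qed
qed

lemma squeeze_shift:
  assumes "0 \<le> t" shows "squeeze (t + 1) = (squeeze t + 1) / 2"
proof -
  have knot: "knot (m + 1) = (knot m + 1) / 2" if "0 \<le> m" for m
  proof -
    have "(2 :: real) powi (- m - 1) = 2 * 2 powi (- m - 2)" by (rule powi_double) simp
    then show ?thesis using knot_diff[of m] that
      by (cases "m = 0") (simp_all add: knot_def power_int_minus algebra_simps)
  qed
  have m: "0 \<le> \<lfloor>t\<rfloor>" using assms by simp
  have "knot (\<lfloor>t\<rfloor> + 1 + 1) = (knot (\<lfloor>t\<rfloor> + 1) + 1) / 2" by (rule knot) (use m in simp)
  then show ?thesis using knot[OF m] by (simp add: squeeze_def field_simps)
qed

text \<open>In the middle of the unit interval the three maps \<open>unsqueeze\<close>, \<open>caret m\<close> and \<open>squeeze\<close> are affine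
on dyadic intervals; near 0 the composite is the identity, and near 1 it is $x \mapsto (x+1)/2$.\<close>

lemma transport_caret: "transport (caret m) \<in> thompson_maps"
proof -
  \<comment> \<open>A mesh fine enough for the first cell to lie below \<open>knot m\<close>, the last one above
    \<open>knot (m + 1)\<close>, and no cell to be the whole interval between these knots.\<close>
  define n where "n = nat (\<bar>m\<bar> + 4)"
  have small: "1 / 2 ^ n < (2 :: real) powi i" if "- \<bar>m\<bar> - 3 \<le> i" for i
  proof -
    have "(1 :: real) / 2 ^ n = 2 powi (- int n)" by (simp add: power_int_minus divide_inverse)
    also have "\<dots> < 2 powi i" using that by (intro power_int_strict_increasing) (auto simp: n_def)
    finally show ?thesis .
  qed
  have "- \<bar>m\<bar> - 3 \<le> - 1" by linarith
  from small[OF this] have half: "1 / 2 ^ n < (1 / 2 :: real)" by (simp add: power_int_minus)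
  have knot0: "knot 0 = 1 / 2" by (simp add: knot_def power_int_minus)
  have knot_lower: "1 / 2 ^ n < knot m"
  proof (cases "m \<le> 0")
    case True then show ?thesis using small[of "m - 1"] by (simp add: knot_def)
  next
    case False
    then have "knot 0 \<le> knot m" by (intro knot_mono) simp
    then show ?thesis using half knot0 by linarith
  qed
  have knot_upper: "knot (m + 1) < 1 - 1 / 2 ^ n" "knot 0 < 1 - 1 / 2 ^ n"
  proof -
    show 0: "knot 0 < 1 - 1 / 2 ^ n" using half knot0 by linarith
    show "knot (m + 1) < 1 - 1 / 2 ^ n"
    proof (cases "m + 1 \<le> 0")
      case True then show ?thesis using knot_mono[of "m + 1" 0] 0 by simp
    next
      case False then show ?thesis using small[of "- (m + 1) - 1"] by (simp add: knot_def)
    qed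
  qed
  have knot_len: "1 / 2 ^ n < knot (m + 1) - knot m"
    unfolding knot_diff using small[of "m - 1"] small[of "- m - 2"] by simp
  show ?thesis
  proof (rule thompson_mapsI_grid[where n = n])
    fix i :: nat assume i: "i < 2 ^ n"
    let ?a = "real i / 2 ^ n" and ?b = "(real i + 1) / 2 ^ n"
    have ab: "dyadic_interval ?a ?b"
      unfolding dyadic_interval_def by (intro exI[of _ "int i"] exI[of _ n]) simp
    consider "i = 0" | "i = 2 ^ n - 1" | "0 < i" "i + 1 < 2 ^ n" using i by linarith
    then show "\<exists>(k :: int) c. \<forall>x\<in>{?a..?b}. transport (caret m) x = 2 powi k * x + c"
    proof cases
      case 1
      have "transport (caret m) x = x" if "x \<in> {?a..?b}" for x
      proof (cases "x = 0")
        case False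
        then have x: "0 < x" "x < knot m" using that 1 knot_lower by auto
        then have "x < 1" using knot_bounds(2)[of m] by simp
        then have "unsqueeze x \<le> of_int m" using x by (simp add: unsqueeze_le)
        then show ?thesis using x \<open>x < 1\<close> by (simp add: caret_fixed)
      qed simp
      then show ?thesis by (intro exI[of _ 0] exI[of _ 0]) simp
    next
      case 2
      have "transport (caret m) x = 2 powi (- 1) * x + 1 / 2" if "x \<in> {?a..?b}" for x
      proof (cases "x = 1")
        case True then show ?thesis by (simp add: power_int_minus)
      next
        case False
        have ab1: "?a = 1 - 1 / 2 ^ n" "?b = 1" using 2 by (simp_all add: of_nat_diff diff_divide_distrib)
        then have x: "x < 1" "knot (m + 1) < x" "knot 0 < x" using that knot_upper False by auto
        then have "0 < x" using knot_bounds(1)[of 0] by simp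
        have "of_int (m + 1) < unsqueeze x" "of_int 0 < unsqueeze x"
          unfolding less_unsqueeze[OF \<open>0 < x\<close> x(1)] squeeze_of_int by (fact x)+
        then have "squeeze (caret m (unsqueeze x)) = (squeeze (unsqueeze x) + 1) / 2"
          by (simp add: caret_def squeeze_shift)
        then show ?thesis using x \<open>0 < x\<close> by (simp add: power_int_minus field_simps)
      qed
      then show ?thesis by blast
    next
      case 3
      have "real (i + 1) < real (2 ^ n)" using 3 by (subst of_nat_less_iff)
      then have pos: "0 < ?a" "?b < 1" using 3 by (simp_all add: field_simps)
      have U: "dyadic_affine unsqueeze ?a ?b" using ab pos by (rule unsqueeze_affine)
      have less: "?a < ?b" using dyadic_interval_less[OF ab] .
      have "unsqueeze ?a \<noteq> of_int m \<or> unsqueeze ?b \<noteq> of_int m + 1"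
      proof (rule ccontr)
        assume "\<not> ?thesis"
        then have "squeeze (unsqueeze ?a) = squeeze (of_int m)"
          "squeeze (unsqueeze ?b) = squeeze (of_int (m + 1))" by simp_all
        moreover have "squeeze (unsqueeze ?a) = ?a" "squeeze (unsqueeze ?b) = ?b"
          using pos less by (intro squeeze_unsqueeze; linarith)+
        ultimately have "?a = knot m" "?b = knot (m + 1)" by (simp_all only: squeeze_of_int)
        then have "knot (m + 1) - knot m = 1 / 2 ^ n" by (simp add: add_divide_distrib flip: diff_divide_distrib)
        then show False using knot_len by simp
      qed
      then have C: "dyadic_affine (caret m) (unsqueeze ?a) (unsqueeze ?b)"
        using U by (intro caret_affine) (simp_all add: dyadic_affine_def)
      then have "dyadic_affine squeeze (caret m (unsqueeze ?a)) (caret m (unsqueeze ?b))"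
        by (intro squeeze_affine) (simp add: dyadic_affine_def)
      then have "dyadic_affine (squeeze \<circ> (caret m \<circ> unsqueeze)) ?a ?b"
        using U C by (intro dyadic_affine_compose) simp_all
      then obtain k :: int and c where "\<forall>x\<in>{?a..?b}. (squeeze \<circ> (caret m \<circ> unsqueeze)) x = 2 powi k * x + c"
        using dyadic_affine_slope by blast
      moreover have "transport (caret m) x = (squeeze \<circ> (caret m \<circ> unsqueeze)) x" if "x \<in> {?a..?b}" for x
      proof -
        have "0 < x" "x < 1" using that pos unfolding atLeastAtMost_iff by linarith+
        then show ?thesis by simp
      qed
      ultimately show ?thesis by auto
    qed
  qed (simp_all add: transport_extensional)
qed

section \<open>The commutator subgroup as a group of caret words\<close>

text \<open>Read on the line, \<open>f\<close> has bounded support. On fine dyadic intervals it is a composite of three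
affine maps between dyadic intervals, so \<open>dyadic_homeomorphism_word\<close> applies.\<close>

lemma interior_map_word:
  assumes f: "f \<in> interior_maps"
  shows "\<exists>w. word_sum w = 0 \<and> transport (word_map w) = f"
proof -
  have fF: "f \<in> thompson_maps" using f by (simp add: interior_maps_iff)
  note F = thompson_mapsD[OF fF]
  obtain e where e: "e > 0" "\<And>x. 0 \<le> x \<Longrightarrow> x \<le> e \<Longrightarrow> f x = x"
    "\<And>x. 1 - e \<le> x \<Longrightarrow> x \<le> 1 \<Longrightarrow> f x = x"
    using f unfolding interior_maps_iff by blast
  have f_in: "0 < f x" "f x < 1" if "0 < x" "x < 1" for x
    using strict_mono_onD[OF F(2), of 0 x] strict_mono_onD[OF F(2), of x 1] F(5,6) that by auto
  define g where "g = (\<lambda>t. unsqueeze (f (squeeze t)))"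
  have g: "transport g = f"
  proof
    fix x show "transport g x = f x"
    proof (cases "0 < x \<and> x < 1")
      case True
      then show ?thesis using f_in[of x] by (simp add: g_def)
    next
      case False
      then show ?thesis using F(1,5,6) by (cases "x = 0 \<or> x = 1") (auto simp: transport_def extensional_def)
    qed
  qed
  obtain N :: nat where N: "knot (- int N) \<le> e" "1 - e \<le> knot (int N)" using knot_small[OF e(1)] by blast
  obtain K where K: "\<And>x y. dyadic_interval x y \<Longrightarrow> 0 \<le> x \<Longrightarrow> y \<le> 1 \<Longrightarrow> y - x \<le> 1 / 2 ^ K \<Longrightarrow>
      dyadic_affine f x y"
    using thompson_dyadic_fine[OF fF] by blast
  have outside: "g t = t" if t: "t \<le> - real N \<or> real N \<le> t" for t
  proof -
    have "squeeze t \<le> squeeze (of_int (- int N)) \<or> squeeze (of_int (int N)) \<le> squeeze t"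
      unfolding squeeze_le_iff using t by simp
    then have "squeeze t \<le> e \<or> 1 - e \<le> squeeze t" unfolding squeeze_of_int using N by linarith
    then have "f (squeeze t) = squeeze t"
      using e(2)[of "squeeze t"] e(3)[of "squeeze t"] squeeze_bounds[of t] by linarith
    then show ?thesis by (simp add: g_def)
  qed
  have "dyadic_affine g (of_int m / 2 ^ K) ((of_int m + 1) / 2 ^ K)" for m :: int
  proof -
    let ?a = "real_of_int m / 2 ^ K" and ?b = "(real_of_int m + 1) / 2 ^ K"
    have ab: "dyadic_interval ?a ?b" unfolding dyadic_interval_def by blast
    have S: "dyadic_affine squeeze ?a ?b" by (rule squeeze_affine[OF ab])
    have "squeeze ?b - squeeze ?a \<le> 1 / 2 ^ K"
      using squeeze_contracts[OF ab] by (simp add: add_divide_distrib)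
    then have M: "dyadic_affine f (squeeze ?a) (squeeze ?b)"
      using S by (intro K) (simp_all add: dyadic_affine_def less_imp_le)
    then have "dyadic_affine unsqueeze (f (squeeze ?a)) (f (squeeze ?b))"
      using f_in by (intro unsqueeze_affine) (simp_all add: dyadic_affine_def)
    then have "dyadic_affine (unsqueeze \<circ> (f \<circ> squeeze)) ?a ?b"
      using S M by (intro dyadic_affine_compose) simp_all
    then show ?thesis by (simp add: g_def comp_def)
  qed
  then obtain w where "word_sum w = 0" "word_map w = g"
    using dyadic_homeomorphism_word[OF outside, of N K] by blast
  then show ?thesis using g by blast
qed

lemma transport_uncaret: "transport (uncaret m) = inv\<^bsub>thompson_F\<^esub> transport (caret m)" (is "_ = ?c")
  "transport (uncaret m) \<in> thompson_maps"
proof -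
  interpret group thompson_F by (rule group_thompson_F)
  have inv: "?c \<in> thompson_maps"
    using inv_closed[of "transport (caret m)"] transport_caret[of m] by simp
  have one: "compose {0..1} (transport (caret m)) ?c = (\<lambda>x\<in>{0..1}. x)"
    using r_inv[of "transport (caret m)"] transport_caret[of m] inv by simp
  have undo: "transport (uncaret m) (transport (caret m) y) = y" if "y \<in> {0..1}" for y
    using that by (cases "y = 0 \<or> y = 1") auto
  have "transport (uncaret m) x = ?c x" for x
  proof (cases "x \<in> {0..1}")
    case True
    have "transport (caret m) (?c x) = x"
      using fun_cong[OF one, of x] True by (simp add: compose_def)
    then show ?thesis
      using undo[of "?c x"] thompson_mapsD(8)[OF inv, of x] True
      by simp
  next
    case False
    then show ?thesis
      using thompson_mapsD(1)[OF inv] transport_extensional[of "uncaret m"]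
      by (simp add: extensional_def)
  qed
  then show eq: "transport (uncaret m) = ?c" ..
  show "transport (uncaret m) \<in> thompson_maps" using inv eq by simp
qed

lemma transport_word_map: "transport (word_map w) \<in> thompson_maps"
proof (induction w)
  case Nil
  show ?case unfolding transport_word_Nil by (rule thompson_id)
next
  case (Cons c w)
  have "transport (letter_map c) \<in> thompson_maps"
    using transport_caret transport_uncaret(2) by (cases c) simp
  then show ?case unfolding transport_word_Cons by (rule thompson_compose[OF _ Cons.IH])
qed

text \<open>In the abelianization all carets have the same image, since \<open>caret_commute\<close> makes \<open>caret n\<close> and
\<open>caret (n + 1)\<close> conjugate. So the image of a word depends only on its exponent sum.\<close>

lemma transport_word_derived:
  assumes "word_sum w = 0"
  shows "transport (word_map w) \<in> derived thompson_F (carrier thompson_F)"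
proof -
  interpret F: group thompson_F by (rule group_thompson_F)
  let ?D = "derived thompson_F (carrier thompson_F)"
  interpret D: normal ?D thompson_F by (rule F.derived_self_is_normal)
  let ?A = "thompson_F Mod ?D"
  interpret A: comm_group ?A by (rule F.derived_quot_is_comm_group)
  define \<phi> where "\<phi> f = ?D #>\<^bsub>thompson_F\<^esub> f" for f
  interpret \<phi>: group_hom thompson_F ?A \<phi>
    using D.r_coset_hom_Mod unfolding \<phi>_def[abs_def] by unfold_locales
  have carr: "transport (caret m) \<in> carrier thompson_F" for m using transport_caret by simp
  have step: "\<phi> (transport (caret (n + 1))) = \<phi> (transport (caret n))" for n
  proof -
    have "caret (n - 1) \<circ> caret n = caret (n + 1) \<circ> caret (n - 1)"
      using caret_commute[of "n - 1" n] by (simp add: fun_eq_iff)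
    then have "transport (caret (n - 1)) \<otimes>\<^bsub>thompson_F\<^esub> transport (caret n) =
        transport (caret (n + 1)) \<otimes>\<^bsub>thompson_F\<^esub> transport (caret (n - 1))"
      using transport_caret by (simp add: transport_comp)
    then have "\<phi> (transport (caret (n - 1))) \<otimes>\<^bsub>?A\<^esub> \<phi> (transport (caret n)) =
        \<phi> (transport (caret (n + 1))) \<otimes>\<^bsub>?A\<^esub> \<phi> (transport (caret (n - 1)))"
      unfolding \<phi>.hom_mult[OF carr carr, symmetric] by (rule arg_cong)
    also have "\<dots> = \<phi> (transport (caret (n - 1))) \<otimes>\<^bsub>?A\<^esub> \<phi> (transport (caret (n + 1)))"
      by (intro A.m_comm \<phi>.hom_closed carr)
    finally show ?thesis
      using \<phi>.hom_closed[OF carr] A.Units_eq by (metis A.Units_l_cancel)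
  qed
  have const: "\<phi> (transport (caret m)) = \<phi> (transport (caret 0))" for m
  proof (induction m rule: int_induct[of _ 0])
    case base show ?case ..
  next
    case (step1 i) then show ?case using step[of i] by simp
  next
    case (step2 i) then show ?case using step[of "i - 1"] by simp
  qed
  define c where "c = \<phi> (transport (caret 0))"
  have c: "c \<in> carrier ?A" unfolding c_def using \<phi>.hom_closed[OF carr] .
  have pow: "c [^]\<^bsub>?A\<^esub> (1 :: int) = c" "c [^]\<^bsub>?A\<^esub> (- 1 :: int) = inv\<^bsub>?A\<^esub> c"
    using A.int_pow_1[OF c] A.int_pow_neg[OF c, of 1] by simp_all
  have "\<phi> (transport (word_map w)) = c [^]\<^bsub>?A\<^esub> (- word_sum w)" for w
  proof (induction w)
    case Nil
    have "\<phi> (\<lambda>x\<in>{0..1}. x) = \<one>\<^bsub>?A\<^esub>" using \<phi>.hom_one unfolding thompson_F_simps .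
    then show ?case unfolding transport_word_Nil by (simp del: restrict_apply)
  next
    case (Cons l w)
    obtain b m where l: "l = (b, m)" by fastforce
    have tl: "transport (letter_map l) \<in> carrier thompson_F"
      using l transport_caret transport_uncaret(2) by (cases b) simp_all
    have "\<phi> (transport (letter_map l)) = c [^]\<^bsub>?A\<^esub> (- letter_sum l)"
      using l const[of m] c pow \<phi>.hom_inv[OF carr[of m]] transport_uncaret(1)[of m]
      by (cases b) (simp_all add: c_def)
    moreover have "transport (word_map (l # w)) =
        transport (letter_map l) \<otimes>\<^bsub>thompson_F\<^esub> transport (word_map w)"
      using tl transport_word_map unfolding transport_word_Cons by simp
    ultimately have "\<phi> (transport (word_map (l # w))) =
        c [^]\<^bsub>?A\<^esub> (- letter_sum l) \<otimes>\<^bsub>?A\<^esub> c [^]\<^bsub>?A\<^esub> (- word_sum w)"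
      using \<phi>.hom_mult[OF tl] transport_word_map Cons.IH by (simp del: word_map_Cons)
    then show ?case using A.int_pow_mult[OF c, of "- letter_sum l" "- word_sum w"]
      by (simp del: word_map_Cons)
  qed
  then have "\<phi> (transport (word_map w)) = \<one>\<^bsub>?A\<^esub>" using assms by simp
  then have "?D #>\<^bsub>thompson_F\<^esub> transport (word_map w) = ?D" by (simp add: \<phi>_def FactGroup_def)
  moreover have "transport (word_map w) \<in> carrier thompson_F" using transport_word_map by simp
  ultimately show ?thesis using F.rcos_self[OF _ D.subgroup_axioms] by metis
qed

theorem derived_eq_words:
  "derived thompson_F (carrier thompson_F) = {transport (word_map w) | w. word_sum w = 0}"
proof
  show "derived thompson_F (carrier thompson_F) \<subseteq> {transport (word_map w) | w. word_sum w = 0}"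
    using derived_subset_interior interior_map_word by blast
qed (use transport_word_derived in blast)

section \<open>Homotopy of edge paths\<close>

text \<open>The loops whose homotopy is to be studied are based at \<open>b\<close>; paths between other vertices enter as
parts of such loops.\<close>

locale based_complex =
  fixes K :: "('v, 'e) two_complex" and b :: 'v
  assumes src_verts: "e \<in> edges K \<Longrightarrow> src K e \<in> verts K"
    and einv_edges: "e \<in> edges K \<Longrightarrow> einv K e \<in> edges K"
    and src_einv: "e \<in> edges K \<Longrightarrow> src K (einv K e) = tgt K e"
    and einv_einv: "e \<in> edges K \<Longrightarrow> einv K (einv K e) = e"
    and cells_closed: "c \<in> cells K \<Longrightarrow> is_path K u c w \<Longrightarrow> u = w"
begin

lemma tgt_einv: "e \<in> edges K \<Longrightarrow> tgt K (einv K e) = src K e"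
  using src_einv[OF einv_edges] einv_einv by metis

lemma tgt_verts: "e \<in> edges K \<Longrightarrow> tgt K e \<in> verts K"
  using src_verts[OF einv_edges] src_einv by metis

lemma is_path_verts: "is_path K u f w \<Longrightarrow> u \<in> verts K \<and> w \<in> verts K"
  by (induction f arbitrary: u) (auto simp: src_verts)

lemma is_path_append: "is_path K u (f @ g) w \<longleftrightarrow> (\<exists>v. is_path K u f v \<and> is_path K v g w)"
  by (induction f arbitrary: u) (auto dest: is_path_verts)

lemma is_path_appendI: "is_path K u f v \<Longrightarrow> is_path K v g w \<Longrightarrow> is_path K u (f @ g) w"
  by (auto simp: is_path_append)

lemma path_inv_simps [simp]: "path_inv K [] = []" "path_inv K (e # f) = path_inv K f @ [einv K e]"
  "path_inv K (f @ g) = path_inv K g @ path_inv K f"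
  by (simp_all add: path_inv_def)

lemma is_path_inv: "is_path K u f w \<Longrightarrow> is_path K w (path_inv K f) u"
proof (induction f arbitrary: u)
  case (Cons e f)
  then have e: "e \<in> edges K" "src K e = u" and "is_path K (tgt K e) f w" by simp_all
  then have "is_path K w (path_inv K f) (tgt K e)" by (intro Cons.IH)
  moreover have "is_path K (tgt K e) [einv K e] u"
    using e by (auto simp: einv_edges src_einv tgt_einv src_verts)
  ultimately show ?case unfolding path_inv_simps by (rule is_path_appendI)
qed simp

lemma path_inv_inv: "is_path K u f w \<Longrightarrow> path_inv K (path_inv K f) = f"
  by (induction f arbitrary: u) (auto simp: einv_einv)

text \<open>Two parallel paths are homotopic when one may be exchanged for the other inside every loop at \<open>b\<close>.
With this definition all of the homotopies below take place in \<open>homotopic_loops\<close>, and the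
relation is a congruence for concatenation.\<close>

definition homotopic :: "'v \<Rightarrow> 'v \<Rightarrow> 'e list \<Rightarrow> 'e list \<Rightarrow> bool" where
  "homotopic u w f g \<longleftrightarrow> is_path K u f w \<and> is_path K u g w \<and>
     (\<forall>p q. is_path K b p u \<longrightarrow> is_path K w q b \<longrightarrow> homotopic_loops K b (p @ f @ q) (p @ g @ q))"

lemma homotopic_paths: "homotopic u w f g \<Longrightarrow> is_path K u f w \<and> is_path K u g w"
  by (simp add: homotopic_def)

lemma homotopic_refl: "is_path K u f w \<Longrightarrow> homotopic u w f f"
  unfolding homotopic_def
proof (intro conjI allI impI homotopic_loops.refl)
  fix p q assume "is_path K u f w" "is_path K b p u" "is_path K w q b"
  then have "is_path K b (p @ f @ q) b" by (intro is_path_appendI)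
  then show "p @ f @ q \<in> loops K b" by (simp add: loops_def)
qed

lemma homotopic_sym: "homotopic u w f g \<Longrightarrow> homotopic u w g f"
  unfolding homotopic_def by (blast intro: homotopic_loops.sym)

lemma homotopic_trans [trans]: "homotopic u w f g \<Longrightarrow> homotopic u w g h \<Longrightarrow> homotopic u w f h"
  unfolding homotopic_def by (blast intro: homotopic_loops.trans)

lemma homotopic_append:
  assumes "homotopic u v f f'" "homotopic v w g g'"
  shows "homotopic u w (f @ g) (f' @ g')"
proof -
  have paths: "is_path K u f v" "is_path K u f' v" "is_path K v g w" "is_path K v g' w"
    using assms by (simp_all add: homotopic_def)
  have "homotopic_loops K b (p @ (f @ g) @ q) (p @ (f' @ g') @ q)"
    if p: "is_path K b p u" and q: "is_path K w q b" for p q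
  proof -
    have "homotopic_loops K b (p @ f @ (g @ q)) (p @ f' @ (g @ q))"
      using assms(1) p is_path_appendI[OF paths(3) q] by (simp add: homotopic_def)
    moreover have "homotopic_loops K b (p @ f' @ (g @ q)) (p @ f' @ (g' @ q))"
    proof -
      have "homotopic_loops K b ((p @ f') @ g @ q) ((p @ f') @ g' @ q)"
        using assms(2) q is_path_appendI[OF p paths(2)] unfolding homotopic_def by blast
      then show ?thesis by (simp only: append_assoc)
    qed
    ultimately have "homotopic_loops K b (p @ f @ (g @ q)) (p @ f' @ (g' @ q))"
      by (rule homotopic_loops.trans)
    then show ?thesis by (simp only: append_assoc)
  qed
  then show ?thesis using paths is_path_appendI unfolding homotopic_def by metis
qed

lemma homotopic_Cons:
  assumes "e \<in> edges K" "src K e = u" "homotopic (tgt K e) w f g"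
  shows "homotopic u w (e # f) (e # g)"
proof -
  have "is_path K u [e] (tgt K e)" using assms by (simp add: tgt_verts)
  from homotopic_append[OF homotopic_refl[OF this] assms(3)] show ?thesis by simp
qed

lemma homotopic_cancel:
  assumes "e \<in> edges K" "src K e = u" shows "homotopic u u [e, einv K e] []"
proof -
  have e: "is_path K u [e, einv K e] u"
    using assms by (auto simp: einv_edges src_einv tgt_einv src_verts)
  have "homotopic_loops K b (p @ [e, einv K e] @ q) (p @ q)"
    if "is_path K b p u" "is_path K u q b" for p q
    using is_path_appendI[OF that(1) is_path_appendI[OF e that(2)]]
    by (intro homotopic_loops.cancel) (simp add: loops_def)
  then show ?thesis using e assms src_verts by (auto simp: homotopic_def)
qed

lemma homotopic_inv_cancel: "is_path K u f w \<Longrightarrow> homotopic u u (f @ path_inv K f) []"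
proof (induction f arbitrary: u)
  case Nil
  then show ?case using homotopic_refl[OF Nil] by simp
next
  case (Cons e f)
  then have e: "e \<in> edges K" "src K e = u" and f: "is_path K (tgt K e) f w" by simp_all
  have "is_path K (tgt K e) [einv K e] u"
    using e by (auto simp: einv_edges src_einv tgt_einv src_verts)
  then have "homotopic (tgt K e) u ((f @ path_inv K f) @ [einv K e]) ([] @ [einv K e])"
    by (rule homotopic_append[OF Cons.IH[OF f] homotopic_refl])
  then have "homotopic u u (e # (f @ path_inv K f) @ [einv K e]) (e # [] @ [einv K e])"
    using e by (intro homotopic_Cons)
  also have "homotopic u u \<dots> []" using homotopic_cancel e by simp
  finally show ?case by simp
qed

lemma homotopic_inv_cancel': "is_path K u f w \<Longrightarrow> homotopic w w (path_inv K f @ f) []"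
  using homotopic_inv_cancel[OF is_path_inv] path_inv_inv by metis

lemma homotopic_path_inv:
  assumes "homotopic u w f g" shows "homotopic w u (path_inv K f) (path_inv K g)"
proof -
  have f: "is_path K u f w" and g: "is_path K u g w" using assms homotopic_paths by auto
  note refl = homotopic_refl[OF is_path_inv]
  have "homotopic w u (path_inv K f @ []) (path_inv K f @ g @ path_inv K g)"
    by (rule homotopic_append[OF refl[OF f] homotopic_sym[OF homotopic_inv_cancel[OF g]]])
  also have "homotopic w u \<dots> (path_inv K f @ f @ path_inv K g)"
    by (rule homotopic_append[OF refl[OF f] homotopic_append[OF homotopic_sym[OF assms] refl[OF g]]])
  also have "homotopic w u \<dots> ([] @ path_inv K g)"
    using homotopic_append[OF homotopic_inv_cancel'[OF f] refl[OF g]] by simp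
  finally show ?thesis by simp
qed

text \<open>A 2-cell whose boundary is \<open>f\<close> followed by the inverse of \<open>g\<close> lets \<open>f\<close> be pushed across to \<open>g\<close>.\<close>

lemma homotopic_cell_square:
  assumes "f @ path_inv K g \<in> cells K" "is_path K u f w" "is_path K u g w"
  shows "homotopic u w f g"
proof -
  have c: "is_path K u (f @ path_inv K g) u" using assms is_path_inv is_path_appendI by blast
  have "homotopic_loops K b (p @ (f @ path_inv K g) @ q) (p @ q)"
    if "is_path K b p u" "is_path K u q b" for p q
    using is_path_appendI[OF that(1) is_path_appendI[OF c that(2)]] assms(1)
    by (intro homotopic_loops.cell) (simp_all add: loops_def)
  then have 1: "homotopic u u (f @ path_inv K g) []"
    using c is_path_verts[OF assms(2)] by (simp add: homotopic_def)
  have "homotopic u w (f @ []) (f @ path_inv K g @ g)"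
    by (rule homotopic_append[OF homotopic_refl[OF assms(2)] homotopic_sym[OF homotopic_inv_cancel'[OF assms(3)]]])
  also have "homotopic u w \<dots> ([] @ g)"
    using homotopic_append[OF 1 homotopic_refl[OF assms(3)]] by simp
  finally show ?thesis by simp
qed

lemma homotopic_imp_loops:
  assumes "homotopic b b f g" shows "homotopic_loops K b f g"
proof -
  have "is_path K b [] b" using assms is_path_verts by (auto simp: homotopic_def)
  then show ?thesis using assms unfolding homotopic_def by (metis append_Nil append_Nil2)
qed

lemma homotopic_loops_closed: "homotopic_loops K b f g \<Longrightarrow> f \<in> loops K b \<and> g \<in> loops K b"
proof (induction rule: homotopic_loops.induct)
  case (cancel f e g)
  then obtain u v where "is_path K b f u" "is_path K u [e, einv K e] v" "is_path K v g b"
    by (auto simp: loops_def is_path_append simp del: is_path.simps append_Cons append_Nil)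
  moreover from this have "u = v" by (auto simp: tgt_einv)
  ultimately show ?case using cancel by (auto simp: loops_def intro: is_path_appendI)
next
  case (cell c f g)
  then obtain u v where "is_path K b f u" "is_path K u c v" "is_path K v g b"
    by (auto simp: loops_def is_path_append)
  moreover from this have "u = v" using cells_closed cell by blast
  ultimately show ?case using cell by (auto simp: loops_def intro: is_path_appendI)
qed auto

lemma equiv_loop_rel: "equiv (loops K b) (loop_rel K b)"
  using homotopic_loops_closed
  by (intro equivI refl_onI symI transI)
    (auto simp: loop_rel_def intro: homotopic_loops.refl homotopic_loops.sym homotopic_loops.trans)

lemma loops_append: "f \<in> loops K b \<Longrightarrow> g \<in> loops K b \<Longrightarrow> f @ g \<in> loops K b"
  by (auto simp: loops_def intro: is_path_appendI)

lemma homotopic_loops_append: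
  assumes "homotopic_loops K b f f'" "homotopic_loops K b g g'"
  shows "homotopic_loops K b (f @ g) (f' @ g')"
proof -
  have left: "homotopic_loops K b (f @ g) (f' @ g)"
    if "homotopic_loops K b f f'" "g \<in> loops K b" for f f' g
    using that
  proof (induction rule: homotopic_loops.induct)
    case (cancel f e h)
    then show ?case
      using loops_append[OF cancel(1,2)] homotopic_loops.cancel[of f e K "h @ g" b] by simp
  next
    case (cell c f h)
    then show ?case
      using loops_append[OF cell(2,3)] homotopic_loops.cell[of c K f "h @ g" b] by simp
  qed (auto intro: homotopic_loops.refl homotopic_loops.sym homotopic_loops.trans loops_append)
  have right: "homotopic_loops K b (f @ g) (f @ g')"
    if "homotopic_loops K b g g'" "f \<in> loops K b" for f g g'
    using that
  proof (induction rule: homotopic_loops.induct)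
    case (cancel g e h)
    then show ?case
      using loops_append[OF cancel(2,1)] homotopic_loops.cancel[of "f @ g" e K h b] by simp
  next
    case (cell c g h)
    then show ?case
      using loops_append[OF cell(3,2)] homotopic_loops.cell[of c K "f @ g" h b] by simp
  qed (auto intro: homotopic_loops.refl homotopic_loops.sym homotopic_loops.trans loops_append)
  show ?thesis
    using left[OF assms(1)] right[OF assms(2)] homotopic_loops_closed[OF assms(1)]
      homotopic_loops_closed[OF assms(2)] by (blast intro: homotopic_loops.trans)
qed

lemma pi1_mult:
  assumes "f \<in> loops K b" "g \<in> loops K b"
  shows "loop_rel K b `` {f} \<otimes>\<^bsub>pi1 K b\<^esub> loop_rel K b `` {g} = loop_rel K b `` {f @ g}"
proof -
  have "loop_rel K b `` {f' @ g'} = loop_rel K b `` {f @ g}"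
    if "f' \<in> loop_rel K b `` {f}" "g' \<in> loop_rel K b `` {g}" for f' g'
    using that
    by (intro equiv_class_eq[OF equiv_loop_rel])
      (auto simp: loop_rel_def intro: homotopic_loops_append homotopic_loops.sym)
  moreover have "f \<in> loop_rel K b `` {f}" "g \<in> loop_rel K b `` {g}"
    using assms by (auto simp: loop_rel_def intro: homotopic_loops.refl)
  ultimately have "(\<Union>f'\<in>loop_rel K b `` {f}. \<Union>g'\<in>loop_rel K b `` {g}. loop_rel K b `` {f' @ g'}) =
      loop_rel K b `` {f @ g}"
    by blast
  then show ?thesis by (simp add: pi1_def)
qed

end

section \<open>The Squier complex of the presentation\<close>

lemma squier_simps [simp]:
  "verts (squier_complex P) = lists (alphabet P) - {[]}"
  "(p, u, v, q) \<in> edges (squier_complex P) \<longleftrightarrow> p \<in> lists (alphabet P) \<and> q \<in> lists (alphabet P) \<and>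
     ((u, v) \<in> rels P \<or> (v, u) \<in> rels P)"
  "src (squier_complex P) (p, u, v, q) = p @ u @ q"
  "tgt (squier_complex P) (p, u, v, q) = p @ v @ q"
  "einv (squier_complex P) (p, u, v, q) = (p, v, u, q)"
  by (simp_all add: squier_complex_def squier_graph_def)

lemma squier_cells:
  "c \<in> cells (squier_complex P) \<longleftrightarrow> (\<exists>p z q l1 r1 l2 r2.
     c = [(p, l1, r1, z @ l2 @ q), (p @ r1 @ z, l2, r2, q), (p, r1, l1, z @ r2 @ q), (p @ l1 @ z, r2, l2, q)] \<and>
     p \<in> lists (alphabet P) \<and> z \<in> lists (alphabet P) \<and> q \<in> lists (alphabet P) \<and>
     (l1, r1) \<in> rels P \<and> (l2, r2) \<in> rels P)"
  by (auto simp: squier_complex_def squier_graph_def path_inv_def)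

lemma based_complex_squier:
  assumes "semigroup_presentation P" shows "based_complex (squier_complex P)"
proof
  fix e assume e: "e \<in> edges (squier_complex P)"
  obtain p u v q where [simp]: "e = (p, u, v, q)" by (cases e)
  show "src (squier_complex P) e \<in> verts (squier_complex P)"
    using e assms by (auto simp: semigroup_presentation_def)
  show "einv (squier_complex P) e \<in> edges (squier_complex P)"
    "src (squier_complex P) (einv (squier_complex P) e) = tgt (squier_complex P) e"
    "einv (squier_complex P) (einv (squier_complex P) e) = e"
    using e by auto
next
  fix c u w assume "c \<in> cells (squier_complex P)" "is_path (squier_complex P) u c w"
  then show "u = w" by (auto simp: squier_cells)
qed

abbreviation "KQ \<equiv> squier_complex Q_pres"

interpretation Q: based_complex KQ "[La 0, Lb 0]"
  by (intro based_complex_squier semigroup_presentation_Q_pres)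

lemma alphabet_Q [simp]: "alphabet Q_pres = UNIV"
  by (simp add: Q_pres_def)

lemma rels_Q: "(u, v) \<in> rels Q_pres \<longleftrightarrow> u = [Lx] \<and> v = [Lx, Lx] \<or>
    (\<exists>i. u = [La i] \<and> v = [La (Suc i), Lx]) \<or> (\<exists>i. u = [Lb i] \<and> v = [Lx, Lb (Suc i)])"
  by (auto simp: Q_pres_def)

text \<open>Applications of relations to disjoint parts of a word may be performed in either order.\<close>

lemma square_Q:
  assumes "(l1, r1) \<in> rels Q_pres" "(l2, r2) \<in> rels Q_pres"
  shows "Q.homotopic (p @ l1 @ z @ l2 @ q) (p @ r1 @ z @ r2 @ q)
    [(p, l1, r1, z @ l2 @ q), (p @ r1 @ z, l2, r2, q)]
    [(p @ l1 @ z, l2, r2, q), (p, l1, r1, z @ r2 @ q)]"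
proof (rule Q.homotopic_cell_square)
  show "[(p, l1, r1, z @ l2 @ q), (p @ r1 @ z, l2, r2, q)] @
      path_inv KQ [(p @ l1 @ z, l2, r2, q), (p, l1, r1, z @ r2 @ q)] \<in> cells KQ"
    using assms by (auto simp: squier_cells)
  have "r1 \<noteq> []" using assms by (auto simp: rels_Q)
  then show "is_path KQ (p @ l1 @ z @ l2 @ q) [(p, l1, r1, z @ l2 @ q), (p @ r1 @ z, l2, r2, q)] (p @ r1 @ z @ r2 @ q)"
    "is_path KQ (p @ l1 @ z @ l2 @ q) [(p @ l1 @ z, l2, r2, q), (p, l1, r1, z @ r2 @ q)] (p @ r1 @ z @ r2 @ q)"
    using assms by auto
qed

abbreviation xpow :: "nat \<Rightarrow> letter list" where "xpow n \<equiv> replicate n Lx"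

text \<open>Only vertices of this form occur on paths that start at $a_0b_0$, and only edges of the three
following kinds and their inverses (see \<open>edge_normal\<close>).\<close>

definition node :: "nat \<Rightarrow> nat \<Rightarrow> nat \<Rightarrow> letter list" where
  "node i n j = La i # xpow n @ [Lb j]"

lemma node_inject: "node i n j = node i' n' j' \<longleftrightarrow> i = i' \<and> n = n' \<and> j = j'"
  by (auto simp: node_def dest: arg_cong[where f = length])

lemma node_vert: "node i n j \<in> verts KQ"
  by (simp add: node_def)

definition a_edge where "a_edge i n j = ([], [La i], [La (Suc i), Lx], xpow n @ [Lb j])"
definition b_edge where "b_edge i n j = (La i # xpow n, [Lb j], [Lx, Lb (Suc j)], [])"
definition x_edge where "x_edge i k m j = (La i # xpow k, [Lx], [Lx, Lx], xpow m @ [Lb j])"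

lemma xpow_append: "xpow m @ xpow n = xpow (m + n)" "xpow m @ Lx # ys = xpow (Suc m) @ ys"
  by (simp_all add: replicate_add replicate_app_Cons_same)

lemma edges_Q [simp]: "a_edge i n j \<in> edges KQ" "b_edge i n j \<in> edges KQ" "x_edge i k m j \<in> edges KQ"
  by (auto simp: a_edge_def b_edge_def x_edge_def rels_Q)

lemma ends_Q [simp]:
  "src KQ (a_edge i n j) = node i n j" "tgt KQ (a_edge i n j) = node (Suc i) (Suc n) j"
  "src KQ (b_edge i n j) = node i n j" "tgt KQ (b_edge i n j) = node i (Suc n) (Suc j)"
  "src KQ (x_edge i k m j) = node i (Suc (k + m)) j"
  "tgt KQ (x_edge i k m j) = node i (Suc (Suc (k + m))) j"
  by (simp_all add: a_edge_def b_edge_def x_edge_def node_def replicate_app_Cons_same replicate_add)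

lemma node_nonempty [simp]: "node i n j \<noteq> []"
  by (simp add: node_def)

lemma square_ab: "Q.homotopic (node i n j) (node (Suc i) (Suc (Suc n)) (Suc j))
    [a_edge i n j, b_edge (Suc i) (Suc n) j] [b_edge i n j, a_edge i (Suc n) (Suc j)]"
  using square_Q[of "[La i]" "[La (Suc i), Lx]" "[Lb j]" "[Lx, Lb (Suc j)]" "[]" "xpow n" "[]"]
  by (simp add: rels_Q a_edge_def b_edge_def node_def replicate_app_Cons_same)

lemma square_ax: "Q.homotopic (node i (Suc (k + m)) j) (node (Suc i) (Suc (Suc (Suc (k + m)))) j)
    [a_edge i (Suc (k + m)) j, x_edge (Suc i) (Suc k) m j]
    [x_edge i k m j, a_edge i (Suc (Suc (k + m))) j]"
  using square_Q[of "[La i]" "[La (Suc i), Lx]" "[Lx]" "[Lx, Lx]" "[]" "xpow k" "xpow m @ [Lb j]"]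
  by (simp add: rels_Q a_edge_def x_edge_def node_def replicate_app_Cons_same replicate_add)

lemma square_xb: "Q.homotopic (node i (Suc (k + m)) j) (node i (Suc (Suc (Suc (k + m)))) (Suc j))
    [x_edge i k m j, b_edge i (Suc (Suc (k + m))) j]
    [b_edge i (Suc (k + m)) j, x_edge i k (Suc m) (Suc j)]"
  using square_Q[of "[Lx]" "[Lx, Lx]" "[Lb j]" "[Lx, Lb (Suc j)]" "La i # xpow k" "xpow m" "[]"]
  by (simp add: rels_Q b_edge_def x_edge_def node_def replicate_app_Cons_same replicate_add)

lemma square_xx: "Q.homotopic (node i (Suc (Suc (k + d + m))) j) (node i (Suc (Suc (Suc (Suc (k + d + m))))) j)
    [x_edge i k (Suc (d + m)) j, x_edge i (Suc (Suc (k + d))) m j]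
    [x_edge i (Suc (k + d)) m j, x_edge i k (Suc (Suc (d + m))) j]"
  using square_Q[of "[Lx]" "[Lx, Lx]" "[Lx]" "[Lx, Lx]" "La i # xpow k" "xpow d" "xpow m @ [Lb j]"]
  by (simp add: rels_Q x_edge_def node_def replicate_app_Cons_same replicate_add)

section \<open>Enlarging words on both sides\<close>

text \<open>The path that splits off \<open>p\<close> letters $x$ on the left and then \<open>q\<close> letters $x$ on the right.\<close>

fun grow :: "nat \<Rightarrow> nat \<Rightarrow> nat \<Rightarrow> nat \<Rightarrow> nat \<Rightarrow> letter sq_edge list" where
  "grow 0 0 i n j = []"
| "grow 0 (Suc q) i n j = b_edge i n j # grow 0 q i (Suc n) (Suc j)"
| "grow (Suc p) q i n j = a_edge i n j # grow p q (Suc i) (Suc n) j"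

lemma grow_path: "is_path KQ (node i n j) (grow p q i n j) (node (i + p) (n + p + q) (j + q))"
  by (induction p q i n j rule: grow.induct) simp_all

lemma grow_b: "Q.homotopic (node i n j) (node (i + p) (n + p + Suc q) (j + Suc q))
    (grow p (Suc q) i n j) (b_edge i n j # grow p q i (Suc n) (Suc j))"
proof (induction p arbitrary: i n)
  case 0
  then show ?case using Q.homotopic_refl[OF grow_path[of i n j 0 "Suc q"]] by simp
next
  case (Suc p)
  let ?g = "grow p q (Suc i) (Suc (Suc n)) (Suc j)" and ?w = "node (i + Suc p) (n + Suc p + Suc q) (j + Suc q)"
  have "Q.homotopic (node i n j) ?w
      (a_edge i n j # grow p (Suc q) (Suc i) (Suc n) j) (a_edge i n j # b_edge (Suc i) (Suc n) j # ?g)"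
    using Suc.IH[of "Suc i" "Suc n"] by (intro Q.homotopic_Cons) simp_all
  also have "Q.homotopic (node i n j) ?w \<dots> (b_edge i n j # a_edge i (Suc n) (Suc j) # ?g)"
    using Q.homotopic_append[OF square_ab[of i n j] Q.homotopic_refl[OF grow_path[of "Suc i" "Suc (Suc n)" "Suc j" p q]]]
    by simp
  finally show ?case by simp
qed

text \<open>Growing takes place at the ends of the word and the splitting in its interior, so they commute; each
step is one of the squares \<open>square_ax\<close> and \<open>square_xb\<close>.\<close>

lemma grow_x: "Q.homotopic (node i (Suc (k + m)) j)
    (node (i + p) (Suc (Suc (k + m + p + q))) (j + q))
    (x_edge i k m j # grow p q i (Suc (Suc (k + m))) j)
    (grow p q i (Suc (k + m)) j @ [x_edge (i + p) (k + p) (m + q) (j + q)])"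
proof (induction p arbitrary: i k)
  case 0
  show ?case
  proof (induction q arbitrary: m j)
    case 0
    show ?case by (simp add: Q.homotopic_refl)
  next
    case (Suc q)
    let ?g = "grow 0 q i (Suc (Suc (Suc (k + m)))) (Suc j)" and ?w = "node i (Suc (Suc (k + m + Suc q))) (j + Suc q)"
    have "Q.homotopic (node i (Suc (k + m)) j) ?w
        (x_edge i k m j # b_edge i (Suc (Suc (k + m))) j # ?g)
        (b_edge i (Suc (k + m)) j # x_edge i k (Suc m) (Suc j) # ?g)"
      using Q.homotopic_append[OF square_xb[of i k m j] Q.homotopic_refl[OF grow_path[of i "Suc (Suc (Suc (k + m)))" "Suc j" 0 q]]]
      by simp
    also have "Q.homotopic (node i (Suc (k + m)) j) ?w \<dots>
        (b_edge i (Suc (k + m)) j # grow 0 q i (Suc (Suc (k + m))) (Suc j) @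
          [x_edge i k (Suc m + q) (Suc j + q)])"
      using Suc.IH[of "Suc m" "Suc j"] by (intro Q.homotopic_Cons) simp_all
    finally show ?case by simp
  qed
next
  case (Suc p)
  let ?g = "grow p q (Suc i) (Suc (Suc (Suc (k + m)))) j" and ?w = "node (i + Suc p) (Suc (Suc (k + m + Suc p + q))) (j + q)"
  have "Q.homotopic (node i (Suc (k + m)) j) ?w
      (x_edge i k m j # a_edge i (Suc (Suc (k + m))) j # ?g)
      (a_edge i (Suc (k + m)) j # x_edge (Suc i) (Suc k) m j # ?g)"
    using Q.homotopic_append[OF Q.homotopic_sym[OF square_ax[of i k m j]]
        Q.homotopic_refl[OF grow_path[of "Suc i" "Suc (Suc (Suc (k + m)))" j p q]]]
    by simp
  also have "Q.homotopic (node i (Suc (k + m)) j) ?w \<dots>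
      (a_edge i (Suc (k + m)) j # grow p q (Suc i) (Suc (Suc (k + m))) j @
        [x_edge (Suc i + p) (Suc k + p) (m + q) (j + q)])"
    using Suc.IH[of "Suc i" "Suc k"] by (intro Q.homotopic_Cons) simp_all
  finally show ?case by simp
qed

section \<open>Caret words as paths between large words\<close>

text \<open>The words $a_N x^n b_N$ that have room for everything in $[-N,N]$. Here \<open>s = n - 2N\<close> is the
displacement of the right half line; it increases by one with each splitting.\<close>

definition hub :: "nat \<Rightarrow> int \<Rightarrow> letter list" where
  "hub N s = node N (nat (2 * int N + s)) N"

text \<open>The splitting of $[m,m+1]$ is applied to the letter $x$ that is preceded by $N+m$ others. For this to
be an edge at \<open>hub N s\<close>, the number \<open>N\<close> has to be large in comparison with \<open>m\<close> and \<open>s\<close>; statements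
about these paths are therefore made for all sufficiently large \<open>N\<close>.\<close>

definition letter_edge :: "nat \<Rightarrow> int \<Rightarrow> bool \<times> int \<Rightarrow> letter sq_edge" where
  "letter_edge N s = (\<lambda>(b, m).
     if b then x_edge N (nat (int N + m)) (nat (int N + s - m - 1)) N
     else einv KQ (x_edge N (nat (int N + m)) (nat (int N + s - m - 2)) N))"

fun word_path :: "nat \<Rightarrow> int \<Rightarrow> caret_word \<Rightarrow> letter sq_edge list" where
  "word_path N s [] = []"
| "word_path N s (c # w) = letter_edge N s c # word_path N (s + letter_sum c) w"

lemma word_path_append: "word_path N s (v @ w) = word_path N s v @ word_path N (s + word_sum v) w"
  by (induction v arbitrary: s) (simp_all add: add.assoc)

lemma hub_nonempty [simp]: "hub N s \<noteq> []"
  by (simp add: hub_def)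

lemma letter_edge_path:
  assumes "\<bar>m\<bar> + \<bar>s\<bar> + 2 \<le> int N"
  shows "is_path KQ (hub N s) [letter_edge N s (b, m)] (hub N (s + letter_sum (b, m)))"
proof -
  have "Suc (nat (int N + m) + nat (int N + s - m - 1)) = nat (2 * int N + s)"
    "Suc (Suc (nat (int N + m) + nat (int N + s - m - 1))) = nat (2 * int N + (s + 1))"
    "Suc (nat (int N + m) + nat (int N + s - m - 2)) = nat (2 * int N + (s - 1))"
    "Suc (Suc (nat (int N + m) + nat (int N + s - m - 2))) = nat (2 * int N + s)"
    using assms by linarith+
  then show ?thesis
    by (auto simp: letter_edge_def hub_def Q.einv_edges Q.src_einv Q.tgt_einv simp del: squier_simps)
      (auto simp: Q.src_verts)
qed

lemma word_path_is_path:
  "\<forall>\<^sub>F N in sequentially. is_path KQ (hub N s) (word_path N s w) (hub N (s + word_sum w))"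
proof (induction w arbitrary: s)
  case (Cons c w)
  obtain b m where c: "c = (b, m)" by fastforce
  have "\<forall>\<^sub>F N in sequentially. nat (\<bar>m\<bar> + \<bar>s\<bar> + 2) \<le> N" by (rule eventually_ge_at_top)
  with Cons.IH[of "s + letter_sum c"] show ?case
  proof eventually_elim
    case (elim N)
    then have "is_path KQ (hub N s) [letter_edge N s c] (hub N (s + letter_sum c))"
      unfolding c by (intro letter_edge_path) linarith
    from Q.is_path_appendI[OF this elim(1)] show ?case by (simp add: add.assoc)
  qed
qed simp

text \<open>The defining relation is the boundary of a 2-cell. As a derivation of \<open>v \<doteq> w\<close> is finite, there is
enough room for all of its steps when \<open>N\<close> is large.\<close>

lemma word_path_respects:
  "v \<doteq> w \<Longrightarrow> word_sum v = word_sum w \<and>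
    (\<forall>s. \<forall>\<^sub>F N in sequentially.
      Q.homotopic (hub N s) (hub N (s + word_sum v)) (word_path N s v) (word_path N s w))"
proof (induction rule: word_eq.induct)
  case (refl w)
  show ?case
    by (intro conjI HOL.refl allI eventually_mono[OF word_path_is_path] Q.homotopic_refl)
next
  case (sym v w)
  have "\<forall>\<^sub>F N in sequentially. Q.homotopic (hub N s) (hub N (s + word_sum w))
      (word_path N s w) (word_path N s v)" for s
  proof -
    have "\<forall>\<^sub>F N in sequentially. Q.homotopic (hub N s) (hub N (s + word_sum v))
        (word_path N s v) (word_path N s w)"
      using sym.IH by blast
    then show ?thesis by eventually_elim (simp add: sym.IH Q.homotopic_sym)
  qed
  then show ?case using sym.IH by simp
next
  case (trans u v w)
  have "\<forall>\<^sub>F N in sequentially. Q.homotopic (hub N s) (hub N (s + word_sum u))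
      (word_path N s u) (word_path N s w)" for s
  proof -
    have "\<forall>\<^sub>F N in sequentially. Q.homotopic (hub N s) (hub N (s + word_sum u))
        (word_path N s u) (word_path N s v)"
      "\<forall>\<^sub>F N in sequentially. Q.homotopic (hub N s) (hub N (s + word_sum v))
        (word_path N s v) (word_path N s w)"
      using trans.IH by blast+
    then show ?thesis by eventually_elim (use trans.IH in \<open>auto intro: Q.homotopic_trans\<close>)
  qed
  then show ?case using trans.IH by simp
next
  case (append v v' w w')
  have "\<forall>\<^sub>F N in sequentially. Q.homotopic (hub N s) (hub N (s + word_sum (v @ w)))
      (word_path N s (v @ w)) (word_path N s (v' @ w'))" for s
  proof -
    have "\<forall>\<^sub>F N in sequentially. Q.homotopic (hub N s) (hub N (s + word_sum v))
        (word_path N s v) (word_path N s v')"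
      "\<forall>\<^sub>F N in sequentially. Q.homotopic (hub N (s + word_sum v)) (hub N (s + word_sum v + word_sum w))
        (word_path N (s + word_sum v) w) (word_path N (s + word_sum v) w')"
      using append.IH by blast+
    then show ?thesis
    proof eventually_elim
      case (elim N)
      from Q.homotopic_append[OF this] show ?case
        using append.IH by (simp add: word_path_append add.assoc)
    qed
  qed
  then show ?case using append.IH by simp
next
  case (cancel c)
  obtain b m where c: "c = (b, m)" by fastforce
  have "\<forall>\<^sub>F N in sequentially. Q.homotopic (hub N s) (hub N (s + word_sum [c, flip c]))
      (word_path N s [c, flip c]) (word_path N s [])" for s
  proof -
    have "\<forall>\<^sub>F N in sequentially. nat (\<bar>m\<bar> + \<bar>s\<bar> + 2) \<le> N" by (rule eventually_ge_at_top)
    then show ?thesis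
    proof eventually_elim
      case (elim N)
      then have "is_path KQ (hub N s) [letter_edge N s c] (hub N (s + letter_sum c))"
        unfolding c by (intro letter_edge_path) linarith
      then have e: "letter_edge N s c \<in> edges KQ" "src KQ (letter_edge N s c) = hub N s"
        by simp_all
      have wp: "word_path N s [c, flip c] = [letter_edge N s c, einv KQ (letter_edge N s c)]"
        by (cases b) (auto simp: c letter_edge_def Q.einv_einv algebra_simps simp del: squier_simps)
      show ?case unfolding wp using Q.homotopic_cancel[OF e] by simp
    qed
  qed
  then show ?case by (simp del: word_path.simps)
next
  case (swap m n)
  have "\<forall>\<^sub>F N in sequentially. Q.homotopic (hub N s) (hub N (s + 2))
      (word_path N s [(True, n), (True, m)]) (word_path N s [(True, m), (True, n + 1)])" for s
  proof -
    have "\<forall>\<^sub>F N in sequentially. nat (\<bar>m\<bar> + \<bar>n\<bar> + \<bar>s\<bar> + 3) \<le> N" by (rule eventually_ge_at_top)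
    then show ?thesis
    proof eventually_elim
      case (elim N)
      define k d r where "k = nat (int N + m)" and "d = nat (n - m - 1)" and "r = nat (int N + s - n - 1)"
      have kdr: "int k = int N + m" "int d = n - m - 1" "int r = int N + s - n - 1"
        using elim swap by (simp_all add: k_def d_def r_def)
      have nat_eq: "nat a = c" if "a = int c" for a c using that by simp
      have "nat (int N + n) = Suc (k + d)" "nat (int N + s - n - 1) = r"
        "nat (int N + m) = k"
        "nat (int N + (s + 1) - m - 1) = Suc (Suc (d + r))" "nat (int N + s - m - 1) = Suc (d + r)"
        "nat (int N + (n + 1)) = Suc (Suc (k + d))" "nat (int N + (s + 1) - (n + 1) - 1) = r"
        "nat (2 * int N + s) = Suc (Suc (k + d + r))"
        "nat (2 * int N + (s + 2)) = Suc (Suc (Suc (Suc (k + d + r))))"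
        by (rule nat_eq; use kdr in simp)+
      note eqs = this
      have "word_path N s [(True, n), (True, m)] =
          [x_edge N (Suc (k + d)) r N, x_edge N k (Suc (Suc (d + r))) N]"
        "word_path N s [(True, m), (True, n + 1)] =
          [x_edge N k (Suc (d + r)) N, x_edge N (Suc (Suc (k + d))) r N]"
        by (simp_all only: word_path.simps letter_edge_def prod.case if_True letter_sum.simps eqs)
      moreover have "hub N s = node N (Suc (Suc (k + d + r))) N"
        "hub N (s + 2) = node N (Suc (Suc (Suc (Suc (k + d + r))))) N"
        by (simp_all only: hub_def eqs)
      ultimately show ?case using Q.homotopic_sym[OF square_xx[of N k d r N]] by simp
    qed
  qed
  then show ?case by (simp del: word_path.simps)
qed

section \<open>The caret word of a path\<close>

text \<open>The weights are chosen such that the relations for $a$ and $b$ preserve the weight of a word. So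
the weight of the part of a word to the left of some letter $x$ is the position on the line of the
unit interval that this letter stands for.\<close>

fun letter_weight :: "letter \<Rightarrow> int" where
  "letter_weight Lx = 1"
| "letter_weight (La i) = - int i"
| "letter_weight (Lb j) = - int j"

definition weight :: "letter list \<Rightarrow> int" where
  "weight u = sum_list (map letter_weight u)"

lemma weight_simps [simp]: "weight [] = 0" "weight (c # u) = letter_weight c + weight u"
  "weight (u @ v) = weight u + weight v" "weight (xpow n) = int n"
  by (simp_all add: weight_def sum_list_replicate)

lemma weight_node: "weight (node i n j) = int n - int i - int j"
  by (simp add: node_def)

text \<open>Edges for the relations of \<open>a\<close> and \<open>b\<close> contribute nothing, because they only change the way in
which the line is cut into pieces.\<close>

definition edge_word :: "letter sq_edge \<Rightarrow> caret_word" where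
  "edge_word = (\<lambda>(p, u, v, q). if (u, v) = ([Lx], [Lx, Lx]) then [(True, weight p)]
     else if (u, v) = ([Lx, Lx], [Lx]) then [(False, weight p)] else [])"

definition path_word :: "letter sq_edge list \<Rightarrow> caret_word" where
  "path_word f = concat (map edge_word f)"

lemma path_word_simps [simp]: "path_word [] = []" "path_word (e # f) = edge_word e @ path_word f"
  "path_word (f @ g) = path_word f @ path_word g"
  by (simp_all add: path_word_def)

lemma edge_word_simps [simp]: "edge_word (a_edge i n j) = []" "edge_word (b_edge i n j) = []"
  "edge_word (x_edge i k m j) = [(True, int k - int i)]"
  by (simp_all add: edge_word_def a_edge_def b_edge_def x_edge_def)

lemma edge_word_einv: "edge_word (einv KQ e) = word_inv (edge_word e)"
  by (cases e) (auto simp: edge_word_def)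

lemma path_word_inv: "path_word (path_inv KQ f) = word_inv (path_word f)"
  by (induction f) (simp_all add: edge_word_einv)

lemma path_word_grow [simp]: "path_word (grow p q i n j) = []"
  by (induction p q i n j rule: grow.induct) simp_all

lemma word_sum_edge: "e \<in> edges KQ \<Longrightarrow> word_sum (edge_word e) = weight (tgt KQ e) - weight (src KQ e)"
  by (cases e) (auto simp: edge_word_def rels_Q)

lemma word_sum_path: "is_path KQ u f w \<Longrightarrow> word_sum (path_word f) = weight w - weight u"
  by (induction f arbitrary: u) (auto simp: word_sum_edge simp del: squier_simps)

lemma path_word_word_path: "\<forall>\<^sub>F N in sequentially. path_word (word_path N s w) = w"
proof (induction w arbitrary: s)
  case (Cons c w)
  obtain b m where c: "c = (b, m)" by fastforce
  have "\<forall>\<^sub>F N in sequentially. nat \<bar>m\<bar> \<le> N" by (rule eventually_ge_at_top)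
  with Cons.IH[of "s + letter_sum c"] show ?case
  proof eventually_elim
    case (elim N)
    then have "int (nat (int N + m)) - int N = m" by linarith
    then show ?case using elim(1)
      by (cases b) (simp_all add: c letter_edge_def edge_word_einv del: squier_simps)
  qed
qed simp

section \<open>Normal forms of paths\<close>

definition spine :: "nat \<Rightarrow> nat \<Rightarrow> nat \<Rightarrow> nat \<Rightarrow> letter sq_edge list" where
  "spine N i n j = grow (N - i) (N - j) i n j"

text \<open>Grow, perform the letters of a word in the interior, and shrink again. The triples are the indices
of the two nodes at the ends.\<close>

definition normal_path :: "nat \<Rightarrow> nat \<times> nat \<times> nat \<Rightarrow> caret_word \<Rightarrow> nat \<times> nat \<times> nat \<Rightarrow> letter sq_edge list" where
  "normal_path N = (\<lambda>(i, n, j) w (i', n', j').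
     spine N i n j @ word_path N (weight (node i n j)) w @ path_inv KQ (spine N i' n' j'))"

lemma spine_path:
  assumes "i \<le> N" "j \<le> N"
  shows "is_path KQ (node i n j) (spine N i n j) (hub N (weight (node i n j)))"
proof -
  have "nat (2 * int N + (int n - int i - int j)) = n + (N - i) + (N - j)"
    using assms by linarith
  then show ?thesis
    using grow_path[of i n j "N - i" "N - j"] assms
    by (simp add: spine_def hub_def weight_node)
qed

lemma path_word_normal_path: "\<forall>\<^sub>F N in sequentially. path_word (normal_path N t w t') = w"
  by (rule eventually_mono[OF path_word_word_path[of "weight (case t of (i, n, j) \<Rightarrow> node i n j)" w]])
    (simp add: normal_path_def spine_def path_word_inv split: prod.splits)

lemma path_inv_inv_squier [simp]: "path_inv KQ (path_inv KQ f) = f"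
  by (induction f) auto

lemma path_inv_word_path: "path_inv KQ (word_path N s w) = word_path N (s + word_sum w) (word_inv w)"
proof (induction w arbitrary: s)
  case (Cons c w)
  have "einv KQ (letter_edge N s c) = letter_edge N (s + letter_sum c) (flip c)"
    by (cases c) (auto simp: letter_edge_def x_edge_def algebra_simps)
  then show ?case using Cons.IH[of "s + letter_sum c"]
    by (simp add: word_path_append add.assoc)
qed simp

lemma path_inv_normal_path:
  assumes "word_sum w = weight (node i' n' j') - weight (node i n j)"
  shows "path_inv KQ (normal_path N (i, n, j) w (i', n', j')) = normal_path N (i', n', j') (word_inv w) (i, n, j)"
  using assms by (simp add: normal_path_def path_inv_word_path)

lemma normal_path_is_path:
  assumes "word_sum w = weight (node i' n' j') - weight (node i n j)"
  shows "\<forall>\<^sub>F N in sequentially. is_path KQ (node i n j) (normal_path N (i, n, j) w (i', n', j')) (node i' n' j')"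
proof -
  have "\<forall>\<^sub>F N in sequentially. i + j + i' + j' \<le> N" by (rule eventually_ge_at_top)
  with word_path_is_path[of "weight (node i n j)" w] show ?thesis
  proof eventually_elim
    case (elim N)
    then have "is_path KQ (node i n j) (spine N i n j) (hub N (weight (node i n j)))"
      "is_path KQ (node i' n' j') (spine N i' n' j') (hub N (weight (node i' n' j')))"
      by (auto intro!: spine_path)
    moreover have "weight (node i n j) + word_sum w = weight (node i' n' j')" using assms by simp
    ultimately show ?case
      using elim(1) by (auto simp: normal_path_def intro!: Q.is_path_appendI Q.is_path_inv)
  qed
qed

text \<open>Shrinking after the first path and growing before the second one cancel.\<close>

lemma normal_path_append:
  assumes v: "word_sum v = weight (node i' n' j') - weight (node i n j)"
    and w: "word_sum w = weight (node i'' n'' j'') - weight (node i' n' j')"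
  shows "\<forall>\<^sub>F N in sequentially. Q.homotopic (node i n j) (node i'' n'' j'')
    (normal_path N (i, n, j) v (i', n', j') @ normal_path N (i', n', j') w (i'', n'', j''))
    (normal_path N (i, n, j) (v @ w) (i'', n'', j''))"
proof -
  have "\<forall>\<^sub>F N in sequentially. i + j + i' + j' + i'' + j'' \<le> N" by (rule eventually_ge_at_top)
  with word_path_is_path[of "weight (node i n j)" v] word_path_is_path[of "weight (node i' n' j')" w]
  show ?thesis
  proof eventually_elim
    case (elim N)
    have S: "is_path KQ (node i n j) (spine N i n j) (hub N (weight (node i n j)))"
      "is_path KQ (node i' n' j') (spine N i' n' j') (hub N (weight (node i' n' j')))"
      "is_path KQ (node i'' n'' j'') (spine N i'' n'' j'') (hub N (weight (node i'' n'' j'')))"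
      using elim by (auto intro!: spine_path)
    have sums: "weight (node i n j) + word_sum v = weight (node i' n' j')"
      "weight (node i' n' j') + word_sum w = weight (node i'' n'' j'')"
      using v w by simp_all
    note V = elim(1)[unfolded sums] and W = elim(2)[unfolded sums]
    note VS = Q.is_path_appendI[OF S(1) V] and WS = Q.is_path_appendI[OF W Q.is_path_inv[OF S(3)]]
    from Q.homotopic_append[OF Q.homotopic_refl[OF VS]
        Q.homotopic_append[OF Q.homotopic_inv_cancel'[OF S(2)] Q.homotopic_refl[OF WS]]]
    show ?case by (simp add: normal_path_def word_path_append sums)
  qed
qed

lemma normal_pathI:
  assumes e: "is_path KQ (node i n j) [e] (node i' n' j')"
    and core: "Q.homotopic (node i n j) (hub N (weight (node i' n' j'))) (e # spine N i' n' j')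
      (spine N i n j @ word_path N (weight (node i n j)) w)"
    and N: "i' \<le> N" "j' \<le> N"
  shows "Q.homotopic (node i n j) (node i' n' j') [e] (normal_path N (i, n, j) w (i', n', j'))"
proof -
  note S = spine_path[OF N, of n']
  have "Q.homotopic (node i n j) (node i' n' j') ([e] @ [])
      ([e] @ (spine N i' n' j' @ path_inv KQ (spine N i' n' j')))"
    by (rule Q.homotopic_append[OF Q.homotopic_refl[OF e] Q.homotopic_sym[OF Q.homotopic_inv_cancel[OF S]]])
  also have "Q.homotopic (node i n j) (node i' n' j') \<dots> (normal_path N (i, n, j) w (i', n', j'))"
    using Q.homotopic_append[OF core Q.homotopic_refl[OF Q.is_path_inv[OF S]]]
    by (simp add: normal_path_def)
  finally show ?thesis by simp
qed

text \<open>The edge is the first step of growing from its source, and what follows is growing from its target.\<close>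

lemma a_edge_normal: "\<forall>\<^sub>F N in sequentially. Q.homotopic (node i n j) (node (Suc i) (Suc n) j)
    [a_edge i n j] (normal_path N (i, n, j) [] (Suc i, Suc n, j))"
  using eventually_ge_at_top[of "Suc i + j"]
proof eventually_elim
  case (elim N)
  have "N - i = Suc (N - Suc i)" using elim by simp
  then have "spine N i n j = a_edge i n j # spine N (Suc i) (Suc n) j" by (simp add: spine_def)
  moreover have "is_path KQ (node i n j) (spine N i n j) (hub N (weight (node (Suc i) (Suc n) j)))"
    using spine_path[of i N j n] elim by (simp add: weight_node)
  ultimately show ?case
    using elim by (intro normal_pathI) (auto intro: Q.homotopic_refl simp: node_vert simp del: squier_simps)
qed

text \<open>As growing starts on the left, the edge has first to be moved to the front by \<open>grow_b\<close>.\<close>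

lemma b_edge_normal: "\<forall>\<^sub>F N in sequentially. Q.homotopic (node i n j) (node i (Suc n) (Suc j))
    [b_edge i n j] (normal_path N (i, n, j) [] (i, Suc n, Suc j))"
  using eventually_ge_at_top[of "i + Suc j"]
proof eventually_elim
  case (elim N)
  have "N - j = Suc (N - Suc j)" using elim by simp
  moreover have "i + (N - i) = N" "j + Suc (N - Suc j) = N" using elim by simp_all
  moreover have "node N (n + (N - i) + Suc (N - Suc j)) N = hub N (weight (node i (Suc n) (Suc j)))"
    using elim by (simp add: hub_def weight_node) (rule arg_cong[where f = "\<lambda>k. node N k N"], linarith)
  ultimately have "Q.homotopic (node i n j) (hub N (weight (node i (Suc n) (Suc j))))
      (b_edge i n j # spine N i (Suc n) (Suc j)) (spine N i n j)"
    using Q.homotopic_sym[OF grow_b[of i n j "N - i" "N - Suc j"]] by (simp only: spine_def)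
  then show ?case
    using elim by (intro normal_pathI) (auto simp: node_vert simp del: squier_simps)
qed

lemma x_edge_normal: "\<forall>\<^sub>F N in sequentially.
    Q.homotopic (node i (Suc (k + m)) j) (node i (Suc (Suc (k + m))) j)
      [x_edge i k m j] (normal_path N (i, Suc (k + m), j) [(True, int k - int i)] (i, Suc (Suc (k + m)), j))"
  using eventually_ge_at_top[of "i + j"]
proof eventually_elim
  case (elim N)
  have ij: "i + (N - i) = N" "j + (N - j) = N" using elim by simp_all
  have "node N (Suc (Suc (k + m + (N - i) + (N - j)))) N = hub N (weight (node i (Suc (Suc (k + m))) j))"
    using elim by (simp add: hub_def weight_node) (rule arg_cong[where f = "\<lambda>k. node N k N"], linarith)
  moreover have "x_edge N (k + (N - i)) (m + (N - j)) N =
      letter_edge N (weight (node i (Suc (k + m)) j)) (True, int k - int i)"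
  proof -
    have "nat (int N + (int k - int i)) = k + (N - i)"
      "nat (int N + (int (Suc (k + m)) - int i - int j) - (int k - int i) - 1) = m + (N - j)"
      using elim by linarith+
    then show ?thesis by (simp add: letter_edge_def weight_node)
  qed
  ultimately have "Q.homotopic (node i (Suc (k + m)) j) (hub N (weight (node i (Suc (Suc (k + m))) j)))
      (x_edge i k m j # spine N i (Suc (Suc (k + m))) j)
      (spine N i (Suc (k + m)) j @ word_path N (weight (node i (Suc (k + m)) j)) [(True, int k - int i)])"
    using grow_x[of i k m j "N - i" "N - j"] unfolding ij by (simp add: spine_def)
  then show ?case
    using elim by (intro normal_pathI) (auto simp: node_vert simp del: squier_simps)
qed

lemma xpow_split: "u @ v = xpow n \<Longrightarrow> u = xpow (length u) \<and> v = xpow (length v) \<and> n = length u + length v"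
  by (metis append_eq_conv_conj drop_replicate length_append length_replicate take_replicate
      length_drop length_take)

text \<open>This and the next two lemmas locate the letter to which a relation is applied in the word of a node.\<close>

lemma node_split_x:
  assumes "p @ Lx # q = node i n j"
  obtains k m where "n = Suc (k + m)" "p = La i # xpow k" "q = xpow m @ [Lb j]"
proof -
  obtain p' where p: "p = La i # p'" "p' @ Lx # q = xpow n @ [Lb j]"
    using assms by (cases p) (auto simp: node_def)
  have "q \<noteq> []" using p(2) by auto
  then obtain q' where q: "q = q' @ [Lb j]" "p' @ Lx # q' = xpow n"
    using p(2) by (cases q rule: rev_cases) auto
  then have "p' = xpow (length p')" "Lx # q' = xpow (Suc (length q'))" "n = Suc (length p' + length q')"
    using xpow_split[OF q(2)] by auto
  then show thesis using p q by (intro that[of "length p'" "length q'"]) auto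
qed

lemma node_split_a: "p @ La i' # q = node i n j \<Longrightarrow> p = [] \<and> i' = i \<and> q = xpow n @ [Lb j]"
proof (cases p)
  case (Cons c p')
  assume "p @ La i' # q = node i n j"
  then have "p' @ La i' # q = xpow n @ [Lb j]" using Cons by (simp add: node_def)
  then have "La i' \<in> set (xpow n @ [Lb j])" by (metis in_set_conv_decomp)
  then show ?thesis by auto
qed (simp add: node_def)

lemma node_split_b:
  assumes "p @ Lb j' # q = node i n j"
  shows "p = La i # xpow n \<and> j' = j \<and> q = []"
proof -
  obtain p' where p: "p = La i # p'" "p' @ Lb j' # q = xpow n @ [Lb j]"
    using assms by (cases p) (auto simp: node_def)
  have "q = []"
  proof (cases q rule: rev_cases)
    case (snoc q' c)
    then have "p' @ Lb j' # q' = xpow n" using p by simp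
    then have "Lb j' \<in> set (xpow n)" by (metis in_set_conv_decomp)
    then show ?thesis by auto
  qed
  then show ?thesis using p by simp
qed

lemma forward_edge_normal:
  assumes "(u, v) \<in> rels Q_pres" "p @ u @ q = node i n j"
  shows "\<exists>i' n' j'. p @ v @ q = node i' n' j' \<and> (\<forall>\<^sub>F N in sequentially.
    Q.homotopic (node i n j) (node i' n' j') [(p, u, v, q)]
      (normal_path N (i, n, j) (edge_word (p, u, v, q)) (i', n', j')))"
proof -
  consider (x) "u = [Lx]" "v = [Lx, Lx]" | (a) a where "u = [La a]" "v = [La (Suc a), Lx]"
    | (b) b where "u = [Lb b]" "v = [Lx, Lb (Suc b)]"
    using assms(1) by (auto simp: rels_Q)
  then show ?thesis
  proof cases
    case x
    have "p @ Lx # q = node i n j" using assms(2) x by simp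
    from node_split_x[OF this] obtain k m
      where km: "n = Suc (k + m)" "p = La i # xpow k" "q = xpow m @ [Lb j]" by blast
    then have e: "(p, u, v, q) = x_edge i k m j" using x by (simp add: x_edge_def)
    moreover have "p @ v @ q = node i (Suc (Suc (k + m))) j" using ends_Q(6)[of i k m j] e[symmetric] by simp
    ultimately show ?thesis using x_edge_normal[of i k m j] km(1) by auto
  next
    case a
    then have "p = []" "a = i" "q = xpow n @ [Lb j]" using node_split_a[of p a q i n j] assms(2) by auto
    then have e: "(p, u, v, q) = a_edge i n j" using a by (simp add: a_edge_def)
    moreover have "p @ v @ q = node (Suc i) (Suc n) j" using ends_Q(2)[of i n j] e[symmetric] by simp
    ultimately show ?thesis using a_edge_normal[of i n j] by auto
  next
    case b
    then have "p = La i # xpow n" "b = j" "q = []" using node_split_b[of p b q i n j] assms(2) by auto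
    then have e: "(p, u, v, q) = b_edge i n j" using b by (simp add: b_edge_def)
    moreover have "p @ v @ q = node i (Suc n) (Suc j)" using ends_Q(4)[of i n j] e[symmetric] by simp
    ultimately show ?thesis using b_edge_normal[of i n j] by auto
  qed
qed

lemma backward_edge_node:
  assumes "(u, v) \<in> rels Q_pres" "p @ v @ q = node i n j"
  shows "\<exists>i' n' j'. p @ u @ q = node i' n' j'"
proof -
  consider (x) "u = [Lx]" "v = [Lx, Lx]" | (a) a where "u = [La a]" "v = [La (Suc a), Lx]"
    | (b) b where "u = [Lb b]" "v = [Lx, Lb (Suc b)]"
    using assms(1) by (auto simp: rels_Q)
  then show ?thesis
  proof cases
    case x
    then have "p @ Lx # (Lx # q) = node i n j" using assms(2) by simp
    from node_split_x[OF this] obtain k m where km: "p = La i # xpow k" "Lx # q = xpow m @ [Lb j]"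
      by blast
    then obtain m' where "q = xpow m' @ [Lb j]" by (cases m) auto
    then have "p @ u @ q = node i (Suc (k + m')) j" using km x by (simp add: node_def xpow_append)
    then show ?thesis by blast
  next
    case a
    then have *: "p = []" "Lx # q = xpow n @ [Lb j]" using node_split_a[of p "Suc a" "Lx # q" i n j] assms(2) by auto
    then obtain n' where "q = xpow n' @ [Lb j]" by (cases n) auto
    then have "p @ u @ q = node a n' j" using * a by (simp add: node_def)
    then show ?thesis by blast
  next
    case b
    then have "p @ Lx # (Lb (Suc b) # q) = node i n j" using assms(2) by simp
    from node_split_x[OF this] obtain k m where km: "p = La i # xpow k" "Lb (Suc b) # q = xpow m @ [Lb j]"
      by blast
    then have "q = []" by (cases m) auto
    then have "p @ u @ q = node i k b" using km b by (simp add: node_def)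
    then show ?thesis by blast
  qed
qed

lemma edge_normal:
  assumes "e \<in> edges KQ" "src KQ e = node i n j"
  shows "\<exists>i' n' j'. tgt KQ e = node i' n' j' \<and> (\<forall>\<^sub>F N in sequentially.
    Q.homotopic (node i n j) (node i' n' j') [e] (normal_path N (i, n, j) (edge_word e) (i', n', j')))"
proof -
  obtain p u v q where e: "e = (p, u, v, q)" by (cases e)
  consider "(u, v) \<in> rels Q_pres" | "(v, u) \<in> rels Q_pres" using assms(1) e by auto
  then show ?thesis
  proof cases
    case 1
    then show ?thesis using forward_edge_normal[of u v p q i n j] assms(2) e by simp
  next
    case 2
    then obtain i' n' j' where s: "p @ v @ q = node i' n' j'"
      using backward_edge_node[of v u p q i n j] assms(2) e by auto
    obtain k l m where t: "p @ u @ q = node k l m" and H: "\<forall>\<^sub>F N in sequentially.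
        Q.homotopic (node i' n' j') (node k l m) [(p, v, u, q)]
          (normal_path N (i', n', j') (edge_word (p, v, u, q)) (k, l, m))"
      using forward_edge_normal[OF 2 s] by blast
    have kl: "node k l m = node i n j" using t assms(2) e by simp
    then have [simp]: "k = i" "l = n" "m = j" by (simp_all add: node_inject)
    have inv: "edge_word (p, u, v, q) = word_inv (edge_word (p, v, u, q))"
      using edge_word_einv[of "(p, v, u, q)"] by simp
    have sum: "word_sum (edge_word (p, v, u, q)) = weight (node i n j) - weight (node i' n' j')"
      using word_sum_edge[of "(p, v, u, q)"] 2 s t assms(1) e by simp
    from H have "\<forall>\<^sub>F N in sequentially. Q.homotopic (node i n j) (node i' n' j') [e]
        (normal_path N (i, n, j) (edge_word e) (i', n', j'))"
    proof eventually_elim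
      case (elim N)
      from Q.homotopic_path_inv[OF elim] show ?case
        unfolding inv e by (simp add: path_inv_normal_path[OF sum])
    qed
    then show ?thesis using s e by auto
  qed
qed

text \<open>The normal form depends on the path only through its end points and its caret word. This is what
reduces homotopy of loops to equality in the group presented by carets.\<close>

theorem path_normal:
  assumes "is_path KQ (node i n j) f w"
  shows "\<exists>i' n' j'. w = node i' n' j' \<and> (\<forall>\<^sub>F N in sequentially.
    Q.homotopic (node i n j) w f (normal_path N (i, n, j) (path_word f) (i', n', j')))"
  using assms
proof (induction f arbitrary: i n j)
  case Nil
  have "\<forall>\<^sub>F N in sequentially. Q.homotopic (node i n j) (node i n j) [] (normal_path N (i, n, j) [] (i, n, j))"
    using eventually_ge_at_top[of "i + j"]
  proof eventually_elim
    case (elim N)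
    then show ?case
      using Q.homotopic_sym[OF Q.homotopic_inv_cancel[OF spine_path[of i N j n]]]
      by (simp add: normal_path_def)
  qed
  then show ?case using Nil by auto
next
  case (Cons e f)
  then have e: "e \<in> edges KQ" "src KQ e = node i n j" and f: "is_path KQ (tgt KQ e) f w" by simp_all
  obtain i' n' j' where t: "tgt KQ e = node i' n' j'" and E: "\<forall>\<^sub>F N in sequentially.
      Q.homotopic (node i n j) (node i' n' j') [e] (normal_path N (i, n, j) (edge_word e) (i', n', j'))"
    using edge_normal[OF e] by blast
  obtain i'' n'' j'' where w: "w = node i'' n'' j''" and F: "\<forall>\<^sub>F N in sequentially.
      Q.homotopic (node i' n' j') w f (normal_path N (i', n', j') (path_word f) (i'', n'', j''))"
    using Cons.IH f t by metis
  have "word_sum (edge_word e) = weight (node i' n' j') - weight (node i n j)"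
    using word_sum_edge[OF e(1)] e t by simp
  moreover have "word_sum (path_word f) = weight (node i'' n'' j'') - weight (node i' n' j')"
    using word_sum_path[OF f] w t by simp
  ultimately have A: "\<forall>\<^sub>F N in sequentially. Q.homotopic (node i n j) w
      (normal_path N (i, n, j) (edge_word e) (i', n', j') @ normal_path N (i', n', j') (path_word f) (i'', n'', j''))
      (normal_path N (i, n, j) (edge_word e @ path_word f) (i'', n'', j''))"
    unfolding w by (rule normal_path_append)
  have "\<forall>\<^sub>F N in sequentially. Q.homotopic (node i n j) w (e # f)
      (normal_path N (i, n, j) (path_word (e # f)) (i'', n'', j''))"
    using E F A
  proof eventually_elim
    case (elim N)
    from Q.homotopic_trans[OF Q.homotopic_append[OF elim(1,2)] elim(3)] show ?case by simp
  qed
  then show ?case using w by blast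
qed

section \<open>Loops and their caret words\<close>

text \<open>When both relations are $x = xx$, the word is an instance of \<open>swap\<close>: the piece \<open>z\<close> between them
consists of letters $x$, so that the second splitting takes place further right. If one relation
concerns $a$ or $b$, it has no letter, and it preserves the weight of what precedes the other one.\<close>

lemma cell_word:
  assumes "(l1, r1) \<in> rels Q_pres" "(l2, r2) \<in> rels Q_pres" "p @ l1 @ z @ l2 @ q = node i n j"
  shows "path_word [(p, l1, r1, z @ l2 @ q), (p @ r1 @ z, l2, r2, q), (p, r1, l1, z @ r2 @ q), (p @ l1 @ z, r2, l2, q)] \<doteq> []"
proof -
  have other: "edge_word (p', u, v, q') = []" "edge_word (p', v, u, q') = []" "weight u = weight v"
    if "(u, v) \<in> rels Q_pres" "u \<noteq> [Lx]" for p' u v q'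
    using that by (auto simp: rels_Q edge_word_def)
  have xx: "v = [Lx, Lx]" if "([Lx], v) \<in> rels Q_pres" for v using that by (auto simp: rels_Q)
  have cancel: "[(True, m), (False, m)] \<doteq> []" for m using word_eq.cancel[of "(True, m)"] by simp
  consider "l1 \<noteq> [Lx]" "l2 \<noteq> [Lx]" | "l1 = [Lx]" "l2 \<noteq> [Lx]" | "l1 \<noteq> [Lx]" "l2 = [Lx]"
    | "l1 = [Lx]" "l2 = [Lx]" by blast
  then show ?thesis
  proof cases
    case 1
    then show ?thesis using other assms by (simp add: word_eq.refl)
  next
    case 2
    then have "r1 = [Lx, Lx]" using xx assms by blast
    then show ?thesis using 2 other[of l2 r2] assms cancel by (simp add: edge_word_def)
  next
    case 3
    then have "r2 = [Lx, Lx]" using xx assms by blast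
    then show ?thesis using 3 other[of l1 r1] assms cancel by (simp add: edge_word_def)
  next
    case 4
    then have r: "r1 = [Lx, Lx]" "r2 = [Lx, Lx]" using xx assms by blast+
    have "p @ Lx # (z @ l2 @ q) = node i n j" "(p @ Lx # z) @ Lx # q = node i n j"
      using assms(3) 4 by simp_all
    then obtain k k' where km: "p = La i # xpow k" and "p @ Lx # z = La i # xpow k'"
      using node_split_x by metis
    then have "xpow k @ Lx # z = xpow k'" using km by simp
    then have "Lx # z = xpow (Suc (length z))" using xpow_split by force
    then have "z = xpow (length z)" by simp
    then have "0 \<le> weight z" using weight_simps(4)[of "length z"] by simp
    define a where "a = weight p"
    define c where "c = weight p + 1 + weight z"
    have "a < c" using \<open>0 \<le> weight z\<close> by (simp add: a_def c_def)
    have "path_word [(p, l1, r1, z @ l2 @ q), (p @ r1 @ z, l2, r2, q), (p, r1, l1, z @ r2 @ q), (p @ l1 @ z, r2, l2, q)]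
        = [(True, a), (True, c + 1)] @ word_inv [(True, c), (True, a)]"
      using 4 r by (simp add: edge_word_def a_def c_def)
    also have "\<dots> \<doteq> [(True, c), (True, a)] @ word_inv [(True, c), (True, a)]"
      by (intro word_eq.append word_eq.refl word_eq.sym[OF word_eq.swap] \<open>a < c\<close>)
    also have "\<dots> \<doteq> []" by (rule word_eq_inv_cancel)
    finally show ?thesis .
  qed
qed

abbreviation "loops_Q \<equiv> loops KQ [La 0, Lb 0]"
abbreviation "homotopic_Q \<equiv> homotopic_loops KQ [La 0, Lb 0]"

lemma base_node: "[La 0, Lb 0] = node 0 0 0"
  by (simp add: node_def)

lemma path_word_invariant: "homotopic_Q f g \<Longrightarrow> path_word f \<doteq> path_word g"
proof (induction rule: homotopic_loops.induct)
  case (cancel f e g)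
  have "path_word [e, einv KQ e] \<doteq> []"
    using word_eq_inv_cancel[of "edge_word e"] by (simp add: edge_word_einv del: squier_simps)
  from word_eq_context[OF this, of "path_word f" "path_word g"] show ?case by simp
next
  case (cell c f g)
  then obtain u v where "is_path KQ [La 0, Lb 0] f u" and c: "is_path KQ u c v"
    by (auto simp: loops_def Q.is_path_append)
  then obtain i n j where u: "u = node i n j" using path_normal unfolding base_node by blast
  obtain p z q l1 r1 l2 r2 where "c = [(p, l1, r1, z @ l2 @ q), (p @ r1 @ z, l2, r2, q),
      (p, r1, l1, z @ r2 @ q), (p @ l1 @ z, r2, l2, q)]"
    "(l1, r1) \<in> rels Q_pres" "(l2, r2) \<in> rels Q_pres"
    using cell(1) by (auto simp: squier_cells)
  then have "path_word c \<doteq> []" using cell_word[of l1 r1 l2 r2 p z q i n j] c u by auto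
  from word_eq_context[OF this, of "path_word f" "path_word g"] show ?case by simp
qed (auto intro: word_eq.intros)

theorem homotopic_iff_word_map:
  assumes "f \<in> loops_Q" "g \<in> loops_Q"
  shows "homotopic_Q f g \<longleftrightarrow> word_map (path_word f) = word_map (path_word g)"
proof
  assume "homotopic_Q f g"
  then show "word_map (path_word f) = word_map (path_word g)"
    by (intro word_map_respects path_word_invariant)
next
  assume "word_map (path_word f) = word_map (path_word g)"
  then have eq: "path_word f \<doteq> path_word g" by (rule word_map_faithful)
  have f: "is_path KQ (node 0 0 0) f (node 0 0 0)" and g: "is_path KQ (node 0 0 0) g (node 0 0 0)"
    using assms by (simp_all add: loops_def base_node)
  have nf: "\<forall>\<^sub>F N in sequentially. Q.homotopic (node 0 0 0) (node 0 0 0) h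
      (normal_path N (0, 0, 0) (path_word h) (0, 0, 0))" if h: "is_path KQ (node 0 0 0) h (node 0 0 0)" for h
  proof -
    obtain i' n' j' where "node 0 0 0 = node i' n' j'" and H: "\<forall>\<^sub>F N in sequentially.
        Q.homotopic (node 0 0 0) (node 0 0 0) h (normal_path N (0, 0, 0) (path_word h) (i', n', j'))"
      using path_normal[OF h] by blast
    then have "i' = 0" "n' = 0" "j' = 0" by (simp_all add: node_inject)
    then show ?thesis using H by simp
  qed
  have sum: "word_sum (path_word f) = 0" using word_sum_path[OF f] by simp
  have "\<forall>\<^sub>F N in sequentially. Q.homotopic (hub N 0) (hub N (0 + word_sum (path_word f)))
      (word_path N 0 (path_word f)) (word_path N 0 (path_word g))"
    using word_path_respects[OF eq] by blast
  with nf[OF f] nf[OF g] have "\<forall>\<^sub>F N in sequentially. Q.homotopic (node 0 0 0) (node 0 0 0) f g"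
  proof eventually_elim
    case (elim N)
    have S: "is_path KQ (node 0 0 0) (spine N 0 0 0) (hub N 0)"
      using spine_path[of 0 N 0 0] by (simp add: weight_node)
    have "Q.homotopic (node 0 0 0) (node 0 0 0)
        (normal_path N (0, 0, 0) (path_word f) (0, 0, 0)) (normal_path N (0, 0, 0) (path_word g) (0, 0, 0))"
      using Q.homotopic_append[OF Q.homotopic_refl[OF S]
          Q.homotopic_append[OF elim(3)[unfolded sum] Q.homotopic_refl[OF Q.is_path_inv]]] S
      by (simp add: normal_path_def weight_node)
    then show ?case using elim(1,2) Q.homotopic_sym Q.homotopic_trans by blast
  qed
  then have "Q.homotopic (node 0 0 0) (node 0 0 0) f g" by simp
  then show "homotopic_Q f g" using Q.homotopic_imp_loops by (simp add: base_node)
qed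

text \<open>The normal path from the base vertex to itself.\<close>

lemma loop_with_word:
  assumes "word_sum w = 0" shows "\<exists>f\<in>loops_Q. path_word f = w"
proof -
  have "\<forall>\<^sub>F N in sequentially. is_path KQ (node 0 0 0) (normal_path N (0, 0, 0) w (0, 0, 0)) (node 0 0 0) \<and>
      path_word (normal_path N (0, 0, 0) w (0, 0, 0)) = w"
    using normal_path_is_path[of w 0 0 0 0 0 0] path_word_normal_path[of "(0, 0, 0)" w "(0, 0, 0)"] assms
    by (simp add: eventually_conj)
  then obtain N where "is_path KQ (node 0 0 0) (normal_path N (0, 0, 0) w (0, 0, 0)) (node 0 0 0)"
    "path_word (normal_path N (0, 0, 0) w (0, 0, 0)) = w"
    using eventually_happens'[OF trivial_limit_sequentially] by blast
  then show ?thesis by (auto simp: loops_def base_node)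
qed

lemma word_sum_loop: "f \<in> loops_Q \<Longrightarrow> word_sum (path_word f) = 0"
  using word_sum_path[of "[La 0, Lb 0]" f "[La 0, Lb 0]"] by (simp add: loops_def)


section \<open>The isomorphism\<close>

definition loop_map :: "letter sq_edge list \<Rightarrow> real \<Rightarrow> real" where
  "loop_map f = transport (word_map (path_word f))"

lemma loop_map_derived: "f \<in> loops_Q \<Longrightarrow> loop_map f \<in> derived thompson_F (carrier thompson_F)"
  unfolding loop_map_def by (intro transport_word_derived word_sum_loop)

lemma loop_map_surj:
  assumes "g \<in> derived thompson_F (carrier thompson_F)"
  shows "\<exists>f\<in>loops_Q. loop_map f = g"
proof -
  obtain w where w: "word_sum w = 0" "g = transport (word_map w)"
    using assms unfolding derived_eq_words by blast
  obtain f where "f \<in> loops_Q" "path_word f = w" using loop_with_word[OF w(1)] by blast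
  then show ?thesis using w by (auto simp: loop_map_def)
qed

lemma loop_map_eq_iff:
  assumes "f \<in> loops_Q" "g \<in> loops_Q"
  shows "loop_map f = loop_map g \<longleftrightarrow> homotopic_Q f g"
  unfolding homotopic_iff_word_map[OF assms] loop_map_def using transport_inj by auto

lemma loop_map_append: "loop_map (f @ g) = loop_map f \<otimes>\<^bsub>thompson_F\<^esub> loop_map g"
  using transport_word_map by (simp add: loop_map_def transport_comp)

lemma commutator_subgroup_iso_diagram_group:
  "commutator_subgroup thompson_F \<cong> diagram_group Q_pres [La 0, Lb 0]"
proof (rule is_isoI, rule isoI)
  let ?D = "derived thompson_F (carrier thompson_F)"
  let ?cls = "\<lambda>f. loop_rel KQ [La 0, Lb 0] `` {f}"
  \<comment> \<open>Any choice of a loop for each element works: two loops with the same action are homotopic.\<close>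
  define rep where "rep g = (SOME f. f \<in> loops_Q \<and> loop_map f = g)" for g
  have rep: "rep g \<in> loops_Q" "loop_map (rep g) = g" if "g \<in> ?D" for g
    using someI_ex[of "\<lambda>f. f \<in> loops_Q \<and> loop_map f = g"] loop_map_surj[OF that]
    by (auto simp: rep_def)
  have cls_eq: "?cls f = ?cls g \<longleftrightarrow> loop_map f = loop_map g" if "f \<in> loops_Q" "g \<in> loops_Q" for f g
    using eq_equiv_class_iff[OF Q.equiv_loop_rel that] loop_map_eq_iff[OF that]
    by (simp add: loop_rel_def)
  have carrier_F': "carrier (commutator_subgroup thompson_F) = ?D"
    and mult_F': "mult (commutator_subgroup thompson_F) = mult thompson_F"
    by (simp_all add: commutator_subgroup_def)
  have carrier_D: "carrier (diagram_group Q_pres [La 0, Lb 0]) = loops_Q // loop_rel KQ [La 0, Lb 0]"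
    by (simp add: diagram_group_def pi1_def)
  have mult_D: "?cls f \<otimes>\<^bsub>diagram_group Q_pres [La 0, Lb 0]\<^esub> ?cls g = ?cls (f @ g)"
    if fg: "f \<in> loops_Q" "g \<in> loops_Q" for f g
    unfolding diagram_group_def by (rule Q.pi1_mult[OF fg])
  show "(\<lambda>g. ?cls (rep g)) \<in> hom (commutator_subgroup thompson_F) (diagram_group Q_pres [La 0, Lb 0])"
  proof (rule homI)
    fix g assume "g \<in> carrier (commutator_subgroup thompson_F)"
    then show "?cls (rep g) \<in> carrier (diagram_group Q_pres [La 0, Lb 0])"
      using rep unfolding carrier_F' carrier_D by (intro quotientI)
  next
    fix g h assume "g \<in> carrier (commutator_subgroup thompson_F)" "h \<in> carrier (commutator_subgroup thompson_F)"
    then have gh: "g \<in> ?D" "h \<in> ?D" by (simp_all only: carrier_F')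
    then have "g \<otimes>\<^bsub>thompson_F\<^esub> h \<in> ?D"
      using group.derived_is_subgroup[OF group_thompson_F order_refl]
      by (meson subgroup.m_closed)
    then have "?cls (rep (g \<otimes>\<^bsub>thompson_F\<^esub> h)) = ?cls (rep g @ rep h)"
      using rep gh by (subst cls_eq) (simp_all only: loop_map_append Q.loops_append)
    then show "?cls (rep (g \<otimes>\<^bsub>commutator_subgroup thompson_F\<^esub> h)) =
        ?cls (rep g) \<otimes>\<^bsub>diagram_group Q_pres [La 0, Lb 0]\<^esub> ?cls (rep h)"
      using mult_D rep gh by (simp only: mult_F')
  qed
  show "bij_betw (\<lambda>g. ?cls (rep g)) (carrier (commutator_subgroup thompson_F))
      (carrier (diagram_group Q_pres [La 0, Lb 0]))"
    unfolding bij_betw_def carrier_F' carrier_D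
  proof
    show "inj_on (\<lambda>g. ?cls (rep g)) ?D"
    proof (rule inj_onI)
      fix g h assume gh: "g \<in> ?D" "h \<in> ?D" and "?cls (rep g) = ?cls (rep h)"
      then have "loop_map (rep g) = loop_map (rep h)" using cls_eq rep by blast
      then show "g = h" using rep gh by simp
    qed
    show "(\<lambda>g. ?cls (rep g)) ` ?D = loops_Q // loop_rel KQ [La 0, Lb 0]"
    proof (rule equalityI; rule subsetI)
      fix X assume "X \<in> (\<lambda>g. ?cls (rep g)) ` ?D"
      then show "X \<in> loops_Q // loop_rel KQ [La 0, Lb 0]" using rep by (auto intro: quotientI)
    next
      fix X assume "X \<in> loops_Q // loop_rel KQ [La 0, Lb 0]"
      then obtain f where f: "f \<in> loops_Q" "X = ?cls f" by (auto elim: quotientE)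
      then have "X = ?cls (rep (loop_map f))"
        using cls_eq rep loop_map_derived by metis
      then show "X \<in> (\<lambda>g. ?cls (rep g)) ` ?D" using loop_map_derived[OF f(1)] by blast
    qed
  qed
qed

theorem theorem26:
  shows "is_diagram_group TYPE(letter) (commutator_subgroup thompson_F) \<and>
    commutator_subgroup thompson_F \<cong> diagram_group Q_pres [La 0, Lb 0]"
proof
  show iso: "commutator_subgroup thompson_F \<cong> diagram_group Q_pres [La 0, Lb 0]"
    by (rule commutator_subgroup_iso_diagram_group)
  show "is_diagram_group TYPE(letter) (commutator_subgroup thompson_F)"
    unfolding is_diagram_group_def
    using iso semigroup_presentation_Q_pres by (intro exI[of _ Q_pres] exI[of _ "[La 0, Lb 0]"]) auto
qed

end
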